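(* Let $L\ge 0$ be an integer, let $\lambda_0>0$, $h_0>0$, $h_\ell\ge 0$ for $1\le \ell\le L$, with $\sum_{\ell=0}^L h_\ell=1$, let $0\le A<\infty$ and $P_{\rm avg}\ge 0$. Consider the finite-memory Poisson channel in which, given the input sequence $(X_k)_{k\in\mathbb Z}$, the outputs $(Y_k)_{k\in\mathbb Z}$ are conditionally independent with $Y_k\mid X_{k-L}^k\sim\operatorname{Poisson}\bigl(\lambda_0+\sum_{\ell=0}^L h_\ell X_{k-\ell}\bigr)$, under the peak and average constraints $0\le X_k\le A$ and $\mathbb E[X_k]\le P_{\rm avg}$. Let $\mathcal P_A(P_{\rm avg})$ be the set of Borel probability measures $F$ on $[0,A]$ with $\int x\,dF(x)\le P_{\rm avg}$. Then every $F^\star\in\mathcal P_A(P_{\rm avg})$ that maximizes the stationary mutual information rate $\mathcal I(F)$ over $F\in\mathcal P_A(P_{\rm avg})$ has finite support on $[0,A]$.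
   Context: For a Borel probability measure $F$ on $[0,A]$, the subscript $F$ on $\mathbb P,\mathbb E,H,I$ means evaluation when $(X_k)_{k\in\mathbb Z}$ is i.i.d. with marginal law $F$ and the outputs $Y_k\in\mathbb N_0=\{0,1,2,\dots\}$ are generated by the channel. Write $Z_k=\lambda_0+\sum_{\ell=0}^L h_\ell X_{k-\ell}$, $X_i^j=(X_i,\dots,X_j)$, $Y_i^j=(Y_i,\dots,Y_j)$. Logarithms are natural. The stationary mutual information rate is $$\mathcal I(F)=\lim_{n\to\infty}\frac1n I_F(X_1^n;Y_1^n)=h_F(\mathbf Y)-h_F(\mathbf Y|\mathbf X),$$ where $h_F(\mathbf Y)=H_F(Y_0\mid Y_{-\infty}^{-1})$ is the output entropy rate, $h_F(\mathbf Y|\mathbf X)=\mathbb E_F[\phi(Z_0)]$, and $\phi(z)=z-z\log z+\sum_{m\ge 0}\frac{e^{-z}z^m}{m!}\log(m!)$ is the Shannon entropy of a Poisson random variable with mean $z>0$. Support means closed support. *)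

theory Defs
  imports "HOL-Probability.Probability"
begin

text \<open>
  Borel probability measures on \<open>[0,A]\<close>. The carrier of such a measure is the interval itself
  rather than the real line: \<open>poisson_pmf\<close> is unspecified for non-positive rates, so the channel
  is a measurable kernel on sequences in \<open>[0,A]\<close> but not on arbitrary real sequences.
\<close>

definition input_laws :: "real \<Rightarrow> real \<Rightarrow> real measure set" where
  "input_laws A Pavg =
     {F \<in> space (prob_algebra (restrict_space borel {0..A})). (\<integral>x. x \<partial>F) \<le> Pavg}"

text \<open>
  Neighbourhoods are taken relative to the carrier; for the closed carrier \<open>[0,A]\<close> this is the
  usual closed support on the real line.
\<close>

definition closed_support :: "'a::topological_space measure \<Rightarrow> 'a set" where
  "closed_support F = {x \<in> space F. \<forall>U. open U \<longrightarrow> x \<in> U \<longrightarrow> emeasure F (U \<inter> space F) > 0}"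

definition intensity :: "real \<Rightarrow> (nat \<Rightarrow> real) \<Rightarrow> nat \<Rightarrow> (int \<Rightarrow> real) \<Rightarrow> int \<Rightarrow> real" where
  "intensity lam0 h L x k = lam0 + (\<Sum>l\<le>L. h l * x (k - int l))"

text \<open>Conditional law of the output sequence given the input sequence \<open>x\<close>.\<close>

definition poisson_channel ::
    "real \<Rightarrow> (nat \<Rightarrow> real) \<Rightarrow> nat \<Rightarrow> (int \<Rightarrow> real) \<Rightarrow> (int \<Rightarrow> nat) measure" where
  "poisson_channel lam0 h L x =
     (\<Pi>\<^sub>M k\<in>UNIV. measure_pmf (poisson_pmf (intensity lam0 h L x k)))"

text \<open>Joint law of the input and output sequences for an i.i.d. input with marginal law \<open>F\<close>.\<close>

definition channel_law ::
    "real \<Rightarrow> (nat \<Rightarrow> real) \<Rightarrow> nat \<Rightarrow> real measure \<Rightarrow> ((int \<Rightarrow> real) \<times> (int \<Rightarrow> nat)) measure" where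
  "channel_law lam0 h L F =
     (\<Pi>\<^sub>M k\<in>(UNIV::int set). F) \<bind> (\<lambda>x. poisson_channel lam0 h L x \<bind> (\<lambda>y.
       return ((\<Pi>\<^sub>M k\<in>UNIV. F) \<Otimes>\<^sub>M (\<Pi>\<^sub>M k\<in>UNIV. count_space UNIV)) (x, y)))"

text \<open>
  \<open>I\<^sub>F(X\<^sub>1\<^sup>n; Y\<^sub>1\<^sup>n)\<close> in nats. The two product measures given as arguments only provide the sigma-algebras
  of the blocks; the laws of the blocks are those induced by \<open>channel_law\<close>.
\<close>

definition block_information ::
    "real \<Rightarrow> (nat \<Rightarrow> real) \<Rightarrow> nat \<Rightarrow> real measure \<Rightarrow> nat \<Rightarrow> real" where
  "block_information lam0 h L F n =
     prob_space.mutual_information (channel_law lam0 h L F) (exp 1)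
       (\<Pi>\<^sub>M k\<in>{1..int n}. F) (\<Pi>\<^sub>M k\<in>{1..int n}. count_space UNIV)
       (\<lambda>(x, y). restrict x {1..int n}) (\<lambda>(x, y). restrict y {1..int n})"

definition information_rate ::
    "real \<Rightarrow> (nat \<Rightarrow> real) \<Rightarrow> nat \<Rightarrow> real measure \<Rightarrow> real" where
  "information_rate lam0 h L F = lim (\<lambda>n. block_information lam0 h L F n / real n)"

end

theory Submission
  imports Defs "HOL-Complex_Analysis.Complex_Analysis" "HOL-Real_Asymp.Real_Asymp"
begin

text \<open>
  If \<open>F\<close> is optimal, perturb it to \<open>(1 + t g) F\<close> with \<open>g\<close> bounded and orthogonal to \<open>1\<close> and \<open>u\<close>;
  the mean is unchanged.  Outputs more than \<open>L\<close> steps apart are independent, so block information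
  differs from \<open>n\<close> times the rate by a constant that does not depend on \<open>F\<close>.  Hence it suffices to expand the
  information of a block of length \<open>n\<close> at \<open>t = \<kappa> / n\<close>; no mixing estimate for the output
  process is needed.  Changing the input at time \<open>k\<close> only affects the outputs in the window
  \<open>{k..k + L}\<close>, whose score against the output with the window set to zero is at most linear
  in the outputs.  So the first-order term is \<open>\<kappa> \<integral> g i\<^sub>n dF\<close> for influence functions \<open>i\<^sub>n\<close> that
  extend holomorphically to a neighbourhood of \<open>[0, \<infinity>)\<close> and are locally bounded there uniformly in \<open>n\<close>.
  By optimality every limit \<open>i\<close> of the \<open>i\<^sub>n\<close> is affine on the support of \<open>F\<close>.  If the support is
  infinite, \<open>i\<close> is affine on \<open>[0, \<infinity>)\<close>, but \<open>i(u)\<close> grows faster than any linear function,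
  because the relative entropy of a Poisson law grows superlinearly in its rate.
\<close>

section \<open>Infinite products of probability measures\<close>

text \<open>Differentiating the rate in the input law would exchange a derivative with the limit
  over blocks. At \<open>t = \<kappa> / n\<close> this does not arise: the chi-square divergence
  between the tilted and the original block of inputs is of order
  \<open>\<kappa>\<^sup>2 / n\<close>, and the error of linearising the information is of order
  \<open>\<kappa>\<^sup>2 / sqrt n\<close>. The log-density of a block has the size of the block, so
  the influence of one input has to be isolated before anything is estimated. Zero outputs are the
  right reference because a Poisson likelihood at \<open>m\<close> is its value at 0 times a
  constant and \<open>z ^ m\<close>, and \<open>lam0 > 0\<close> keeps \<open>ln z\<close> bounded.
  The resulting score depends on the outputs alone and is bounded without a constant term. Hence its
  expectation stays linear in \<open>u\<close> when the input at time \<open>k\<close> is moved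
  beyond \<open>A\<close>, whereas \<open>h 0 > 0\<close> forces the output at time \<open>k\<close>
  to have rate at least \<open>h 0 * u\<close>. The affine function in the optimality condition
  plays the part of the Lagrange multipliers for total mass and mean.\<close>

lemma distr_PiM_restrict:
  assumes "\<And>i. prob_space (M i)" "finite J"
  shows "distr (PiM UNIV M) (PiM J M) (\<lambda>x. restrict x J) = PiM J M"
proof -
  interpret product_prob_space M UNIV
    using assms(1) by (simp add: product_prob_space_def product_prob_space_axioms_def product_sigma_finite_def prob_space_imp_sigma_finite)
  show ?thesis using assms(2) by (rule distr_PiM_restrict_finite) simp
qed

lemma nn_integral_PiM_prod:
  assumes M: "\<And>i. prob_space (M i)" and J: "finite J"
    and f: "\<And>i. i \<in> J \<Longrightarrow> f i \<in> borel_measurable (M i)"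
  shows "(\<integral>\<^sup>+x. (\<Prod>i\<in>J. f i (x i)) \<partial>PiM UNIV M) = (\<Prod>i\<in>J. \<integral>\<^sup>+u. f i u \<partial>M i)"
proof -
  interpret product_prob_space M UNIV
    using M by (simp add: product_prob_space_def product_prob_space_axioms_def product_sigma_finite_def prob_space_imp_sigma_finite)
  have f': "(\<lambda>x. \<Prod>i\<in>J. f i (x i)) \<in> borel_measurable (PiM J M)"
    using f by measurable
  have "(\<integral>\<^sup>+x. (\<Prod>i\<in>J. f i (x i)) \<partial>PiM UNIV M) =
        (\<integral>\<^sup>+x. (\<Prod>i\<in>J. f i (x i)) \<partial>distr (PiM UNIV M) (PiM J M) (\<lambda>x. restrict x J))"
    using f' by (subst nn_integral_distr) (auto intro!: measurable_restrict_subset)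
  also have "\<dots> = (\<integral>\<^sup>+x. (\<Prod>i\<in>J. f i (x i)) \<partial>PiM J M)"
    using distr_PiM_restrict[of M J] M J by simp
  also have "\<dots> = (\<Prod>i\<in>J. \<integral>\<^sup>+u. f i u \<partial>M i)"
    using J f by (rule product_nn_integral_prod)
  finally show ?thesis .
qed

text \<open>Both sides agree on cylinders by Fubini; a tilted coordinate that the cylinder leaves
  free contributes the factor 1 by \<open>w1\<close>. The lemma serves the outputs (from rate 1 to
  the channel rates) and the inputs (from \<open>F\<close> to its tilt). Only finitely many
  coordinates are tilted, because infinite products of different laws are in general mutually
  singular.\<close>

lemma density_PiM:
  fixes w :: "'i \<Rightarrow> 'a \<Rightarrow> ennreal"
  assumes M: "\<And>i. prob_space (M i)" and J: "finite J"
    and w: "\<And>i. i \<in> J \<Longrightarrow> w i \<in> borel_measurable (M i)"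
    and w1: "\<And>i. i \<in> J \<Longrightarrow> (\<integral>\<^sup>+u. w i u \<partial>M i) = 1"
  shows "density (PiM UNIV M) (\<lambda>x. \<Prod>i\<in>J. w i (x i)) =
    PiM UNIV (\<lambda>i. if i \<in> J then density (M i) (w i) else M i)" (is "?D = PiM UNIV ?N")
proof -
  have N: "prob_space (?N i)" for i
    using M w w1 by (auto intro!: prob_spaceI simp: emeasure_density cong: nn_integral_cong simp: prob_space.emeasure_space_1[OF M])
  have wm[measurable]: "(\<lambda>x. \<Prod>i\<in>J. w i (x i)) \<in> borel_measurable (PiM UNIV M)"
    using w by measurable
  have sN: "sets (PiM UNIV ?N) = sets (PiM UNIV M)"
    by (rule sets_PiM_cong) auto
  show ?thesis
  proof (rule measure_eqI_PiM_infinite[symmetric])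
    show "sets (PiM UNIV ?N) = sets (PiM UNIV M)" by fact
    show "sets ?D = sets (PiM UNIV M)" by simp
    show "finite_measure (PiM UNIV ?N)"
      by (intro prob_space.finite_measure prob_space_PiM N)
    fix A K assume K: "finite K" "K \<subseteq> (UNIV::'i set)" and A: "\<And>i. i \<in> K \<Longrightarrow> A i \<in> sets (M i)"
    let ?B = "prod_emb UNIV M K (Pi\<^sub>E K A)"
    have B: "?B \<in> sets (PiM UNIV M)"
      using K A by (intro sets_PiM_I) auto
    have emb: "?B = prod_emb UNIV ?N K (Pi\<^sub>E K A)"
      by (auto simp: prod_emb_def PiE_iff Pi_iff split: if_splits)
    have "emeasure (PiM UNIV ?N) ?B = (\<Prod>i\<in>K. emeasure (?N i) (A i))"
      unfolding emb using K A N by (subst emeasure_PiM_emb) auto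
    also have "\<dots> = (\<Prod>i\<in>K. \<integral>\<^sup>+u. (if i \<in> J then w i u else 1) * indicator (A i) u \<partial>M i)"
      using A w by (intro prod.cong) (auto simp: emeasure_density nn_integral_indicator)
    also have "\<dots> = (\<Prod>i\<in>K \<union> J. \<integral>\<^sup>+u. (if i \<in> J then w i u else 1) * (if i \<in> K then indicator (A i) u else 1) \<partial>M i)"
      using K J w1 by (intro prod.mono_neutral_cong_left) auto
    also have "\<dots> = (\<integral>\<^sup>+x. (\<Prod>i\<in>K \<union> J. (if i \<in> J then w i (x i) else 1) * (if i \<in> K then indicator (A i) (x i) else 1)) \<partial>PiM UNIV M)"
    proof (rule nn_integral_PiM_prod[OF M, symmetric])
      fix i assume "i \<in> K \<union> J"
      show "(\<lambda>u. (if i \<in> J then w i u else 1) * (if i \<in> K then indicator (A i) u else 1)) \<in> borel_measurable (M i)"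
        using w[of i] A[of i] by (cases "i \<in> J"; cases "i \<in> K") simp_all
    qed (use K J in simp)
    also have "\<dots> = (\<integral>\<^sup>+x. (\<Prod>i\<in>J. w i (x i)) * indicator ?B x \<partial>PiM UNIV M)"
    proof (rule nn_integral_cong)
      fix x assume x: "x \<in> space (PiM UNIV M)"
      have 1: "(\<Prod>i\<in>K \<union> J. (if i \<in> J then w i (x i) else 1)) = (\<Prod>i\<in>J. w i (x i))"
        using K J by (intro prod.mono_neutral_cong_right) auto
      have 2: "(\<Prod>i\<in>K \<union> J. (if i \<in> K then indicator (A i) (x i) else 1)) = (\<Prod>i\<in>K. (indicator (A i) (x i) :: ennreal))"
        using K J by (intro prod.mono_neutral_cong_right) auto
      have 3: "(\<Prod>i\<in>K. (indicator (A i) (x i) :: ennreal)) = indicator ?B x"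
      proof (cases "\<forall>i\<in>K. x i \<in> A i")
        case True
        then have "x \<in> ?B" using x by (simp add: prod_emb_iff space_PiM PiE_iff)
        then show ?thesis using True by simp
      next
        case False
        then have "x \<notin> ?B" by (auto simp add: prod_emb_iff PiE_iff)
        then show ?thesis using False K(1) by (auto simp: prod_zero_iff indicator_def)
      qed
      show "(\<Prod>i\<in>K \<union> J. (if i \<in> J then w i (x i) else 1) * (if i \<in> K then indicator (A i) (x i) else 1)) = (\<Prod>i\<in>J. w i (x i)) * indicator ?B x"
        unfolding prod.distrib 1 2 3 ..
    qed
    also have "\<dots> = emeasure ?D ?B"
      using B by (subst emeasure_density) auto
    finally show "emeasure (PiM UNIV ?N) ?B = emeasure ?D ?B" .
  qed
qed

text \<open>Dependence is stated pointwise instead of through a sub-sigma-algebra. It is relative to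
  a carrier \<open>S\<close>, since functions of the input are controlled only on sequences with
  values in \<open>[0,A]\<close>.\<close>

definition depends_on :: "'i set \<Rightarrow> ('i \<Rightarrow> 'a) set \<Rightarrow> (('i \<Rightarrow> 'a) \<Rightarrow> 'b) \<Rightarrow> bool" where
  "depends_on B S f \<longleftrightarrow> (\<forall>x\<in>S. \<forall>y\<in>S. (\<forall>i\<in>B. x i = y i) \<longrightarrow> f x = f y)"

text \<open>The function factors through the finite product over \<open>B\<close>, on which both
  measures have the same image. This is what replaces an infinite product by one that differs from a
  reference measure in finitely many coordinates only and thus has a density.\<close>

lemma integral_PiM_depends_on:
  fixes f :: "('i \<Rightarrow> 'a) \<Rightarrow> real"
  assumes M: "\<And>i. prob_space (M i)" and N: "\<And>i. prob_space (N i)" and B: "finite B"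
    and sets: "\<And>i. sets (N i) = sets (M i)" and eq: "\<And>i. i \<in> B \<Longrightarrow> N i = M i"
    and f: "f \<in> borel_measurable (PiM UNIV M)" and dep: "depends_on B (space (PiM UNIV M)) f"
  shows "(\<integral>x. f x \<partial>PiM UNIV N) = (\<integral>x. f x \<partial>PiM UNIV M)"
    and "integrable (PiM UNIV N) f \<longleftrightarrow> integrable (PiM UNIV M) f"
proof -
  have sp: "space (PiM UNIV N) = space (PiM UNIV M)"
    using sets_eq_imp_space_eq[OF sets] by (simp add: space_PiM)
  have se: "sets (PiM UNIV N) = sets (PiM UNIV M)"
    by (rule sets_PiM_cong) (auto simp: sets)
  \<comment> \<open>An arbitrary filler for the coordinates outside \<open>B\<close>; it exists
    because a probability space is not empty.\<close>
  define c where "c i = (SOME u. u \<in> space (M i))" for i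
  have c: "c i \<in> space (M i)" for i
    unfolding c_def by (simp add: some_in_eq prob_space.not_empty[OF M])
  define f' where "f' r = f (\<lambda>i. if i \<in> B then r i else c i)" for r
  have "(\<lambda>r. (\<lambda>i. if i \<in> B then r i else c i)) \<in> measurable (PiM B M) (PiM UNIV M)"
  proof (rule measurable_PiM_single')
    show "(\<lambda>r. if i \<in> B then r i else c i) \<in> measurable (PiM B M) (M i)" for i
      using c by (cases "i \<in> B") auto
  qed (auto simp: c space_PiM PiE_iff)
  then have f': "f' \<in> borel_measurable (PiM B M)"
    unfolding f'_def by (rule measurable_compose[OF _ f])
  have ff': "f x = f' (restrict x B)" if "x \<in> space (PiM UNIV M)" for x
  proof -
    have "(\<lambda>i. if i \<in> B then restrict x B i else c i) \<in> space (PiM UNIV M)"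
      using that c by (simp add: space_PiM PiE_iff)
    then show ?thesis
      unfolding f'_def by (intro dep[unfolded depends_on_def, rule_format] that) simp_all
  qed
  have BN: "PiM B N = PiM B M"
    by (rule PiM_cong) (auto simp: eq)
  have r1: "(\<lambda>x. restrict x B) \<in> measurable (PiM UNIV M) (PiM B M)"
    by (intro measurable_restrict_subset) auto
  then have r2: "(\<lambda>x. restrict x B) \<in> measurable (PiM UNIV N) (PiM B M)"
    by (subst measurable_cong_sets[OF se refl])
  have d1: "distr (PiM UNIV M) (PiM B M) (\<lambda>x. restrict x B) = PiM B M"
    by (rule distr_PiM_restrict[OF M B])
  have d2: "distr (PiM UNIV N) (PiM B M) (\<lambda>x. restrict x B) = PiM B M"
    using distr_PiM_restrict[of N B, OF N B] BN by simp
  have "(\<integral>x. f x \<partial>PiM UNIV N) = (\<integral>x. f' (restrict x B) \<partial>PiM UNIV N)"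
    by (rule Bochner_Integration.integral_cong) (auto simp: sp ff')
  also have "\<dots> = (\<integral>x. f' x \<partial>PiM B M)"
    using integral_distr[OF r2 f'] d2 by simp
  also have "\<dots> = (\<integral>x. f' (restrict x B) \<partial>PiM UNIV M)"
    using integral_distr[OF r1 f'] d1 by simp
  also have "\<dots> = (\<integral>x. f x \<partial>PiM UNIV M)"
    by (rule Bochner_Integration.integral_cong) (auto simp: ff')
  finally show "(\<integral>x. f x \<partial>PiM UNIV N) = (\<integral>x. f x \<partial>PiM UNIV M)" .
  have "integrable (PiM UNIV N) f \<longleftrightarrow> integrable (PiM UNIV N) (\<lambda>x. f' (restrict x B))"
    by (rule Bochner_Integration.integrable_cong) (auto simp: sp ff')
  also have "\<dots> \<longleftrightarrow> integrable (PiM UNIV M) (\<lambda>x. f' (restrict x B))"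
    using integrable_distr_eq[OF r2 f'] integrable_distr_eq[OF r1 f'] d1 d2 by simp
  also have "\<dots> \<longleftrightarrow> integrable (PiM UNIV M) f"
    by (rule Bochner_Integration.integrable_cong) (auto simp: ff')
  finally show "integrable (PiM UNIV N) f \<longleftrightarrow> integrable (PiM UNIV M) f" .
qed

text \<open>Splicing two independent copies along \<open>B\<close> reproduces the law. Every
  independence and conditioning argument below is an instance: functions of disjoint coordinates,
  freezing one input, and averaging over the inputs before a block.\<close>

lemma distr_PiM_mix:
  assumes M: "\<And>i. prob_space (M i)"
  shows "distr (PiM UNIV M \<Otimes>\<^sub>M PiM UNIV M) (PiM UNIV M) (\<lambda>(x, x') i. if i \<in> B then x i else x' i) = PiM UNIV M"
    (is "distr ?PP ?P ?f = _")
proof (rule measure_eqI_PiM_infinite[symmetric])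
  interpret P: prob_space ?P by (rule prob_space_PiM[OF M])
  interpret PP: pair_prob_space ?P ?P ..
  have f: "?f \<in> measurable ?PP ?P"
    by (rule measurable_PiM_single') (auto simp: space_pair_measure space_PiM PiE_iff split_beta')
  show "finite_measure ?P" by (rule P.finite_measure_axioms)
  fix A J assume J: "finite J" "J \<subseteq> (UNIV::'a set)" and A: "\<And>i. i \<in> J \<Longrightarrow> A i \<in> sets (M i)"
  let ?X = "\<lambda>J. prod_emb UNIV M J (Pi\<^sub>E J A)"
  have X: "?X K \<in> sets ?P" if "K \<subseteq> J" for K
    using that J A by (intro sets_PiM_I) (auto intro: finite_subset)
  have eq: "?f -` ?X J \<inter> space ?PP = ?X (J \<inter> B) \<times> ?X (J - B)"
    by (auto simp: prod_emb_def space_pair_measure space_PiM PiE_iff split: if_splits)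
  have "emeasure (distr ?PP ?P ?f) (?X J) = emeasure ?PP (?X (J \<inter> B) \<times> ?X (J - B))"
    using X[of J] by (subst emeasure_distr[OF f]) (auto simp: eq)
  also have "\<dots> = emeasure ?P (?X (J \<inter> B)) * emeasure ?P (?X (J - B))"
    by (rule P.emeasure_pair_measure_Times) (auto intro!: X)
  also have "\<dots> = (\<Prod>i\<in>J \<inter> B. M i (A i)) * (\<Prod>i\<in>J - B. M i (A i))"
    using J A by (subst (1 2) emeasure_PiM_emb[OF M]) auto
  also have "\<dots> = (\<Prod>i\<in>J. M i (A i))"
    using J by (subst prod.union_disjoint[symmetric]) (auto intro!: prod.cong)
  also have "\<dots> = emeasure ?P (?X J)"
    using J A by (subst emeasure_PiM_emb[OF M]) auto
  finally show "emeasure ?P (?X J) = emeasure (distr ?PP ?P ?f) (?X J)" ..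
qed simp_all

section \<open>Poisson channels\<close>

lemma has_bochner_integral_poisson:
  assumes z: "z > 0"
  shows "has_bochner_integral (measure_pmf (poisson_pmf z)) real z"
proof -
  have "(\<lambda>k. z * exp (- z) * (z ^ k /\<^sub>R fact k)) sums (z * exp (- z) * exp z)"
    by (intro sums_mult exp_converges)
  moreover have "z * exp (- z) * (z ^ k /\<^sub>R fact k) = z ^ Suc k / fact (Suc k) * exp (- z) * real (Suc k)" for k
    by (simp add: field_simps del: of_nat_Suc)
  ultimately have "(\<lambda>k. z ^ Suc k / fact (Suc k) * exp (- z) * real (Suc k)) sums z"
    by (simp only: mult.assoc exp_minus_inverse[of z] mult.commute[of "exp (- z)"] mult_1_right)
  then have s: "(\<lambda>k. z ^ k / fact k * exp (- z) * real k) sums z"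
    using sums_Suc[of "\<lambda>k. z ^ k / fact k * exp (- z) * real k" z] by simp
  have "(\<integral>\<^sup>+m. ennreal (real m) \<partial>measure_pmf (poisson_pmf z)) = (\<Sum>m. ennreal (z ^ m / fact m * exp (- z) * real m))"
    using z by (simp add: nn_integral_measure_pmf nn_integral_count_space_nat flip: ennreal_mult')
  also have "\<dots> = ennreal z"
    using z s by (intro suminf_ennreal_eq) auto
  finally show ?thesis
    using z by (intro has_bochner_integral_nn_integral) auto
qed

text \<open>Density of the Poisson law of rate \<open>z\<close> with respect to the Poisson law of rate \<open>1\<close>, so that all
  output laws live on one product probability space and no factorials occur.\<close>

definition pwt :: "real \<Rightarrow> nat \<Rightarrow> real" where
  "pwt z m = exp (1 - z) * z ^ m"

lemma density_measure_pmf: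
  fixes p q :: "'a pmf"
  assumes e: "\<And>m. pmf p m * g m = pmf q m" and g: "\<And>m. g m \<ge> (0::real)"
  shows "density (measure_pmf p) (\<lambda>m. ennreal (g m)) = measure_pmf q"
proof (rule measure_eqI)
  fix X assume "X \<in> sets (density (measure_pmf p) (\<lambda>m. ennreal (g m)))"
  have "emeasure (density (measure_pmf p) (\<lambda>m. ennreal (g m))) X = (\<integral>\<^sup>+m. ennreal (g m) * indicator X m \<partial>measure_pmf p)"
    by (simp add: emeasure_density)
  also have "\<dots> = (\<integral>\<^sup>+m. ennreal (pmf p m) * (ennreal (g m) * indicator X m) \<partial>count_space UNIV)"
    by (simp add: nn_integral_measure_pmf)
  also have "\<dots> = (\<integral>\<^sup>+m. ennreal (pmf q m) * indicator X m \<partial>count_space UNIV)"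
    by (simp add: mult.assoc[symmetric] ennreal_mult'[symmetric] e)
  also have "\<dots> = emeasure (measure_pmf q) X"
    by (simp flip: nn_integral_measure_pmf)
  finally show "emeasure (density (measure_pmf p) (\<lambda>m. ennreal (g m))) X = emeasure (measure_pmf q) X" .
qed simp
lemma density_poisson:
  assumes z: "z > 0"
  shows "density (measure_pmf (poisson_pmf 1)) (\<lambda>m. ennreal (pwt z m)) = measure_pmf (poisson_pmf z)"
proof (rule density_measure_pmf)
  fix m
  have "exp (- 1) * exp (1 - z) = exp (- z)" by (simp flip: exp_add)
  then have "1 / fact m * exp (- 1) * (exp (1 - z) * z ^ m) = z ^ m / fact m * exp (- z)"
    by (metis (no_types, opaque_lifting) mult.assoc mult.commute mult_1 times_divide_eq_left)
  then show "pmf (poisson_pmf 1) m * pwt z m = pmf (poisson_pmf z) m"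
    using z by (simp add: pwt_def)
qed (use z in \<open>simp add: pwt_def\<close>)

lemma pwt_measurable [measurable (raw)]:
  assumes [measurable]: "f \<in> borel_measurable N" and g: "g \<in> measurable N (count_space UNIV)"
  shows "(\<lambda>w. pwt (f w) (g w)) \<in> borel_measurable N"
proof -
  have "(\<lambda>w. pwt (f w) m) \<in> borel_measurable N" for m
    unfolding pwt_def by measurable
  then show ?thesis by (rule measurable_compose_countable[OF _ g])
qed

lemma pwt_pos: "z > 0 \<Longrightarrow> pwt z m > 0"
  by (simp add: pwt_def)

lemma nn_integral_pwt: "z > 0 \<Longrightarrow> (\<integral>\<^sup>+m. ennreal (pwt z m) \<partial>measure_pmf (poisson_pmf 1)) = 1"
proof -
  assume "z > 0"
  have "(\<integral>\<^sup>+m. ennreal (pwt z m) \<partial>measure_pmf (poisson_pmf 1)) = emeasure (density (measure_pmf (poisson_pmf 1)) (\<lambda>m. ennreal (pwt z m))) UNIV"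
    by (subst emeasure_density) auto
  also have "\<dots> = 1"
    unfolding density_poisson[OF \<open>z > 0\<close>] using measure_pmf.emeasure_space_1[of "poisson_pmf z"] by simp
  finally show ?thesis .
qed

abbreviation output_space :: "(int \<Rightarrow> nat) measure" where
  "output_space \<equiv> PiM UNIV (\<lambda>_. count_space UNIV)"

definition ref_out :: "(int \<Rightarrow> nat) measure" where
  "ref_out = PiM UNIV (\<lambda>_. measure_pmf (poisson_pmf 1))"

abbreviation outputs_depend :: "int set \<Rightarrow> ((int \<Rightarrow> nat) \<Rightarrow> 'a) \<Rightarrow> bool" where
  "outputs_depend J f \<equiv> depends_on J UNIV f"

lemma sets_ref_out [measurable_cong, simp]: "sets ref_out = sets output_space"
  unfolding ref_out_def by (rule sets_PiM_cong) auto

lemma space_output_space [simp]: "space output_space = UNIV"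
  by (simp add: space_PiM)

lemma space_ref_out [simp]: "space ref_out = UNIV"
  by (simp add: ref_out_def space_PiM)

interpretation ref_out: prob_space ref_out
  unfolding ref_out_def by (intro prob_space_PiM prob_space_measure_pmf)

lemma measurable_output [measurable (raw)]:
  "f \<in> measurable N output_space \<Longrightarrow> (\<lambda>w. f w j) \<in> measurable N (count_space UNIV)"
  by (rule measurable_compose[OF _ measurable_component_singleton]) auto

lemma prob_space_poisson_channel: "prob_space (poisson_channel lam0 h L x)"
  unfolding poisson_channel_def by (intro prob_space_PiM prob_space_measure_pmf)

lemma sets_poisson_channel [measurable_cong, simp]: "sets (poisson_channel lam0 h L x) = sets output_space"
  unfolding poisson_channel_def by (rule sets_PiM_cong) auto

lemma space_poisson_channel [simp]: "space (poisson_channel lam0 h L x) = UNIV"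
  by (simp add: poisson_channel_def space_PiM)

lemma depends_onI: "(\<And>x y. (\<forall>i\<in>B. x i = y i) \<Longrightarrow> f x = f y) \<Longrightarrow> depends_on B S f"
  unfolding depends_on_def by blast

lemma depends_onD: "depends_on B S f \<Longrightarrow> x \<in> S \<Longrightarrow> y \<in> S \<Longrightarrow> (\<And>i. i \<in> B \<Longrightarrow> x i = y i) \<Longrightarrow> f x = f y"
  unfolding depends_on_def by blast

lemma depends_on_mono: "depends_on B S f \<Longrightarrow> B \<subseteq> C \<Longrightarrow> depends_on C S f"
  unfolding depends_on_def by blast

lemma depends_on_compose: "depends_on B S f \<Longrightarrow> depends_on B S (\<lambda>x. g (f x))"
  unfolding depends_on_def by metis

lemma depends_on_compose2: "depends_on B S f \<Longrightarrow> depends_on B S f' \<Longrightarrow> depends_on B S (\<lambda>x. g (f x) (f' x))"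
  unfolding depends_on_def by metis

lemma depends_on_prod: "depends_on J S (\<lambda>y. \<Prod>j\<in>J. f j (y j))"
  unfolding depends_on_def by (intro ballI impI prod.cong) simp_all

section \<open>Likelihoods of the channel with memory\<close>

locale poisson_memory =
  fixes L :: nat and lam0 A :: real and h :: "nat \<Rightarrow> real"
  assumes lam0_pos: "lam0 > 0" and h0_pos: "h 0 > 0"
    and h_nonneg: "\<And>l. l \<le> L \<Longrightarrow> h l \<ge> 0"
    and h_sum: "(\<Sum>l\<le>L. h l) = 1" and A_nonneg: "A \<ge> 0"
begin

abbreviation rate :: "(int \<Rightarrow> real) \<Rightarrow> int \<Rightarrow> real" where
  "rate x k \<equiv> intensity lam0 h L x k"

abbreviation chan :: "(int \<Rightarrow> real) \<Rightarrow> (int \<Rightarrow> nat) measure" where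
  "chan x \<equiv> poisson_channel lam0 h L x"

text \<open>Likelihood of the outputs at times \<open>J\<close> given the input \<open>x\<close>,
  relative to independent Poisson outputs of rate 1.\<close>

definition kap :: "int set \<Rightarrow> (int \<Rightarrow> real) \<Rightarrow> (int \<Rightarrow> nat) \<Rightarrow> real" where
  "kap J x y = (\<Prod>j\<in>J. pwt (rate x j) (y j))"

abbreviation input_space :: "(int \<Rightarrow> real) measure" where
  "input_space \<equiv> PiM UNIV (\<lambda>_. restrict_space borel {0..A})"

abbreviation "inputs \<equiv> space input_space"

lemma space_input: "x \<in> inputs \<longleftrightarrow> (\<forall>k. 0 \<le> x k \<and> x k \<le> A)"
  by (auto simp: space_PiM space_restrict_space)

definition M where "M = lam0 + A"

lemma M_pos: "M > 0" and lam0_le_M: "lam0 \<le> M"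
  using lam0_pos A_nonneg by (auto simp: M_def)

lemma h_le_1: "l \<le> L \<Longrightarrow> h l \<le> 1"
  using member_le_sum[of l "{..L}" h] h_nonneg h_sum by auto

lemma rate_ge: "(\<And>k. 0 \<le> x k) \<Longrightarrow> lam0 \<le> rate x j"
  unfolding intensity_def using h_nonneg by (auto intro!: sum_nonneg)

lemma rate_pos: "(\<And>k. 0 \<le> x k) \<Longrightarrow> 0 < rate x j"
  using rate_ge[of x j] lam0_pos by simp

lemma rate_le: assumes "\<And>k. x k \<le> A" shows "rate x j \<le> M"
proof -
  have "(\<Sum>l\<le>L. h l * x (j - int l)) \<le> (\<Sum>l\<le>L. h l * A)"
    using assms h_nonneg by (intro sum_mono mult_left_mono) auto
  also have "\<dots> = A" by (simp add: sum_distrib_right[symmetric] h_sum)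
  finally show ?thesis by (simp add: intensity_def M_def)
qed

lemma rate_bounds: "x \<in> inputs \<Longrightarrow> lam0 \<le> rate x j \<and> rate x j \<le> M \<and> 0 < rate x j"
  using rate_ge[of x j] rate_le[of x j] rate_pos[of x j] by (auto simp: space_input)

lemma rate_upd_same: "j \<notin> {k..k + int L} \<Longrightarrow> rate (x(k := u)) j = rate x j"
  by (auto simp: intensity_def intro!: sum.cong)

text \<open>Splitting off the value at input 0 exhibits the rate as an affine function of
  \<open>u\<close>. This form makes sense for complex \<open>u\<close> and for
  \<open>u > A\<close>.\<close>

lemma rate_upd:
  assumes "j \<in> {k..k + int L}"
  shows "rate (x(k := u)) j = rate (x(k := 0)) j + h (nat (j - k)) * u"
proof -
  have "(\<Sum>l\<le>L. h l * (x(k := u)) (j - int l)) = (\<Sum>l\<le>L. h l * (x(k := 0)) (j - int l) + (if l = nat (j - k) then h l * u else 0))"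
    using assms by (intro sum.cong) auto
  also have "\<dots> = (\<Sum>l\<le>L. h l * (x(k := 0)) (j - int l)) + h (nat (j - k)) * u"
    using assms by (subst sum.distrib) (auto simp: sum.delta)
  finally show ?thesis by (simp add: intensity_def)
qed

lemma rate_cong: "(\<And>i. j - int L \<le> i \<Longrightarrow> i \<le> j \<Longrightarrow> x i = x' i) \<Longrightarrow> rate x j = rate x' j"
  unfolding intensity_def by (auto intro!: sum.cong)

lemma rate_shift: "rate (\<lambda>i. x (i + s)) j = rate x (j + s)"
  by (simp add: intensity_def algebra_simps)

lemma measurable_input [measurable (raw)]:
  assumes f: "f \<in> measurable N input_space"
  shows "(\<lambda>w. f w j) \<in> borel_measurable N"
proof -
  have "(\<lambda>x. x j) \<in> measurable input_space (restrict_space borel {0..A})"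
    by (rule measurable_component_singleton) simp
  then have "(\<lambda>x. x j) \<in> borel_measurable input_space"
    by (rule measurable_restrict_space2_iff[THEN iffD1, THEN conjunct1])
  then show ?thesis by (rule measurable_compose[OF f])
qed

lemma rate_measurable [measurable (raw)]:
  assumes [measurable]: "f \<in> measurable N input_space"
  shows "(\<lambda>w. rate (f w) j) \<in> borel_measurable N"
  unfolding intensity_def by measurable

lemma kap_measurable_out [measurable]: "kap J x \<in> borel_measurable output_space"
  unfolding kap_def by measurable

lemma kap_measurable [measurable (raw)]:
  assumes [measurable]: "f \<in> measurable N input_space" "g \<in> measurable N output_space"
  shows "(\<lambda>w. kap J (f w) (g w)) \<in> borel_measurable N"
  unfolding kap_def by measurable

lemma kap_depends: "outputs_depend J (kap J x)"
  unfolding kap_def by (rule depends_on_prod)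

lemma kap_pos: "(\<And>k. 0 \<le> x k) \<Longrightarrow> 0 < kap J x y"
  unfolding kap_def by (intro prod_pos ballI pwt_pos rate_pos)

lemma density_kap:
  assumes x: "\<And>k. 0 \<le> x k" and J: "finite J"
  shows "density ref_out (\<lambda>y. ennreal (kap J x y)) =
    PiM UNIV (\<lambda>j. if j \<in> J then measure_pmf (poisson_pmf (rate x j)) else measure_pmf (poisson_pmf 1))"
proof -
  have "density ref_out (\<lambda>y. ennreal (kap J x y)) = density ref_out (\<lambda>y. \<Prod>j\<in>J. ennreal (pwt (rate x j) (y j)))"
    using less_imp_le[OF pwt_pos[OF rate_pos[OF x]]] by (simp add: kap_def prod_ennreal)
  also have "\<dots> = PiM UNIV (\<lambda>j. if j \<in> J then density (measure_pmf (poisson_pmf 1)) (\<lambda>m. ennreal (pwt (rate x j) m)) else measure_pmf (poisson_pmf 1))"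
    unfolding ref_out_def
    by (rule density_PiM) (auto simp: prob_space_measure_pmf J nn_integral_pwt rate_pos[OF x])
  also have "\<dots> = PiM UNIV (\<lambda>j. if j \<in> J then measure_pmf (poisson_pmf (rate x j)) else measure_pmf (poisson_pmf 1))"
    by (rule PiM_cong) (auto simp: density_poisson rate_pos[OF x])
  finally show ?thesis .
qed

text \<open>The channel law and the density \<open>kap J x\<close> against \<open>ref_out\<close>
  are different measures on output sequences; they agree only on the coordinates in
  \<open>J\<close>, which is why \<open>dep\<close> is assumed.\<close>

lemma integral_chan:
  fixes f :: "(int \<Rightarrow> nat) \<Rightarrow> real"
  assumes x: "\<And>k. 0 \<le> x k" and J: "finite J" and f: "f \<in> borel_measurable output_space" and dep: "outputs_depend J f"
  shows "(\<integral>y. f y \<partial>chan x) = (\<integral>y. kap J x y * f y \<partial>ref_out)"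
    and "integrable (chan x) f \<longleftrightarrow> integrable ref_out (\<lambda>y. kap J x y * f y)"
proof -
  let ?N = "\<lambda>j. if j \<in> J then measure_pmf (poisson_pmf (rate x j)) else measure_pmf (poisson_pmf 1)"
  have fm: "f \<in> borel_measurable (PiM UNIV ?N)"
    using f by (subst measurable_cong_sets[OF sets_PiM_cong refl]) auto
  have sp: "space (PiM UNIV ?N) = UNIV"
    by (auto simp: space_PiM)
  have eq: "density ref_out (\<lambda>y. ennreal (kap J x y)) = PiM UNIV ?N"
    by (rule density_kap[OF x J])
  note pm = integral_PiM_depends_on[where M = ?N and N = "\<lambda>j. measure_pmf (poisson_pmf (rate x j))" and f = f and B = J,
    OF _ _ J _ _ fm, unfolded sp, OF _ _ _ _ dep]
  have nn: "AE y in ref_out. 0 \<le> kap J x y"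
    using kap_pos[OF x] by (auto simp: less_imp_le)
  have "(\<integral>y. f y \<partial>chan x) = (\<integral>y. f y \<partial>PiM UNIV ?N)"
    unfolding poisson_channel_def by (rule pm) (auto simp: prob_space_measure_pmf)
  also have "\<dots> = (\<integral>y. kap J x y * f y \<partial>ref_out)"
    unfolding eq[symmetric] using f nn by (subst integral_density) auto
  finally show "(\<integral>y. f y \<partial>chan x) = (\<integral>y. kap J x y * f y \<partial>ref_out)" .
  have "integrable (chan x) f \<longleftrightarrow> integrable (PiM UNIV ?N) f"
    unfolding poisson_channel_def by (rule pm) (auto simp: prob_space_measure_pmf)
  also have "\<dots> \<longleftrightarrow> integrable ref_out (\<lambda>y. kap J x y * f y)"
    unfolding eq[symmetric] using f nn by (subst integrable_density) auto
  finally show "integrable (chan x) f \<longleftrightarrow> integrable ref_out (\<lambda>y. kap J x y * f y)" .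
qed

lemma chan_mean:
  assumes x: "\<And>k. 0 \<le> x k"
  shows "has_bochner_integral (chan x) (\<lambda>y. real (y j)) (rate x j)"
proof -
  have *: "distr (chan x) (measure_pmf (poisson_pmf (rate x j))) (\<lambda>y. y j) = measure_pmf (poisson_pmf (rate x j))"
    unfolding poisson_channel_def
    using distr_PiM_component[where I = UNIV and M = "\<lambda>j. measure_pmf (poisson_pmf (rate x j))" and i = j] by (simp add: prob_space_measure_pmf)
  have m: "(\<lambda>y. y j) \<in> measurable (chan x) (measure_pmf (poisson_pmf (rate x j)))"
    by simp
  show ?thesis
    using has_bochner_integral_poisson[OF rate_pos[of x j, OF x]]
      integrable_distr_eq[OF m, of real] integral_distr[OF m, of real] *
    by (simp add: has_bochner_integral_iff)
qed

lemma chan_linear: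
  assumes x: "\<And>k. 0 \<le> x k"
  shows "has_bochner_integral (chan x) (\<lambda>y. \<Sum>j\<in>J. b + c * real (y j)) (\<Sum>j\<in>J. b + c * rate x j)"
proof -
  interpret prob_space "chan x" by (rule prob_space_poisson_channel)
  have "has_bochner_integral (chan x) (\<lambda>y. b) b"
    using prob_space by (simp add: has_bochner_integral_iff)
  then show ?thesis
    by (intro has_bochner_integral_sum has_bochner_integral_add has_bochner_integral_mult_right chan_mean x)
qed

text \<open>Logarithms of output densities are at most linear in the outputs, so this single
  dominating function handles their integrability. Only \<open>x >= 0\<close> is assumed, because
  one coordinate will later be moved above \<open>A\<close>.\<close>

lemma chan_bound:
  fixes f :: "(int \<Rightarrow> nat) \<Rightarrow> real"
  assumes x: "\<And>k. 0 \<le> x k" and f: "f \<in> borel_measurable output_space"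
    and bd: "\<And>y. \<bar>f y\<bar> \<le> (\<Sum>j\<in>J. b + c * real (y j))"
  shows "integrable (chan x) f" and "\<bar>\<integral>y. f y \<partial>chan x\<bar> \<le> (\<Sum>j\<in>J. b + c * rate x j)"
    and "(\<integral>y. \<bar>f y\<bar> \<partial>chan x) \<le> (\<Sum>j\<in>J. b + c * rate x j)"
proof -
  note lin = chan_linear[OF x, where J = J and b = b and c = c, unfolded has_bochner_integral_iff]
  show i: "integrable (chan x) f"
    using f bd by (intro Bochner_Integration.integrable_bound[OF lin[THEN conjunct1]]) (auto intro: order_trans[OF _ abs_ge_self])
  then have "(\<integral>y. \<bar>f y\<bar> \<partial>chan x) \<le> (\<integral>y. (\<Sum>j\<in>J. b + c * real (y j)) \<partial>chan x)"
    using lin bd by (intro integral_mono) auto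
  then show *: "(\<integral>y. \<bar>f y\<bar> \<partial>chan x) \<le> (\<Sum>j\<in>J. b + c * rate x j)" using lin by simp
  show "\<bar>\<integral>y. f y \<partial>chan x\<bar> \<le> (\<Sum>j\<in>J. b + c * rate x j)"
    using * integral_abs_bound[of "chan x" f] by linarith
qed

lemma chan_cong:
  fixes f :: "(int \<Rightarrow> nat) \<Rightarrow> real"
  assumes J: "finite J" and f: "f \<in> borel_measurable output_space" and dep: "outputs_depend J f"
    and eq: "\<And>j. j \<in> J \<Longrightarrow> rate x j = rate x' j"
  shows "(\<integral>y. f y \<partial>chan x) = (\<integral>y. f y \<partial>chan x')"
proof -
  let ?N = "\<lambda>j. measure_pmf (poisson_pmf (rate x' j))"
  have fm: "f \<in> borel_measurable (PiM UNIV ?N)"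
    using f by (subst measurable_cong_sets[OF sets_PiM_cong refl]) auto
  show ?thesis
    unfolding poisson_channel_def
    by (rule integral_PiM_depends_on[where B = J]) (use fm dep eq J in \<open>auto simp: prob_space_measure_pmf space_PiM\<close>)
qed

lemma integral_chan_measurable:
  fixes f :: "(int \<Rightarrow> nat) \<Rightarrow> real"
  assumes J: "finite J" and f[measurable]: "f \<in> borel_measurable output_space" and dep: "outputs_depend J f"
  shows "(\<lambda>x. \<integral>y. f y \<partial>chan x) \<in> borel_measurable input_space"
proof -
  have "(\<lambda>x. \<integral>y. kap J x y * f y \<partial>ref_out) \<in> borel_measurable input_space"
    by measurable
  moreover have "(\<integral>y. f y \<partial>chan x) = (\<integral>y. kap J x y * f y \<partial>ref_out)" if "x \<in> inputs" for x
    using that by (intro integral_chan J f dep) (auto simp: space_input)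
  ultimately show ?thesis by (simp cong: measurable_cong)
qed

text \<open>With rates in \<open>[lam0, M]\<close>, \<open>b\<close> bounds the part
  \<open>1 - z\<close> of \<open>ln (pwt z m)\<close> and \<open>c\<close> bounds
  \<open>ln z\<close>, so that \<open>b + c * m\<close> bounds the whole logarithm.\<close>

definition b where "b = M + 1"
definition c where "c = \<bar>ln lam0\<bar> + \<bar>ln M\<bar>"

lemma b_nonneg: "b \<ge> 0" and c_nonneg: "c \<ge> 0"
  using M_pos by (auto simp: b_def c_def)

lemma ln_rate_bound:
  assumes "lam0 \<le> z" "z \<le> M" shows "\<bar>ln z\<bar> \<le> c"
proof -
  have "ln lam0 \<le> ln z" "ln z \<le> ln M" using assms lam0_pos by auto
  then show ?thesis by (auto simp: c_def)
qed

lemma power_bounds: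
  assumes "lam0 \<le> z" "z \<le> M" shows "exp (- (c * real m)) \<le> z ^ m" "z ^ m \<le> exp (c * real m)"
proof -
  have "z ^ m = exp (real m * ln z)"
    using assms lam0_pos by (simp add: exp_of_nat_mult)
  moreover have "\<bar>real m * ln z\<bar> \<le> c * real m"
    using ln_rate_bound[OF assms] by (simp add: abs_mult mult.commute[of c] mult_left_mono)
  ultimately show "exp (- (c * real m)) \<le> z ^ m" "z ^ m \<le> exp (c * real m)" by (auto simp: abs_le_iff)
qed

lemma pwt_bounds:
  assumes "lam0 \<le> z" "z \<le> M" shows "exp (- (b + c * real m)) \<le> pwt z m" "pwt z m \<le> exp (b + c * real m)"
proof -
  have "exp (- b) \<le> exp (1 - z)" "exp (1 - z) \<le> exp b"
    using assms lam0_pos by (auto simp: b_def)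
  then have "exp (- b) * exp (- (c * real m)) \<le> pwt z m" "pwt z m \<le> exp b * exp (c * real m)"
    unfolding pwt_def using assms lam0_pos by (intro mult_mono power_bounds; simp)+
  then show "exp (- (b + c * real m)) \<le> pwt z m" "pwt z m \<le> exp (b + c * real m)"
    by (simp_all add: exp_add[symmetric])
qed

lemma kap_bounds:
  assumes "x \<in> inputs"
  shows "exp (- (\<Sum>j\<in>J. b + c * real (y j))) \<le> kap J x y" "kap J x y \<le> exp (\<Sum>j\<in>J. b + c * real (y j))"
proof -
  consider "finite J" | "infinite J" by blast
  then have "exp (- (\<Sum>j\<in>J. b + c * real (y j))) \<le> kap J x y \<and> kap J x y \<le> exp (\<Sum>j\<in>J. b + c * real (y j))"
  proof cases
    case 1
    have pb: "exp (- (b + c * real (y j))) \<le> pwt (rate x j) (y j)" "pwt (rate x j) (y j) \<le> exp (b + c * real (y j))" for j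
      using pwt_bounds rate_bounds[OF assms] by blast+
    have "exp (- (\<Sum>j\<in>J. b + c * real (y j))) = (\<Prod>j\<in>J. exp (- (b + c * real (y j))))"
      using 1 by (simp add: exp_sum[symmetric] sum_negf[symmetric] del: minus_add_distrib)
    also have "\<dots> \<le> kap J x y" unfolding kap_def using pb(1) by (intro prod_mono conjI exp_ge_zero)
    finally have l: "exp (- (\<Sum>j\<in>J. b + c * real (y j))) \<le> kap J x y" .
    have "kap J x y \<le> (\<Prod>j\<in>J. exp (b + c * real (y j)))"
      unfolding kap_def using pb(2) less_imp_le[OF pwt_pos] rate_bounds[OF assms] by (intro prod_mono) auto
    also have "\<dots> = exp (\<Sum>j\<in>J. b + c * real (y j))" using 1 by (simp add: exp_sum)
    finally show ?thesis using l by simp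
  \<comment> \<open>For infinite \<open>J\<close> the sum is 0 and the product is 1 by
    convention.\<close>
  qed (simp add: kap_def)
  then show "exp (- (\<Sum>j\<in>J. b + c * real (y j))) \<le> kap J x y" "kap J x y \<le> exp (\<Sum>j\<in>J. b + c * real (y j))" by auto
qed

end

section \<open>Output densities and entropy\<close>

lemma integrable_pair_mult:
  fixes f :: "'a \<Rightarrow> real" and g :: "'b \<Rightarrow> real"
  assumes "prob_space M" "prob_space N" and f: "integrable M f" and g: "integrable N g"
  shows "integrable (M \<Otimes>\<^sub>M N) (\<lambda>(x, y). f x * g y)"
    and "(\<integral>(x, y). f x * g y \<partial>(M \<Otimes>\<^sub>M N)) = (\<integral>x. f x \<partial>M) * (\<integral>y. g y \<partial>N)"
proof -
  interpret M: prob_space M by fact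
  interpret N: prob_space N by fact
  interpret MN: pair_prob_space M N ..
  have [measurable]: "f \<in> borel_measurable M" "g \<in> borel_measurable N" using f g by auto
  show i: "integrable (M \<Otimes>\<^sub>M N) (\<lambda>(x, y). f x * g y)"
  proof (rule MN.Fubini_integrable)
    show "integrable M (\<lambda>x. \<integral>y. norm (case (x, y) of (x, y) \<Rightarrow> f x * g y) \<partial>N)"
      using f by (simp add: abs_mult)
    show "AE x in M. integrable N (\<lambda>y. case (x, y) of (x, y) \<Rightarrow> f x * g y)"
      using g by simp
  qed measurable
  show "(\<integral>(x, y). f x * g y \<partial>(M \<Otimes>\<^sub>M N)) = (\<integral>x. f x \<partial>M) * (\<integral>y. g y \<partial>N)"
    using MN.integral_fst'[OF i] by simp
qed

lemma integral_PiM_mix: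
  fixes f :: "('i \<Rightarrow> 'a) \<Rightarrow> real"
  assumes M: "\<And>i. prob_space (M i)" and f: "f \<in> borel_measurable (PiM UNIV M)"
  shows "(\<integral>x. f x \<partial>PiM UNIV M) = (\<integral>(x, x'). f (\<lambda>i. if i \<in> B then x i else x' i) \<partial>(PiM UNIV M \<Otimes>\<^sub>M PiM UNIV M))"
    and "integrable (PiM UNIV M) f \<longleftrightarrow> integrable (PiM UNIV M \<Otimes>\<^sub>M PiM UNIV M) (\<lambda>(x, x'). f (\<lambda>i. if i \<in> B then x i else x' i))"
proof -
  let ?mix = "(\<lambda>(x, x') i. if i \<in> B then x i else x' i) :: ('i \<Rightarrow> 'a) \<times> ('i \<Rightarrow> 'a) \<Rightarrow> 'i \<Rightarrow> 'a"
  have m: "?mix \<in> measurable (PiM UNIV M \<Otimes>\<^sub>M PiM UNIV M) (PiM UNIV M)"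
    by (rule measurable_PiM_single') (auto simp: space_pair_measure space_PiM PiE_iff split_beta')
  show "(\<integral>x. f x \<partial>PiM UNIV M) = (\<integral>(x, x'). f (\<lambda>i. if i \<in> B then x i else x' i) \<partial>(PiM UNIV M \<Otimes>\<^sub>M PiM UNIV M))"
    using integral_distr[OF m f] unfolding distr_PiM_mix[OF M] by (simp add: split_beta')
  show "integrable (PiM UNIV M) f \<longleftrightarrow> integrable (PiM UNIV M \<Otimes>\<^sub>M PiM UNIV M) (\<lambda>(x, x'). f (\<lambda>i. if i \<in> B then x i else x' i))"
    using integrable_distr_eq[OF m f] unfolding distr_PiM_mix[OF M] by (simp add: split_beta')
qed

text \<open>After splicing along \<open>B\<close>, \<open>f\<close> sees only the first copy and
  \<open>g\<close> only the second.\<close>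

lemma integral_PiM_indep:
  fixes f g :: "('i \<Rightarrow> 'a) \<Rightarrow> real"
  assumes M: "\<And>i. prob_space (M i)" and f: "integrable (PiM UNIV M) f" and g: "integrable (PiM UNIV M) g"
    and df: "depends_on B (space (PiM UNIV M)) f" and dg: "depends_on (- B) (space (PiM UNIV M)) g"
  shows "integrable (PiM UNIV M) (\<lambda>x. f x * g x)"
    and "(\<integral>x. f x * g x \<partial>PiM UNIV M) = (\<integral>x. f x \<partial>PiM UNIV M) * (\<integral>x. g x \<partial>PiM UNIV M)"
proof -
  let ?P = "PiM UNIV M" and ?mix = "\<lambda>x x' i. if i \<in> B then x i else x' i"
  have P: "prob_space ?P" by (rule prob_space_PiM[OF M])
  have mix: "?mix x x' \<in> space ?P" if "x \<in> space ?P" "x' \<in> space ?P" for x x'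
    using that by (auto simp: space_PiM PiE_iff)
  have fm: "f (?mix x x') = f x" if "x \<in> space ?P" "x' \<in> space ?P" for x x'
    by (rule depends_onD[OF df mix[OF that] that(1)]) simp
  have gm: "g (?mix x x') = g x'" if "x \<in> space ?P" "x' \<in> space ?P" for x x'
    by (rule depends_onD[OF dg mix[OF that] that(2)]) simp
  have m: "(\<lambda>x. f x * g x) \<in> borel_measurable ?P" using f g by auto
  have "integrable ?P (\<lambda>x. f x * g x) \<longleftrightarrow> integrable (?P \<Otimes>\<^sub>M ?P) (\<lambda>(x, x'). f x * g x')"
    unfolding integral_PiM_mix(2)[OF M m, of B]
    by (rule Bochner_Integration.integrable_cong) (auto simp: space_pair_measure fm gm)
  then show "integrable ?P (\<lambda>x. f x * g x)"
    using integrable_pair_mult[OF P P f g] by simp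
  have "(\<integral>x. f x * g x \<partial>?P) = (\<integral>(x, x'). f x * g x' \<partial>(?P \<Otimes>\<^sub>M ?P))"
    unfolding integral_PiM_mix(1)[OF M m, of B]
    by (rule Bochner_Integration.integral_cong) (auto simp: space_pair_measure fm gm)
  then show "(\<integral>x. f x * g x \<partial>?P) = (\<integral>x. f x \<partial>?P) * (\<integral>x. g x \<partial>?P)"
    using integrable_pair_mult[OF P P f g] by simp
qed

lemma integral_PiM_shift:
  fixes M :: "int \<Rightarrow> 'a measure" and f :: "(int \<Rightarrow> 'a) \<Rightarrow> real"
  assumes M: "\<And>i. prob_space (M i)" and f: "f \<in> borel_measurable (PiM UNIV (\<lambda>i. M (i + s)))"
  shows "(\<integral>x. f x \<partial>PiM UNIV (\<lambda>i. M (i + s))) = (\<integral>x. f (\<lambda>i. x (i + s)) \<partial>PiM UNIV M)"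
proof -
  have "distr (PiM UNIV M) (PiM UNIV (\<lambda>i. M (i + s))) (\<lambda>x i. x (i + s)) = PiM UNIV (\<lambda>i. M (i + s))"
    using distr_PiM_reindex[where K = UNIV and I = UNIV and M = M and f = "\<lambda>i. i + s"] M by (simp add: inj_on_def restrict_def)
  moreover have "(\<lambda>x i. x (i + s)) \<in> measurable (PiM UNIV M) (PiM UNIV (\<lambda>i. M (i + s)))"
    by (rule measurable_PiM_single') (auto simp: space_PiM PiE_iff)
  ultimately show ?thesis using integral_distr[OF _ f] by metis
qed

text \<open>Fekete's argument with a bounded defect. The length \<open>j * (m + L)\<close> is read
  both as \<open>j\<close> blocks of length \<open>m\<close> with gaps \<open>L\<close> and as
  \<open>m + L\<close> blocks of length \<open>j\<close>, which compares the two normalised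
  quantities for all \<open>m\<close> and \<open>j\<close>. The infimum \<open>R\<close> then
  satisfies both estimates at every finite \<open>n\<close>, and finite \<open>n\<close> is where
  they are used.\<close>

lemma almost_additive_rate:
  fixes a :: "nat \<Rightarrow> real"
  assumes a0: "a 0 = 0" and sub: "\<And>n m. a (n + m) \<le> a n + a m"
    and super: "\<And>n m. a n + a m - C \<le> a (n + L + m)"
  obtains R where "\<And>n. n \<ge> 1 \<Longrightarrow> real n * R \<le> a n" "\<And>n. n \<ge> 1 \<Longrightarrow> a n - C \<le> real (n + L) * R"
proof -
  have up: "a (k * j) \<le> real k * a j" for k j
  proof (induction k)
    case (Suc k)
    have "a (Suc k * j) \<le> a j + a (k * j)" using sub[of j "k * j"] by simp
    with Suc show ?case by (simp add: algebra_simps)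
  qed (simp add: a0)
  have low: "real k * (a m - C) \<le> a (k * (m + L))" for k m
  proof (induction k)
    case (Suc k)
    have "a m + a (k * (m + L)) - C \<le> a (Suc k * (m + L))"
      using super[of m "k * (m + L)"] by (simp add: add.assoc)
    with Suc show ?case by (simp add: algebra_simps)
  qed (simp add: a0)
  have key: "(a m - C) / real (m + L) \<le> a j / real j" if "m \<ge> 1" "j \<ge> 1" for m j
  proof -
    have "real j * (a m - C) \<le> a (j * (m + L))" by (rule low)
    also have "\<dots> \<le> real (m + L) * a j" using up[of "m + L" j] by (simp add: mult.commute)
    finally show ?thesis using that by (simp add: field_simps)
  qed
  define R where "R = (INF j\<in>{1..}. a j / real j)"
  have bdd: "bdd_below ((\<lambda>j. a j / real j) ` {1..})"
    using key[of 1] by (intro bdd_belowI2[where m = "(a 1 - C) / real (1 + L)"]) auto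
  show thesis
  proof
    fix n :: nat assume n: "n \<ge> 1"
    have "R \<le> a n / real n" unfolding R_def using n by (intro cINF_lower bdd) auto
    then show "real n * R \<le> a n" using n by (simp add: field_simps)
    have "(a n - C) / real (n + L) \<le> R"
      unfolding R_def using key n by (intro cINF_greatest) auto
    then show "a n - C \<le> real (n + L) * R" using n by (simp add: field_simps)
  qed
qed

lemma abs_ln_diff_le:
  fixes u v s :: real
  assumes v: "v > 0" and le: "exp (- s) * v \<le> u" "u \<le> exp s * v"
  shows "\<bar>ln u - ln v\<bar> \<le> s"
proof -
  have "exp (- s) * v > 0" using v by simp
  then have u: "u > 0" using le by linarith
  have "ln (exp (- s) * v) \<le> ln u"
    using v by (subst ln_le_cancel_iff[OF _ u]) (simp, rule le)
  moreover have "ln u \<le> ln (exp s * v)"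
    using v by (subst ln_le_cancel_iff[OF u]) (simp, rule le)
  ultimately show ?thesis using v by (simp add: ln_mult abs_le_iff)
qed

text \<open>Relative entropy of the Poisson law of rate \<open>z\<close> with respect to that of rate \<open>1\<close>.\<close>

definition theta :: "real \<Rightarrow> real" where
  "theta z = 1 - z + z * ln z"

lemma theta_measurable [measurable]: "theta \<in> borel_measurable borel"
  unfolding theta_def[abs_def] by measurable

text \<open>Tangent line of the convex function \<open>theta\<close> at \<open>a\<close>. Its slope
  \<open>ln a\<close> can be made arbitrarily large, which is the form in which superlinear growth
  is used.\<close>

lemma theta_ge:
  assumes z: "z > 0" and a: "a > 0" shows "1 + z * ln a - a \<le> theta z"
proof -
  have "ln (a / z) \<le> a / z - 1" using z a by (intro ln_le_minus_one) auto
  then have "z * (ln a - ln z) \<le> z * (a / z - 1)" using z a by (intro mult_left_mono) (auto simp: ln_div)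
  then show ?thesis using z by (simp add: theta_def algebra_simps)
qed

lemma theta_nonneg: "z > 0 \<Longrightarrow> theta z \<ge> 0"
  using theta_ge[of z 1] by simp

section \<open>Output densities and their relative entropy under independent inputs\<close>

locale poisson_input = poisson_memory +
  fixes F :: "real measure"
  assumes F: "F \<in> space (prob_algebra (restrict_space borel {0..A}))"
begin

lemma prob_space_F: "prob_space F" and sets_F [measurable_cong]: "sets F = sets (restrict_space borel {0..A})"
  using F by (auto simp: space_prob_algebra)

lemma space_F: "space F = {0..A}"
  using sets_eq_imp_space_eq[OF sets_F] by (simp add: space_restrict_space)

definition P :: "(int \<Rightarrow> real) measure" where "P = PiM UNIV (\<lambda>_. F)"

lemma sets_P [measurable_cong, simp]: "sets P = sets input_space"
  unfolding P_def by (rule sets_PiM_cong) (auto simp: sets_F)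

lemma space_P [simp]: "space P = inputs"
  using sets_eq_imp_space_eq[OF sets_P] .

sublocale F: prob_space F by (rule prob_space_F)

sublocale P: prob_space P unfolding P_def by (intro prob_space_PiM prob_space_F)

sublocale PR: pair_prob_space P ref_out ..

abbreviation "base \<equiv> P \<Otimes>\<^sub>M ref_out"

lemma P_prob_space [simp]: "measure P inputs = 1"
  using P.prob_space by simp

lemma ref_out_prob_space [simp]: "measure ref_out UNIV = 1"
  using ref_out.prob_space by simp

lemma P_bounded:
  fixes f :: "(int \<Rightarrow> real) \<Rightarrow> real"
  assumes f: "f \<in> borel_measurable input_space" and bd: "\<And>x. x \<in> inputs \<Longrightarrow> \<bar>f x\<bar> \<le> B"
  shows "integrable P f" and "\<bar>\<integral>x. f x \<partial>P\<bar> \<le> B"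
proof -
  show i: "integrable P f"
    using f bd by (intro P.integrable_const_bound[where B = B]) auto
  have "\<bar>\<integral>x. f x \<partial>P\<bar> \<le> (\<integral>x. \<bar>f x\<bar> \<partial>P)" by (rule integral_abs_bound)
  also have "\<dots> \<le> B" using i bd by (intro P.integral_le_const) auto
  finally show "\<bar>\<integral>x. f x \<partial>P\<bar> \<le> B" .
qed

text \<open>Density of the law of the outputs at times \<open>J\<close> with respect to
  \<open>ref_out\<close>.\<close>

definition pd :: "int set \<Rightarrow> (int \<Rightarrow> nat) \<Rightarrow> real" where
  "pd J y = (\<integral>x. kap J x y \<partial>P)"

lemma kap_nonneg: "x \<in> inputs \<Longrightarrow> 0 \<le> kap J x y"
  using kap_pos[of x J y] by (auto simp: space_input less_imp_le)

lemma kap_integrable: "integrable P (\<lambda>x. kap J x y)"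
proof (rule P_bounded)
  fix x assume x: "x \<in> inputs"
  show "\<bar>kap J x y\<bar> \<le> exp (\<Sum>j\<in>J. b + c * real (y j))"
    using kap_bounds(2)[OF x, of J y] kap_nonneg[OF x, of J y] by simp
qed measurable

lemma pd_measurable [measurable]: "pd J \<in> borel_measurable output_space"
  unfolding pd_def by measurable

lemma pd_depends: "outputs_depend J (pd J)"
proof (rule depends_onI)
  fix y y' :: "int \<Rightarrow> nat" assume eq: "\<forall>i\<in>J. y i = y' i"
  have "kap J x y = kap J x y'" for x
    using eq by (intro depends_onD[OF kap_depends]) auto
  then show "pd J y = pd J y'" by (simp add: pd_def)
qed

lemma pd_bounds:
  "exp (- (\<Sum>j\<in>J. b + c * real (y j))) \<le> pd J y" "pd J y \<le> exp (\<Sum>j\<in>J. b + c * real (y j))"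
proof -
  show "exp (- (\<Sum>j\<in>J. b + c * real (y j))) \<le> pd J y"
    unfolding pd_def by (rule P.integral_ge_const[OF kap_integrable]) (rule AE_I2, rule kap_bounds, simp)
  show "pd J y \<le> exp (\<Sum>j\<in>J. b + c * real (y j))"
    unfolding pd_def by (rule P.integral_le_const[OF kap_integrable]) (rule AE_I2, rule kap_bounds, simp)
qed

lemma pd_pos: "pd J y > 0"
  by (rule less_le_trans[OF exp_gt_zero pd_bounds(1)])

lemma ln_pd_bound: "\<bar>ln (pd J y)\<bar> \<le> (\<Sum>j\<in>J. b + c * real (y j))"
using abs_ln_diff_le[of 1 _ "pd J y"] pd_bounds[where J = J and y = y] by simp

text \<open>On \<open>inputs\<close> all rates are at most \<open>M\<close>, so the linear bound on
  \<open>f x\<close> gives channel expectations bounded uniformly in \<open>x\<close>; this is the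
  integrability that Fubini requires.\<close>

lemma fubini_kap:
  fixes f :: "(int \<Rightarrow> real) \<Rightarrow> (int \<Rightarrow> nat) \<Rightarrow> real"
  assumes J: "finite J" and f[measurable]: "case_prod f \<in> borel_measurable (input_space \<Otimes>\<^sub>M output_space)"
    and dep: "\<And>x. x \<in> inputs \<Longrightarrow> outputs_depend J (f x)"
    and bd: "\<And>x y. x \<in> inputs \<Longrightarrow> \<bar>f x y\<bar> \<le> (\<Sum>j\<in>J. b' + c' * real (y j))" and c': "c' \<ge> 0"
  shows "integrable base (\<lambda>(x, y). kap J x y * f x y)"
    and "(\<integral>(x, y). kap J x y * f x y \<partial>base) = (\<integral>x. (\<integral>y. f x y \<partial>chan x) \<partial>P)"
    and "integrable P (\<lambda>x. \<integral>y. f x y \<partial>chan x)"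
proof -
  let ?g = "\<lambda>x y. kap J x y * f x y"
  have nn: "\<And>k. 0 \<le> x k" if "x \<in> inputs" for x using that by (auto simp: space_input)
  have fm: "f x \<in> borel_measurable output_space" if "x \<in> inputs" for x
    using measurable_Pair2[OF f that] by simp
  have kf: "(\<integral>y. kap J x y * f x y \<partial>ref_out) = (\<integral>y. f x y \<partial>chan x)"
    and kfi: "integrable ref_out (\<lambda>y. kap J x y * f x y)"
    and kfa: "(\<integral>y. kap J x y * \<bar>f x y\<bar> \<partial>ref_out) = (\<integral>y. \<bar>f x y\<bar> \<partial>chan x)"
    if x: "x \<in> inputs" for x
  proof -
    show "(\<integral>y. kap J x y * f x y \<partial>ref_out) = (\<integral>y. f x y \<partial>chan x)"
      by (rule integral_chan(1)[symmetric]) (use nn[OF x] J dep[OF x] fm[OF x] in simp_all)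
    show "integrable ref_out (\<lambda>y. kap J x y * f x y)"
      by (rule integral_chan(2)[THEN iffD1, OF _ J fm[OF x] dep[OF x] chan_bound(1)[OF _ fm[OF x] bd[OF x]]]) (use nn[OF x] in simp_all)
    show "(\<integral>y. kap J x y * \<bar>f x y\<bar> \<partial>ref_out) = (\<integral>y. \<bar>f x y\<bar> \<partial>chan x)"
      by (rule integral_chan(1)[symmetric]) (use nn[OF x] J fm[OF x] depends_on_compose[OF dep[OF x], of abs] in simp_all)
  qed
  have b1: "(\<integral>y. \<bar>f x y\<bar> \<partial>chan x) \<le> (\<Sum>j\<in>J. b' + c' * M)" if x: "x \<in> inputs" for x
  proof -
    have "(\<integral>y. \<bar>f x y\<bar> \<partial>chan x) \<le> (\<Sum>j\<in>J. b' + c' * rate x j)"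
      by (rule chan_bound(3)) (use nn[OF x] bd[OF x] fm[OF x] in auto)
    also have "\<dots> \<le> (\<Sum>j\<in>J. b' + c' * M)"
      using rate_bounds[OF x] c' by (intro sum_mono add_left_mono mult_left_mono) auto
    finally show ?thesis .
  qed
  have na: "(\<integral>y. norm (?g x y) \<partial>ref_out) = (\<integral>y. \<bar>f x y\<bar> \<partial>chan x)" if x: "x \<in> inputs" for x
  proof -
    have "(\<integral>y. norm (?g x y) \<partial>ref_out) = (\<integral>y. kap J x y * \<bar>f x y\<bar> \<partial>ref_out)"
      using kap_nonneg[OF x, of J] by (intro Bochner_Integration.integral_cong) (auto simp: abs_mult)
    then show ?thesis using kfa[OF x] by simp
  qed
  have i: "integrable base (case_prod ?g)"
  proof (rule PR.Fubini_integrable)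
    show "integrable P (\<lambda>x. \<integral>y. norm (case_prod ?g (x, y)) \<partial>ref_out)"
    proof (rule P_bounded)
      fix x assume x: "x \<in> inputs"
      show "\<bar>\<integral>y. norm (case_prod ?g (x, y)) \<partial>ref_out\<bar> \<le> (\<Sum>j\<in>J. b' + c' * M)"
        using na[OF x] b1[OF x] by simp
    qed measurable
    show "AE x in P. integrable ref_out (\<lambda>y. case_prod ?g (x, y))"
      using kfi by auto
  qed measurable
  then show "integrable base (\<lambda>(x, y). kap J x y * f x y)" .
  show "(\<integral>(x, y). kap J x y * f x y \<partial>base) = (\<integral>x. (\<integral>y. f x y \<partial>chan x) \<partial>P)"
    unfolding PR.integral_fst[OF i, symmetric]
    by (rule Bochner_Integration.integral_cong[OF refl]) (simp add: kf)
  have "integrable P (\<lambda>x. \<integral>y. ?g x y \<partial>ref_out)" by (rule PR.integrable_fst[OF i])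
  then show "integrable P (\<lambda>x. \<integral>y. f x y \<partial>chan x)"
    by (rule Bochner_Integration.integrable_cong[THEN iffD1, rotated -1]) (simp_all add: kf)
qed

text \<open>The weight \<open>w\<close> is meant to be the likelihood ratio of a perturbed input law
  on finitely many coordinates, or its square; with \<open>w = 1\<close> this is the expectation of
  \<open>f\<close> under the output law.\<close>

lemma fubini_pd:
  fixes f :: "(int \<Rightarrow> nat) \<Rightarrow> real" and w :: "(int \<Rightarrow> real) \<Rightarrow> real"
  assumes J: "finite J" and f[measurable]: "f \<in> borel_measurable output_space" and dep: "outputs_depend J f"
    and bd: "\<And>y. \<bar>f y\<bar> \<le> (\<Sum>j\<in>J. b' + c' * real (y j))" and c': "c' \<ge> 0"
    and w[measurable]: "w \<in> borel_measurable input_space"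
    and wb: "\<And>x. x \<in> inputs \<Longrightarrow> \<bar>w x\<bar> \<le> W" and W: "0 \<le> W"
  shows "integrable ref_out (\<lambda>y. (\<integral>x. w x * kap J x y \<partial>P) * f y)"
    and "(\<integral>x. w x * (\<integral>y. f y \<partial>chan x) \<partial>P) = (\<integral>y. (\<integral>x. w x * kap J x y \<partial>P) * f y \<partial>ref_out)"
    and "integrable P (\<lambda>x. w x * (\<integral>y. f y \<partial>chan x))"
proof -
  have bd': "\<bar>w x * f y\<bar> \<le> (\<Sum>j\<in>J. W * b' + (W * c') * real (y j))" if "x \<in> inputs" for x y
  proof -
    have "\<bar>w x\<bar> * \<bar>f y\<bar> \<le> W * (\<Sum>j\<in>J. b' + c' * real (y j))"
      using wb[OF that] bd W by (intro mult_mono) auto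
    then show ?thesis by (simp add: abs_mult sum_distrib_left algebra_simps)
  qed
  have dep': "outputs_depend J (\<lambda>y. w x * f y)" for x
    by (rule depends_on_compose[OF dep])
  have m: "(\<lambda>(x, y). w x * f y) \<in> borel_measurable (input_space \<Otimes>\<^sub>M output_space)" by measurable
  have fub: "integrable base (\<lambda>(x, y). kap J x y * (w x * f y))"
    "(\<integral>(x, y). kap J x y * (w x * f y) \<partial>base) = (\<integral>x. (\<integral>y. w x * f y \<partial>chan x) \<partial>P)"
    "integrable P (\<lambda>x. \<integral>y. w x * f y \<partial>chan x)"
    by (rule fubini_kap[OF J m dep' bd']; use W c' in simp)+
  have inner: "(\<integral>x. kap J x y * (w x * f y) \<partial>P) = (\<integral>x. w x * kap J x y \<partial>P) * f y" for y
    by (subst Bochner_Integration.integral_mult_left_zero[symmetric]) (simp add: mult_ac)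
  show "integrable ref_out (\<lambda>y. (\<integral>x. w x * kap J x y \<partial>P) * f y)"
    using PR.integrable_snd[OF fub(1)] unfolding inner .
  show "(\<integral>x. w x * (\<integral>y. f y \<partial>chan x) \<partial>P) = (\<integral>y. (\<integral>x. w x * kap J x y \<partial>P) * f y \<partial>ref_out)"
    using PR.integral_snd[OF fub(1)] fub(2) unfolding inner by simp
  show "integrable P (\<lambda>x. w x * (\<integral>y. f y \<partial>chan x))"
    using fub(3) by simp
qed

lemma fubini_pd1:
  fixes f :: "(int \<Rightarrow> nat) \<Rightarrow> real"
  assumes J: "finite J" and f: "f \<in> borel_measurable output_space" and dep: "outputs_depend J f"
    and bd: "\<And>y. \<bar>f y\<bar> \<le> (\<Sum>j\<in>J. b' + c' * real (y j))" and c': "c' \<ge> 0"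
  shows "integrable ref_out (\<lambda>y. pd J y * f y)"
    and "(\<integral>x. (\<integral>y. f y \<partial>chan x) \<partial>P) = (\<integral>y. pd J y * f y \<partial>ref_out)"
    and "integrable P (\<lambda>x. \<integral>y. f y \<partial>chan x)"
  using fubini_pd[OF J f dep bd c', of "\<lambda>_. 1" 1] by (simp_all add: pd_def)

definition Ups :: "int set \<Rightarrow> (int \<Rightarrow> real) \<Rightarrow> real" where
  "Ups J x = (\<integral>y. ln (pd J y) \<partial>chan x)"

text \<open>By \<open>fubini_pd1\<close> this is the integral of \<open>pd J * ln (pd J)\<close>,
  that is, the relative entropy of the output law on \<open>J\<close> with respect to
  \<open>ref_out\<close>.\<close>

definition U :: "int set \<Rightarrow> real" where
  "U J = (\<integral>x. Ups J x \<partial>P)"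

lemma ln_pd_depends: "outputs_depend J (\<lambda>y. ln (pd J y))"
  by (rule depends_on_compose[OF pd_depends])

lemma Ups_measurable: "finite J \<Longrightarrow> Ups J \<in> borel_measurable input_space"
  unfolding Ups_def[abs_def] by (rule integral_chan_measurable[OF _ _ ln_pd_depends]) auto

lemma Ups_bound: "x \<in> inputs \<Longrightarrow> \<bar>Ups J x\<bar> \<le> real (card J) * (b + c * M)"
proof -
  assume x: "x \<in> inputs"
  have "\<bar>Ups J x\<bar> \<le> (\<Sum>j\<in>J. b + c * rate x j)"
    unfolding Ups_def by (rule chan_bound(2)) (use x ln_pd_bound in \<open>auto simp: space_input\<close>)
  also have "\<dots> \<le> (\<Sum>j\<in>J. b + c * M)"
    using rate_bounds[OF x] c_nonneg by (intro sum_mono add_left_mono mult_left_mono) auto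
  finally show ?thesis by simp
qed

lemma Ups_integrable: "finite J \<Longrightarrow> integrable P (Ups J)"
  by (rule P_bounded(1)[OF Ups_measurable Ups_bound])

lemma U_bound: "finite J \<Longrightarrow> \<bar>U J\<bar> \<le> real (card J) * (b + c * M)"
  unfolding U_def by (rule P_bounded(2)[OF Ups_measurable Ups_bound])

lemma pd_integral:
  assumes J: "finite J" shows "integrable ref_out (pd J)" and "(\<integral>y. pd J y \<partial>ref_out) = 1"
proof -
  have "integrable ref_out (pd J) \<and> (\<integral>y. pd J y \<partial>ref_out) = 1"
  \<comment> \<open>A sum over \<open>J\<close> cannot dominate the constant 1 when \<open>J\<close>
    is empty, so that case is computed directly.\<close>
  proof (cases "J = {}")
    case True
    then show ?thesis by (simp add: pd_def[abs_def] kap_def P.prob_space ref_out.prob_space)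
  next
    case False
    then have "card J \<ge> 1" using J by (simp add: Suc_leI card_gt_0_iff)
    then have "integrable ref_out (pd J)" "(\<integral>x. (\<integral>y. 1 \<partial>chan x) \<partial>P) = (\<integral>y. pd J y \<partial>ref_out)"
      using fubini_pd1[of J "\<lambda>_. 1" 1 0] J by (auto simp: depends_on_def)
    moreover have "(\<integral>y. 1 \<partial>chan x) = (1::real)" for x
      using prob_space.prob_space[OF prob_space_poisson_channel] by simp
    ultimately show ?thesis by (simp add: P.prob_space)
  qed
  then show "integrable ref_out (pd J)" and "(\<integral>y. pd J y \<partial>ref_out) = 1" by auto
qed

text \<open>The difference of the two sides is the mutual information between the outputs on
  \<open>J1\<close> and on \<open>J2\<close>. Its nonnegativity follows from
  \<open>ln r <= r - 1\<close>, because the product of the two densities has total mass 1 over the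
  product measure \<open>ref_out\<close>.\<close>

lemma U_superadditive:
  assumes J: "finite J1" "finite J2" "J1 \<inter> J2 = {}"
  shows "U J1 + U J2 \<le> U (J1 \<union> J2)"
proof -
  let ?J = "J1 \<union> J2"
  have fin: "finite ?J" using J by simp
  have step: "integrable ref_out (\<lambda>y. pd ?J y * ln (pd K y)) \<and> U K = (\<integral>y. pd ?J y * ln (pd K y) \<partial>ref_out)" if K: "K \<subseteq> ?J" for K
  proof -
    have "\<bar>ln (pd K y)\<bar> \<le> (\<Sum>j\<in>?J. b + c * real (y j))" for y
      by (rule order_trans[OF ln_pd_bound]) (use fin K b_nonneg c_nonneg in \<open>intro sum_mono2\<close>, auto)
    then show ?thesis
      using fubini_pd1[of ?J "\<lambda>y. ln (pd K y)" b c] fin c_nonneg depends_on_mono[OF ln_pd_depends K]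
      unfolding U_def Ups_def by auto
  qed
  note s1 = step[of J1] and s2 = step[of J2] and s3 = step[of ?J]
  have ind: "integrable ref_out (\<lambda>y. pd J1 y * pd J2 y) \<and> (\<integral>y. pd J1 y * pd J2 y \<partial>ref_out) = 1"
  proof -
    have "J2 \<subseteq> - J1" using J by auto
    then have "depends_on (- J1) UNIV (pd J2)" using pd_depends depends_on_mono by blast
    then show ?thesis
      using integral_PiM_indep[where M = "\<lambda>_. measure_pmf (poisson_pmf 1)" and f = "pd J1" and g = "pd J2" and B = J1]
        pd_integral[OF J(1)] pd_integral[OF J(2)] pd_depends[of J1]
      unfolding ref_out_def[symmetric] by (simp add: prob_space_measure_pmf)
  qed
  have pt: "pd ?J y * ln (pd J1 y) + pd ?J y * ln (pd J2 y) - pd ?J y * ln (pd ?J y) \<le> pd J1 y * pd J2 y - pd ?J y" for y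
  proof -
    have pos: "pd J1 y > 0" "pd J2 y > 0" "pd ?J y > 0" by (rule pd_pos)+
    then have "ln (pd J1 y * pd J2 y / pd ?J y) \<le> pd J1 y * pd J2 y / pd ?J y - 1"
      by (intro ln_le_minus_one) auto
    then have "pd ?J y * (ln (pd J1 y) + ln (pd J2 y) - ln (pd ?J y)) \<le> pd ?J y * (pd J1 y * pd J2 y / pd ?J y - 1)"
      using pos by (intro mult_left_mono) (auto simp: ln_div ln_mult)
    then show ?thesis using pos by (simp add: algebra_simps)
  qed
  have "U J1 + U J2 - U ?J = (\<integral>y. pd ?J y * ln (pd J1 y) + pd ?J y * ln (pd J2 y) - pd ?J y * ln (pd ?J y) \<partial>ref_out)"
    using s1 s2 s3 by simp
  also have "\<dots> \<le> (\<integral>y. pd J1 y * pd J2 y - pd ?J y \<partial>ref_out)"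
    using s1 s2 s3 ind pd_integral(1)[OF fin] pt by (intro integral_mono) auto
  also have "\<dots> = 0" using ind pd_integral[OF fin] by simp
  finally show ?thesis by simp
qed

lemma kap_input_depends: "(\<And>j i. j \<in> J \<Longrightarrow> j - int L \<le> i \<Longrightarrow> i \<le> j \<Longrightarrow> i \<in> B) \<Longrightarrow> depends_on B S (\<lambda>x. kap J x y)"
  unfolding depends_on_def kap_def by (auto intro!: prod.cong arg_cong2[where f = pwt] rate_cong)

text \<open>Outputs up to time \<open>s\<close> see inputs up to \<open>s\<close>, and outputs after
  \<open>s + L\<close> see only inputs after \<open>s\<close>, so the likelihoods on
  \<open>J1\<close> and \<open>J2\<close> are independent under \<open>P\<close>. The likelihood on
  \<open>K\<close> is replaced by its pointwise upper bound, and the logarithm of that bound is the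
  error term.\<close>

lemma U_subadditive:
  assumes J: "finite J1" "finite J2" "finite K" "J1 \<inter> K = {}" "J2 \<inter> K = {}" "J1 \<subseteq> {..s}" "J2 \<subseteq> {s + int L<..}"
  shows "U (J1 \<union> K \<union> J2) \<le> U J1 + U J2 + real (card K) * (b + c * M)"
proof -
  let ?J = "J1 \<union> K \<union> J2"
  have J12: "J1 \<inter> J2 = {}" using J(6,7) by force
  have fin: "finite ?J" using J by simp
  have pdle: "pd ?J y \<le> exp (\<Sum>j\<in>K. b + c * real (y j)) * (pd J1 y * pd J2 y)" for y
  proof -
    have kp: "kap ?J x y = kap K x y * (kap J1 x y * kap J2 x y)" for x
      unfolding kap_def using J J12 by (subst prod.union_disjoint; auto simp: prod.union_disjoint mult_ac)
    have ind: "integrable P (\<lambda>x. kap J1 x y * kap J2 x y)" "(\<integral>x. kap J1 x y * kap J2 x y \<partial>P) = pd J1 y * pd J2 y"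
      unfolding pd_def P_def using kap_integrable[of J1 y] kap_integrable[of J2 y] J(6,7)
      by (intro integral_PiM_indep[where B = "{..s}"] kap_input_depends; force simp: P_def prob_space_F)+
    have "pd ?J y \<le> (\<integral>x. exp (\<Sum>j\<in>K. b + c * real (y j)) * (kap J1 x y * kap J2 x y) \<partial>P)"
      unfolding pd_def
    proof (rule integral_mono)
      fix x assume "x \<in> space P"
      then have x: "x \<in> inputs" by simp
      show "kap ?J x y \<le> exp (\<Sum>j\<in>K. b + c * real (y j)) * (kap J1 x y * kap J2 x y)"
        unfolding kp using kap_bounds(2)[OF x] kap_nonneg[OF x] by (intro mult_right_mono mult_nonneg_nonneg) auto
    qed (use kap_integrable ind in auto)
    then show ?thesis using ind by simp
  qed
  have lnle: "ln (pd ?J y) \<le> ln (pd J1 y) + ln (pd J2 y) + (\<Sum>j\<in>K. b + c * real (y j))" for y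
  proof -
    have "ln (pd ?J y) \<le> ln (exp (\<Sum>j\<in>K. b + c * real (y j)) * (pd J1 y * pd J2 y))"
      using pdle[of y] pd_pos by (subst ln_le_cancel_iff) (auto intro: mult_pos_pos)
    then show ?thesis using pd_pos[of J1 y] pd_pos[of J2 y] by (simp add: ln_mult)
  qed
  have "Ups ?J x \<le> Ups J1 x + Ups J2 x + real (card K) * (b + c * M)" if x: "x \<in> inputs" for x
  proof -
    have nn: "\<And>k. 0 \<le> x k" using x by (auto simp: space_input)
    have lin: "integrable (chan x) (\<lambda>y. \<Sum>j\<in>K. b + c * real (y j))"
       "(\<integral>y. (\<Sum>j\<in>K. b + c * real (y j)) \<partial>chan x) = (\<Sum>j\<in>K. b + c * rate x j)"
      using chan_linear[of x b c K] nn by (auto simp: has_bochner_integral_iff)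
    have i: "integrable (chan x) (\<lambda>y. ln (pd J' y))" for J'
      by (rule chan_bound(1)) (use nn ln_pd_bound in auto)
    have "Ups ?J x \<le> (\<integral>y. ln (pd J1 y) + ln (pd J2 y) + (\<Sum>j\<in>K. b + c * real (y j)) \<partial>chan x)"
      unfolding Ups_def using i lin lnle by (intro integral_mono) auto
    also have "\<dots> = Ups J1 x + Ups J2 x + (\<Sum>j\<in>K. b + c * rate x j)"
      unfolding Ups_def using i lin by simp
    also have "(\<Sum>j\<in>K. b + c * rate x j) \<le> (\<Sum>j\<in>K. b + c * M)"
      using rate_bounds[OF x] c_nonneg by (intro sum_mono add_left_mono mult_left_mono) auto
    finally show ?thesis by simp
  qed
  then have "U ?J \<le> (\<integral>x. Ups J1 x + Ups J2 x + real (card K) * (b + c * M) \<partial>P)"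
    unfolding U_def using Ups_integrable J fin by (intro integral_mono) auto
  also have "\<dots> = U J1 + U J2 + real (card K) * (b + c * M)"
    unfolding U_def using Ups_integrable J by (simp add: P.prob_space)
  finally show ?thesis .
qed

lemma U_shift:
  assumes J: "finite J" shows "U ((\<lambda>j. j + s) ` J) = U J"
proof -
  have kap_s: "kap ((\<lambda>j. j + s) ` J) x y = kap J (\<lambda>i. x (i + s)) (\<lambda>i. y (i + s))" for x y
    unfolding kap_def by (subst prod.reindex) (auto simp: inj_on_def rate_shift)
  have pd_s: "pd ((\<lambda>j. j + s) ` J) y = pd J (\<lambda>i. y (i + s))" for y
    unfolding pd_def kap_s
    using integral_PiM_shift[where M = "\<lambda>_. F" and f = "\<lambda>x. kap J x (\<lambda>i. y (i + s))" and s = s]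
    by (simp add: P_def[symmetric] prob_space_F)
  have Ups_s: "Ups ((\<lambda>j. j + s) ` J) x = Ups J (\<lambda>i. x (i + s))" for x
  proof -
    have c: "chan (\<lambda>i. x (i + s)) = PiM UNIV (\<lambda>i. measure_pmf (poisson_pmf (rate x (i + s))))"
      unfolding poisson_channel_def rate_shift ..
    have m: "(\<lambda>y. ln (pd J y)) \<in> borel_measurable (chan (\<lambda>i. x (i + s)))" by measurable
    show ?thesis
      unfolding Ups_def pd_s c
      using integral_PiM_shift[where M = "\<lambda>i. measure_pmf (poisson_pmf (rate x i))" and s = s, OF _ m[unfolded c]]
      by (simp add: prob_space_measure_pmf poisson_channel_def)
  qed
  show ?thesis
    unfolding U_def Ups_s
    using integral_PiM_shift[where M = "\<lambda>_. F" and f = "Ups J" and s = s] Ups_measurable[OF J]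
    by (simp add: P_def[symmetric] prob_space_F)
qed

text \<open>Expected relative entropy of a single output given the inputs, with respect to the
  Poisson law of rate 1; by stationarity the time does not matter.\<close>

definition V :: real where "V = (\<integral>x. theta (rate x 0) \<partial>P)"

lemma theta_bound:
  assumes "lam0 \<le> z" "z \<le> M" shows "\<bar>theta z\<bar> \<le> 1 + c * M"
proof -
  have z: "0 < z" using assms lam0_pos by simp
  have "z * ln z \<le> z * c" using z ln_rate_bound[OF assms] by (intro mult_left_mono) auto
  also have "\<dots> \<le> M * c" using assms c_nonneg by (intro mult_right_mono) auto
  finally have "z * ln z \<le> M * c" .
  then have "theta z \<le> 1 + c * M" unfolding theta_def using z by (simp add: mult.commute[of c])
  then show ?thesis using theta_nonneg[OF z] by simp
qed

lemma theta_rate_integral: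
  "integrable P (\<lambda>x. theta (rate x j))" "(\<integral>x. theta (rate x j) \<partial>P) = V"
proof -
  show "integrable P (\<lambda>x. theta (rate x j))"
    by (rule P_bounded(1)) (use theta_bound rate_bounds in auto)
  have "(\<lambda>x. theta (rate x 0)) \<in> borel_measurable P" by measurable
  then show "(\<integral>x. theta (rate x j) \<partial>P) = V"
    unfolding V_def using integral_PiM_shift[where M = "\<lambda>_. F" and f = "\<lambda>x. theta (rate x 0)" and s = j]
    by (simp add: P_def[symmetric] prob_space_F rate_shift)
qed

lemma V_bounds: "0 \<le> V" "V \<le> 1 + c * M"
proof -
  show "0 \<le> V" unfolding V_def using rate_bounds theta_nonneg by (intro integral_nonneg_AE) auto
  show "V \<le> 1 + c * M" 
    using P_bounded(2)[of "\<lambda>x. theta (rate x 0)" "1 + c * M"] theta_bound rate_bounds unfolding V_def by auto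
qed

text \<open>This is the mutual information of the outputs at times \<open>1..n\<close> and the inputs at times
  \<open>1-L..n\<close>; unlike \<open>block_information\<close>, it includes the inputs before the block that still
  influence it.\<close>

definition a :: "nat \<Rightarrow> real" where "a n = real n * V - U {1..int n}"

lemma a_sub: "a (n + m) \<le> a n + a m"
proof -
  have s: "{1..int (n + m)} = {1..int n} \<union> (\<lambda>j. j + int n) ` {1..int m}"
    by (auto simp: image_iff)
  have "U {1..int n} + U ((\<lambda>j. j + int n) ` {1..int m}) \<le> U {1..int (n + m)}"
    unfolding s by (rule U_superadditive) auto
  then show ?thesis unfolding U_shift[OF finite_atLeastAtMost_int] by (simp add: a_def algebra_simps)
qed

text \<open>The outputs in the gap contribute \<open>L * V >= 0\<close> to the left summand of
  \<open>a\<close>, which is dropped; the defect is thus only the cost of the gap in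
  \<open>U\<close>.\<close>

lemma a_super: "a n + a m - real L * (b + c * M) \<le> a (n + L + m)"
proof -
  have s: "{1..int (n + L + m)} = {1..int n} \<union> {int n<..int n + int L} \<union> (\<lambda>j. j + int (n + L)) ` {1..int m}"
    by (auto simp: image_iff)
  have "U {1..int (n + L + m)} \<le> U {1..int n} + U ((\<lambda>j. j + int (n + L)) ` {1..int m}) + real (card {int n<..int n + int L}) * (b + c * M)"
    unfolding s by (rule U_subadditive[where s = "int n"]) auto
  moreover have "real L * V \<ge> 0" using V_bounds by simp
  ultimately show ?thesis unfolding U_shift[OF finite_atLeastAtMost_int] by (simp add: a_def algebra_simps)
qed

text \<open>The estimate will be applied to \<open>F\<close> and to its perturbations with the same
  error, so the error may involve only the constants of the channel. For this the excess
  \<open>L * R\<close> is bounded through \<open>R <= a 1\<close>.\<close>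

lemma a_rate:
  obtains R where "\<And>n. n \<ge> 1 \<Longrightarrow> real n * R \<le> a n"
    "\<And>n. n \<ge> 1 \<Longrightarrow> a n \<le> real n * R + real L * (b + c * M) + real L * (1 + b + 2 * c * M)"
proof -
  have "U {} = 0" using U_bound[of "{}"] by simp
  then have "a 0 = 0" by (simp add: a_def)
  then obtain R where R: "\<And>n. n \<ge> 1 \<Longrightarrow> real n * R \<le> a n" "\<And>n. n \<ge> 1 \<Longrightarrow> a n - real L * (b + c * M) \<le> real (n + L) * R"
    using almost_additive_rate[of a, OF _ a_sub a_super] by blast
  have "R \<le> a 1" using R(1)[of 1] by simp
  also have "\<dots> \<le> 1 + b + 2 * c * M"
    using V_bounds U_bound[of "{1..1::int}"] by (simp add: a_def abs_le_iff)
  finally have "real L * R \<le> real L * (1 + b + 2 * c * M)" by (rule mult_left_mono) simp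
  then have "\<And>n. n \<ge> 1 \<Longrightarrow> a n \<le> real n * R + real L * (b + c * M) + real L * (1 + b + 2 * c * M)"
    using R(2) by (smt (verit, best) of_nat_add distrib_right)
  with R(1) that show thesis by blast
qed

end

section \<open>Block information\<close>

lemma (in poisson_memory) nn_integral_chan:
  assumes x: "\<And>k. 0 \<le> x k" and J: "finite J" and f: "f \<in> borel_measurable (PiM J (\<lambda>_. count_space UNIV))"
  shows "(\<integral>\<^sup>+y. f (restrict y J) \<partial>chan x) = (\<integral>\<^sup>+y. ennreal (kap J x y) * f (restrict y J) \<partial>ref_out)"
proof -
  let ?M = "\<lambda>j. measure_pmf (poisson_pmf (rate x j))"
  let ?N = "\<lambda>j. if j \<in> J then measure_pmf (poisson_pmf (rate x j)) else measure_pmf (poisson_pmf 1)"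
  have dM: "distr (PiM UNIV ?M) (PiM J ?M) (\<lambda>y. restrict y J) = PiM J ?M"
    by (rule distr_PiM_restrict[OF _ J]) (rule prob_space_measure_pmf)
  have dN: "distr (PiM UNIV ?N) (PiM J ?N) (\<lambda>y. restrict y J) = PiM J ?N"
    by (rule distr_PiM_restrict[OF _ J]) (simp add: prob_space_measure_pmf)
  have NM: "PiM J ?N = PiM J ?M" by (rule PiM_cong) auto
  have sJ: "sets (PiM J ?M) = sets (PiM J (\<lambda>_. count_space UNIV))"
    by (rule sets_PiM_cong) auto
  have sU: "sets (PiM UNIV ?M) = sets output_space" "sets (PiM UNIV ?N) = sets output_space"
    by (rule sets_PiM_cong; auto)+
  have r: "(\<lambda>y. restrict y J) \<in> measurable output_space (PiM J (\<lambda>_. count_space UNIV))"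
    by (rule measurable_restrict_subset) simp
  then have rM: "(\<lambda>y. restrict y J) \<in> measurable (PiM UNIV ?M) (PiM J ?M)"
    and rN: "(\<lambda>y. restrict y J) \<in> measurable (PiM UNIV ?N) (PiM J ?M)"
    using measurable_cong_sets[OF sU(1) sJ] measurable_cong_sets[OF sU(2) sJ] by auto
  have fJ: "f \<in> borel_measurable (PiM J ?M)"
    using f measurable_cong_sets[OF sJ refl] by auto
  have "(\<integral>\<^sup>+y. f (restrict y J) \<partial>chan x) = (\<integral>\<^sup>+y. f y \<partial>PiM J ?M)"
    unfolding poisson_channel_def
    using nn_integral_distr[OF rM, of f] fJ dM by simp
  also have "\<dots> = (\<integral>\<^sup>+y. f (restrict y J) \<partial>PiM UNIV ?N)"
    using nn_integral_distr[OF rN, of f] fJ dN NM by simp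
  also have "\<dots> = (\<integral>\<^sup>+y. f (restrict y J) \<partial>density ref_out (\<lambda>y. ennreal (kap J x y)))"
    using density_kap[OF _ J, of x] x by simp
  also have "\<dots> = (\<integral>\<^sup>+y. ennreal (kap J x y) * f (restrict y J) \<partial>ref_out)"
    using measurable_compose[OF r f] by (subst nn_integral_density) auto
  finally show ?thesis .
qed

context poisson_input
begin

lemma emeasure_poisson_measurable:
  "(\<lambda>x. emeasure (measure_pmf (poisson_pmf (rate x j))) E) \<in> borel_measurable input_space"
proof -
  have "emeasure (measure_pmf (poisson_pmf (rate x j))) E = (\<integral>\<^sup>+m. ennreal (pwt (rate x j) m) * indicator E m \<partial>measure_pmf (poisson_pmf 1))"
    if "x \<in> inputs" for x
    using rate_bounds[OF that, of j] density_poisson[of "rate x j", symmetric] by (simp add: emeasure_density)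
  moreover have "(\<lambda>x. \<integral>\<^sup>+m. ennreal (pwt (rate x j) m) * indicator E m \<partial>measure_pmf (poisson_pmf 1)) \<in> borel_measurable input_space"
    by measurable
  ultimately show ?thesis by (subst measurable_cong) auto
qed

text \<open>Cylinders generate the sigma-algebra, and the probability of a cylinder is a finite
  product of Poisson probabilities, each measurable in the rate. Measurability is on
  \<open>input_space\<close>, where the rates are positive.\<close>

lemma chan_kernel [measurable]: "chan \<in> measurable input_space (prob_algebra output_space)"
proof (rule measurable_prob_algebra_generated[OF sets_PiM Int_stable_prod_algebra prod_algebra_sets_into_space])
  show "prob_space (chan x)" for x by (rule prob_space_poisson_channel)
  show "sets (chan x) = sets output_space" for x by simp
  fix E assume "E \<in> prod_algebra (UNIV::int set) (\<lambda>_. count_space (UNIV::nat set))"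
  then obtain J D where D: "E = prod_emb UNIV (\<lambda>_. count_space UNIV) J (Pi\<^sub>E J D)" "finite J"
    by (elim prod_algebraE) auto
  have "emeasure (chan x) E = (\<Prod>j\<in>J. emeasure (measure_pmf (poisson_pmf (rate x j))) (D j))" for x
  proof -
    have "E = prod_emb UNIV (\<lambda>j. measure_pmf (poisson_pmf (rate x j))) J (Pi\<^sub>E J D)"
      unfolding D by (auto simp: prod_emb_def)
    then show ?thesis
      unfolding poisson_channel_def using D(2) by (subst emeasure_PiM_emb[symmetric]) (auto simp: prob_space_measure_pmf)
  qed
  then show "(\<lambda>x. emeasure (chan x) E) \<in> borel_measurable input_space"
    using emeasure_poisson_measurable by simp
qed

lemma chan_kernel_P [measurable]: "chan \<in> measurable P (prob_algebra output_space)"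
  using chan_kernel measurable_cong_sets[OF sets_P refl] by blast

lemma chan_return_kernel:
  "(\<lambda>x. chan x \<bind> (\<lambda>y. return (P \<Otimes>\<^sub>M output_space) (x, y))) \<in> measurable P (prob_algebra (P \<Otimes>\<^sub>M output_space))"
  by measurable

lemma channel_law_alt:
  "channel_law lam0 h L F = P \<bind> (\<lambda>x. chan x \<bind> (\<lambda>y. return (P \<Otimes>\<^sub>M output_space) (x, y)))"
  unfolding channel_law_def P_def ..

lemma prob_space_channel_law: "prob_space (channel_law lam0 h L F)"
  and sets_channel_law [measurable_cong]: "sets (channel_law lam0 h L F) = sets (P \<Otimes>\<^sub>M output_space)"
proof -
  have P: "P \<in> space (prob_algebra P)" by (simp add: space_prob_algebra P.prob_space_axioms)
  have "channel_law lam0 h L F \<in> space (prob_algebra (P \<Otimes>\<^sub>M output_space))"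
    unfolding channel_law_alt
    using measurable_bind_prob_space[OF measurable_const[OF P] chan_return_kernel, of P, THEN measurable_space] P.not_empty
    by blast
  then show "prob_space (channel_law lam0 h L F)" "sets (channel_law lam0 h L F) = sets (P \<Otimes>\<^sub>M output_space)"
    by (auto simp: space_prob_algebra)
qed

lemma nn_integral_channel_law:
  assumes f: "f \<in> borel_measurable (P \<Otimes>\<^sub>M output_space)"
  shows "(\<integral>\<^sup>+w. f w \<partial>channel_law lam0 h L F) = (\<integral>\<^sup>+x. \<integral>\<^sup>+y. f (x, y) \<partial>chan x \<partial>P)"
proof -
  have "(\<integral>\<^sup>+w. f w \<partial>channel_law lam0 h L F) =
      (\<integral>\<^sup>+x. \<integral>\<^sup>+w. f w \<partial>(chan x \<bind> (\<lambda>y. return (P \<Otimes>\<^sub>M output_space) (x, y))) \<partial>P)"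
    unfolding channel_law_alt
    by (rule nn_integral_bind[OF f measurable_prob_algebraD[OF chan_return_kernel]])
  also have "\<dots> = (\<integral>\<^sup>+x. \<integral>\<^sup>+y. f (x, y) \<partial>chan x \<partial>P)"
  proof (rule nn_integral_cong)
    fix x assume x: "x \<in> space P"
    have k: "(\<lambda>y. return (P \<Otimes>\<^sub>M output_space) (x, y)) \<in> measurable (chan x) (subprob_algebra (P \<Otimes>\<^sub>M output_space))"
      using x by measurable
    show "(\<integral>\<^sup>+w. f w \<partial>(chan x \<bind> (\<lambda>y. return (P \<Otimes>\<^sub>M output_space) (x, y)))) = (\<integral>\<^sup>+y. f (x, y) \<partial>chan x)"
      unfolding nn_integral_bind[OF f k] using x f
      by (intro nn_integral_cong nn_integral_return) (auto simp: space_pair_measure)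
  qed
  finally show ?thesis .
qed

definition mixJ :: "int set \<Rightarrow> (int \<Rightarrow> real) \<Rightarrow> (int \<Rightarrow> real) \<Rightarrow> int \<Rightarrow> real" where
  "mixJ J r x = (\<lambda>i. if i \<in> J then r i else x i)"

text \<open>Conditional density of the outputs at times \<open>J\<close> given the inputs
  \<open>r\<close> at times \<open>J\<close> alone: the inputs outside \<open>J\<close> that still
  act on these outputs are averaged out.\<close>

definition qJ :: "int set \<Rightarrow> (int \<Rightarrow> real) \<Rightarrow> (int \<Rightarrow> nat) \<Rightarrow> real" where
  "qJ J r s = (\<integral>x. kap J (mixJ J r x) s \<partial>P)"

context
  fixes J :: "int set"
  assumes J: "finite J"
begin

abbreviation "inJ \<equiv> PiM J (\<lambda>_. F)"
abbreviation "outJ \<equiv> PiM J (\<lambda>_. measure_pmf (poisson_pmf 1))"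

lemma prob_inJ: "prob_space inJ" and prob_outJ: "prob_space outJ"
  by (auto intro!: prob_space_PiM prob_space_F prob_space_measure_pmf)

lemma sets_outJ [measurable_cong]: "sets outJ = sets (PiM J (\<lambda>_. count_space UNIV))"
  by (rule sets_PiM_cong) auto

lemma restrict_in [measurable]: "(\<lambda>x. restrict x J) \<in> measurable P inJ"
  unfolding P_def by (rule measurable_restrict_subset) simp

lemma restrict_out [measurable]: "(\<lambda>y. restrict y J) \<in> measurable output_space outJ"
  by (subst measurable_cong_sets[OF refl sets_outJ]) (rule measurable_restrict_subset, simp)

lemma distr_restrict_in: "distr P inJ (\<lambda>x. restrict x J) = inJ"
  unfolding P_def by (rule distr_PiM_restrict[OF prob_space_F J])

lemma distr_restrict_out: "distr ref_out outJ (\<lambda>x. restrict x J) = outJ"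
  unfolding ref_out_def by (rule distr_PiM_restrict[OF prob_space_measure_pmf J])

lemma mixJ_measurable [measurable (raw)]:
  assumes f: "f \<in> measurable N inJ" and g: "g \<in> measurable N P"
  shows "(\<lambda>w. mixJ J (f w) (g w)) \<in> measurable N input_space"
proof -
  have "(\<lambda>w. mixJ J (f w) (g w)) \<in> measurable N (PiM UNIV (\<lambda>_. F))"
    unfolding mixJ_def
  proof (rule measurable_PiM_single')
    show "(\<lambda>w. if i \<in> J then f w i else g w i) \<in> measurable N F" for i
      using measurable_compose[OF f measurable_component_singleton[of i J "\<lambda>_. F"]]
        measurable_compose[OF g[unfolded P_def] measurable_component_singleton[of i UNIV "\<lambda>_. F"]]
      by (cases "i \<in> J") auto
    show "(\<lambda>w i. if i \<in> J then f w i else g w i) \<in> space N \<rightarrow> UNIV \<rightarrow>\<^sub>E space F"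
      using measurable_space[OF f] measurable_space[OF g[unfolded P_def]] by (auto simp: space_PiM PiE_iff Pi_iff)
  qed
  moreover have "sets (PiM UNIV (\<lambda>_::int. F)) = sets input_space" using sets_P unfolding P_def .
  ultimately show ?thesis using measurable_cong_sets[OF refl] by blast
qed

lemma kapJ_measurable [measurable (raw)]:
  assumes [measurable]: "f \<in> measurable N input_space" and g: "g \<in> measurable N outJ"
  shows "(\<lambda>w. kap J (f w) (g w)) \<in> borel_measurable N"
proof -
  have "(\<lambda>w. g w j) \<in> measurable N (count_space UNIV)" if "j \<in> J" for j
    using measurable_compose[OF g measurable_component_singleton[OF that]] by simp
  then show ?thesis unfolding kap_def by measurable
qed

lemma kap_restrict: "kap J x (restrict y J) = kap J x y"
  by (rule depends_onD[OF kap_depends]) auto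

lemma pd_restrict: "pd J (restrict y J) = pd J y"
  by (rule depends_onD[OF pd_depends]) auto

lemma qJ_measurable [measurable]: "(\<lambda>(r, s). qJ J r s) \<in> borel_measurable (inJ \<Otimes>\<^sub>M outJ)"
  unfolding qJ_def by measurable

lemma pdJ_measurable [measurable]: "pd J \<in> borel_measurable outJ"
  unfolding pd_def by measurable

lemma mixJ_in: "r \<in> space inJ \<Longrightarrow> x \<in> inputs \<Longrightarrow> mixJ J r x \<in> inputs"
  by (auto simp: mixJ_def space_input space_PiM PiE_iff space_F)

lemma restrict_in_space: "x \<in> inputs \<Longrightarrow> restrict x J \<in> space inJ"
  by (auto simp: space_input space_PiM PiE_iff space_F)

lemma qJ_nn: "r \<in> space inJ \<Longrightarrow> ennreal (qJ J r s) = (\<integral>\<^sup>+x. ennreal (kap J (mixJ J r x) s) \<partial>P)"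
  and qJ_nonneg: "r \<in> space inJ \<Longrightarrow> 0 \<le> qJ J r s"
  and qJ_integrable: "r \<in> space inJ \<Longrightarrow> integrable P (\<lambda>x. kap J (mixJ J r x) s)"
proof -
  assume r: "r \<in> space inJ"
  have m: "(\<lambda>x. mixJ J r x) \<in> measurable P input_space"
    using r by measurable
  have "(\<lambda>z. kap J z s) \<in> borel_measurable input_space"
    unfolding kap_def by measurable
  then have "(\<lambda>x. kap J (mixJ J r x) s) \<in> borel_measurable P"
    by (rule measurable_compose[OF m])
  then show i: "integrable P (\<lambda>x. kap J (mixJ J r x) s)"
    using kap_bounds(2)[OF mixJ_in[OF r], of _ J s] kap_nonneg[OF mixJ_in[OF r], of _ J s]
    by (intro P.integrable_const_bound[where B = "exp (\<Sum>j\<in>J. b + c * real (s j))"]) auto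
  show "ennreal (qJ J r s) = (\<integral>\<^sup>+x. ennreal (kap J (mixJ J r x) s) \<partial>P)"
    unfolding qJ_def using kap_nonneg[OF mixJ_in[OF r], of _ J s] by (intro nn_integral_eq_integral[symmetric] i) auto
  show "0 \<le> qJ J r s"
    unfolding qJ_def using kap_nonneg[OF mixJ_in[OF r], of _ J s] by (intro integral_nonneg_AE) auto
qed

text \<open>The first identity changes the output measure to \<open>ref_out\<close>. For the second,
  the inputs outside \<open>J\<close> are replaced by those of an independent copy; integrating over
  the copy first turns \<open>kap\<close> into \<open>qJ\<close>, since the integrand
  \<open>g\<close> sees only the block.\<close>

lemma nn_integral_law:
  assumes g[measurable]: "case_prod g \<in> borel_measurable (inJ \<Otimes>\<^sub>M outJ)"
  shows "(\<integral>\<^sup>+(x, y). g (restrict x J) (restrict y J) \<partial>channel_law lam0 h L F) =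
    (\<integral>\<^sup>+x. \<integral>\<^sup>+y. ennreal (kap J x y) * g (restrict x J) (restrict y J) \<partial>ref_out \<partial>P)" (is "_ = ?R")
    and "(\<integral>\<^sup>+x. \<integral>\<^sup>+y. ennreal (kap J x y) * g (restrict x J) (restrict y J) \<partial>ref_out \<partial>P) =
     (\<integral>\<^sup>+r. \<integral>\<^sup>+s. ennreal (qJ J r s) * g r s \<partial>outJ \<partial>inJ)"
proof -
  have "(\<integral>\<^sup>+(x, y). g (restrict x J) (restrict y J) \<partial>channel_law lam0 h L F) =
    (\<integral>\<^sup>+x. \<integral>\<^sup>+y. g (restrict x J) (restrict y J) \<partial>chan x \<partial>P)"
    by (subst nn_integral_channel_law) auto
  also have "\<dots> = ?R"
  proof (rule nn_integral_cong)
    fix x assume "x \<in> space P"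
    then have x: "x \<in> inputs" by simp
    have "g (restrict x J) \<in> borel_measurable outJ"
      using measurable_Pair2[OF g restrict_in_space[OF x]] by simp
    then have gm: "g (restrict x J) \<in> borel_measurable (PiM J (\<lambda>_. count_space UNIV))"
      using measurable_cong_sets[OF sets_outJ refl] by blast
    show "(\<integral>\<^sup>+y. g (restrict x J) (restrict y J) \<partial>chan x) = (\<integral>\<^sup>+y. ennreal (kap J x y) * g (restrict x J) (restrict y J) \<partial>ref_out)"
      by (rule nn_integral_chan[OF _ J gm]) (use x in \<open>simp add: space_input\<close>)
  qed
  finally show "(\<integral>\<^sup>+(x, y). g (restrict x J) (restrict y J) \<partial>channel_law lam0 h L F) = ?R" .
  define G where "G x = (\<integral>\<^sup>+y. ennreal (kap J x y) * g (restrict x J) (restrict y J) \<partial>ref_out)" for x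
  have G[measurable]: "G \<in> borel_measurable P" unfolding G_def by measurable
  interpret PP: pair_prob_space P P ..
  have mx: "restrict (mixJ J (restrict x J) x') J = restrict x J" for x x' by (auto simp: mixJ_def)
  have "?R = (\<integral>\<^sup>+x. G x \<partial>P)" unfolding G_def ..
  also have "\<dots> = (\<integral>\<^sup>+x. G x \<partial>distr (P \<Otimes>\<^sub>M P) P (\<lambda>(x, x') i. if i \<in> J then x i else x' i))"
    using distr_PiM_mix[of "\<lambda>_. F" J] prob_space_F unfolding P_def by simp
  also have "\<dots> = (\<integral>\<^sup>+(x, x'). G (mixJ J (restrict x J) x') \<partial>(P \<Otimes>\<^sub>M P))"
  proof -
    have "(\<lambda>(x, x') i. if i \<in> J then x i else x' i) \<in> measurable (P \<Otimes>\<^sub>M P) P"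
      unfolding P_def by (rule measurable_PiM_single') (auto simp: space_pair_measure space_PiM PiE_iff split_beta')
    then show ?thesis
      by (subst nn_integral_distr) (auto simp: mixJ_def split_beta' cong: if_cong intro!: nn_integral_cong arg_cong[where f = G])
  qed
  also have "\<dots> = (\<integral>\<^sup>+x. \<integral>\<^sup>+x'. G (mixJ J (restrict x J) x') \<partial>P \<partial>P)"
    by (subst P.nn_integral_fst[symmetric]) (auto simp: split_beta')
  also have "\<dots> = (\<integral>\<^sup>+x. \<integral>\<^sup>+y. ennreal (qJ J (restrict x J) (restrict y J)) * g (restrict x J) (restrict y J) \<partial>ref_out \<partial>P)"
  proof (rule nn_integral_cong)
    fix x assume "x \<in> space P"
    then have x: "restrict x J \<in> space inJ" by (intro restrict_in_space) simp
    have gx[measurable]: "g (restrict x J) \<in> borel_measurable outJ"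
      using measurable_Pair2[OF g x] by simp
    have [measurable]: "(\<lambda>x'. mixJ J (restrict x J) x') \<in> measurable P input_space"
      using x by measurable
    have "(\<integral>\<^sup>+x'. G (mixJ J (restrict x J) x') \<partial>P) =
      (\<integral>\<^sup>+x'. \<integral>\<^sup>+y. ennreal (kap J (mixJ J (restrict x J) x') y) * g (restrict x J) (restrict y J) \<partial>ref_out \<partial>P)"
      unfolding G_def mx ..
    also have "\<dots> = (\<integral>\<^sup>+y. \<integral>\<^sup>+x'. ennreal (kap J (mixJ J (restrict x J) x') y) * g (restrict x J) (restrict y J) \<partial>P \<partial>ref_out)"
      by (rule PR.Fubini'[symmetric]) measurable
    also have "\<dots> = (\<integral>\<^sup>+y. ennreal (qJ J (restrict x J) (restrict y J)) * g (restrict x J) (restrict y J) \<partial>ref_out)"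
      unfolding qJ_nn[OF x] kap_restrict by (intro nn_integral_cong nn_integral_multc) measurable
    finally show "(\<integral>\<^sup>+x'. G (mixJ J (restrict x J) x') \<partial>P) = \<dots>" .
  qed
  also have "\<dots> = (\<integral>\<^sup>+r. \<integral>\<^sup>+y. ennreal (qJ J r (restrict y J)) * g r (restrict y J) \<partial>ref_out \<partial>distr P inJ (\<lambda>x. restrict x J))"
    by (subst nn_integral_distr) auto
  also have "\<dots> = (\<integral>\<^sup>+r. \<integral>\<^sup>+s. ennreal (qJ J r s) * g r s \<partial>distr ref_out outJ (\<lambda>x. restrict x J) \<partial>inJ)"
    unfolding distr_restrict_in
  proof (rule nn_integral_cong)
    fix r assume r: "r \<in> space inJ"
    have [measurable]: "g r \<in> borel_measurable outJ" "qJ J r \<in> borel_measurable outJ"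
      using measurable_Pair2[OF g r] measurable_Pair2[OF qJ_measurable r] by simp_all
    show "(\<integral>\<^sup>+y. ennreal (qJ J r (restrict y J)) * g r (restrict y J) \<partial>ref_out) = (\<integral>\<^sup>+s. ennreal (qJ J r s) * g r s \<partial>distr ref_out outJ (\<lambda>x. restrict x J))"
      by (subst nn_integral_distr) auto
  qed
  finally show "?R = (\<integral>\<^sup>+r. \<integral>\<^sup>+s. ennreal (qJ J r s) * g r s \<partial>outJ \<partial>inJ)"
    unfolding distr_restrict_out .
qed

abbreviation "CL \<equiv> channel_law lam0 h L F"
abbreviation "XJ \<equiv> (\<lambda>(x, y). restrict x J) :: (int \<Rightarrow> real) \<times> (int \<Rightarrow> nat) \<Rightarrow> int \<Rightarrow> real"
abbreviation "YJ \<equiv> (\<lambda>(x, y). restrict y J) :: (int \<Rightarrow> real) \<times> (int \<Rightarrow> nat) \<Rightarrow> int \<Rightarrow> nat"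

lemma XJ_measurable [measurable]: "XJ \<in> measurable CL inJ" and YJ_measurable [measurable]: "YJ \<in> measurable CL outJ"
  unfolding split_beta' by measurable

lemma distributed_joint: "distributed CL (inJ \<Otimes>\<^sub>M outJ) (\<lambda>w. (XJ w, YJ w)) (\<lambda>w. ennreal (qJ J (fst w) (snd w)))"
  unfolding distributed_def
proof (intro conjI measure_eqI)
  interpret outJ: prob_space outJ by (rule prob_outJ)
  fix D assume "D \<in> sets (distr CL (inJ \<Otimes>\<^sub>M outJ) (\<lambda>w. (XJ w, YJ w)))"
  then have D[measurable]: "D \<in> sets (inJ \<Otimes>\<^sub>M outJ)" by simp
  have "emeasure (distr CL (inJ \<Otimes>\<^sub>M outJ) (\<lambda>w. (XJ w, YJ w))) D = (\<integral>\<^sup>+w. indicator D w \<partial>distr CL (inJ \<Otimes>\<^sub>M outJ) (\<lambda>w. (XJ w, YJ w)))"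
    by simp
  also have "\<dots> = (\<integral>\<^sup>+(x, y). indicator D (restrict x J, restrict y J) \<partial>CL)"
    by (subst nn_integral_distr) (auto simp: split_beta')
  also have "\<dots> = (\<integral>\<^sup>+r. \<integral>\<^sup>+s. ennreal (qJ J r s) * indicator D (r, s) \<partial>outJ \<partial>inJ)"
    using nn_integral_law[of "\<lambda>r s. indicator D (r, s)"] by simp
  also have "\<dots> = (\<integral>\<^sup>+w. ennreal (qJ J (fst w) (snd w)) * indicator D w \<partial>(inJ \<Otimes>\<^sub>M outJ))"
    by (subst outJ.nn_integral_fst[symmetric]) (auto simp: split_beta'[symmetric])
  also have "\<dots> = emeasure (density (inJ \<Otimes>\<^sub>M outJ) (\<lambda>w. ennreal (qJ J (fst w) (snd w)))) D"
    by (subst emeasure_density) (auto simp: split_beta'[symmetric])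
  finally show "emeasure (distr CL (inJ \<Otimes>\<^sub>M outJ) (\<lambda>w. (XJ w, YJ w))) D = \<dots>" .
qed (auto simp: split_beta'[symmetric])

lemma distributed_in: "distributed CL inJ XJ (\<lambda>_. 1)"
  unfolding distributed_def
proof (intro conjI measure_eqI)
  fix D assume "D \<in> sets (distr CL inJ XJ)"
  then have D[measurable]: "D \<in> sets inJ" by simp
  have "emeasure (distr CL inJ XJ) D = (\<integral>\<^sup>+w. indicator D w \<partial>distr CL inJ XJ)" by simp
  also have "\<dots> = (\<integral>\<^sup>+w. indicator D (restrict (fst w) J) \<partial>CL)"
    by (subst nn_integral_distr) (auto simp: split_beta')
  also have "\<dots> = (\<integral>\<^sup>+x. \<integral>\<^sup>+y. indicator D (restrict x J) \<partial>chan x \<partial>P)"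
    by (subst nn_integral_channel_law) auto
  also have "\<dots> = (\<integral>\<^sup>+x. indicator D (restrict x J) \<partial>P)"
    using prob_space.emeasure_space_1[OF prob_space_poisson_channel, of lam0 h L] by (simp del: nn_integral_indicator)
  also have "\<dots> = (\<integral>\<^sup>+r. indicator D r \<partial>distr P inJ (\<lambda>x. restrict x J))"
    by (subst nn_integral_distr) auto
  also have "\<dots> = emeasure (density inJ (\<lambda>_. 1)) D"
    unfolding distr_restrict_in by (simp add: density_1)
  finally show "emeasure (distr CL inJ XJ) D = emeasure (density inJ (\<lambda>_. 1)) D" .
qed auto

lemma distributed_out: "distributed CL outJ YJ (\<lambda>s. ennreal (pd J s))"
  unfolding distributed_def
proof (intro conjI measure_eqI)
  fix D assume "D \<in> sets (distr CL outJ YJ)"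
  then have D[measurable]: "D \<in> sets outJ" by simp
  have "emeasure (distr CL outJ YJ) D = (\<integral>\<^sup>+w. indicator D w \<partial>distr CL outJ YJ)" by simp
  also have "\<dots> = (\<integral>\<^sup>+(x, y). indicator D (restrict y J) \<partial>CL)"
    by (subst nn_integral_distr) (auto simp: split_beta')
  also have "\<dots> = (\<integral>\<^sup>+x. \<integral>\<^sup>+y. ennreal (kap J x y) * indicator D (restrict y J) \<partial>ref_out \<partial>P)"
    using nn_integral_law(1)[of "\<lambda>r s. indicator D s"] by simp
  also have "\<dots> = (\<integral>\<^sup>+y. \<integral>\<^sup>+x. ennreal (kap J x y) * indicator D (restrict y J) \<partial>P \<partial>ref_out)"
    by (rule PR.Fubini'[symmetric]) measurable
  also have "\<dots> = (\<integral>\<^sup>+y. ennreal (pd J (restrict y J)) * indicator D (restrict y J) \<partial>ref_out)"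
  proof (rule nn_integral_cong)
    fix y
    have "(\<integral>\<^sup>+x. ennreal (kap J x y) \<partial>P) = ennreal (pd J y)"
      unfolding pd_def using kap_nonneg by (intro nn_integral_eq_integral kap_integrable) auto
    then show "(\<integral>\<^sup>+x. ennreal (kap J x y) * indicator D (restrict y J) \<partial>P) = ennreal (pd J (restrict y J)) * indicator D (restrict y J)"
      unfolding pd_restrict by (subst nn_integral_multc) auto
  qed
  also have "\<dots> = (\<integral>\<^sup>+s. ennreal (pd J s) * indicator D s \<partial>distr ref_out outJ (\<lambda>x. restrict x J))"
    by (subst nn_integral_distr) auto
  also have "\<dots> = emeasure (density outJ (\<lambda>s. ennreal (pd J s))) D"
    unfolding distr_restrict_out by (subst emeasure_density) auto
  finally show "emeasure (distr CL outJ YJ) D = emeasure (density outJ (\<lambda>s. ennreal (pd J s))) D" .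
qed auto

text \<open>Inside the logarithm stands the conditional density \<open>qJ\<close>, but the weight is
  \<open>kap\<close> on whole input sequences. In this form the information can be compared with
  \<open>a\<close> under one and the same measure.\<close>

lemma mutual_information_law:
  "prob_space.mutual_information CL (exp 1) inJ (PiM J (\<lambda>_. count_space UNIV)) XJ YJ =
   (\<integral>(x, y). kap J x y * ln (qJ J (restrict x J) y / pd J y) \<partial>base)"
proof -
  interpret CL: prob_space CL by (rule prob_space_channel_law)
  interpret CL: information_space CL "exp 1" by standard simp
  interpret inJ: prob_space inJ by (rule prob_inJ)
  interpret outJ: prob_space outJ by (rule prob_outJ)
  let ?T = "PiM J (\<lambda>_. count_space (UNIV :: nat set))"
  let ?S2 = "inJ \<Otimes>\<^sub>M outJ"
  have s2: "sets (inJ \<Otimes>\<^sub>M ?T) = sets ?S2" by (rule sets_pair_measure_cong) (auto simp: sets_outJ)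
  \<comment> \<open>The measure on the output block enters only through its sigma-algebra, so the
    counting measures may be replaced by Poisson laws.\<close>
  have "CL.mutual_information (exp 1) inJ ?T XJ YJ = CL.mutual_information (exp 1) inJ outJ XJ YJ"
    unfolding CL.mutual_information_def
    using distr_cong[OF refl sets_outJ[symmetric], of CL YJ YJ] distr_cong[OF refl s2, of CL "\<lambda>w. (XJ w, YJ w)" "\<lambda>w. (XJ w, YJ w)"] by simp
  also have "\<dots> = (\<integral>w. qJ J (fst w) (snd w) * log (exp 1) (qJ J (fst w) (snd w) / (1 * pd J (snd w))) \<partial>?S2)"
    using CL.mutual_information_distr[where S = inJ and T = outJ and X = XJ and Y = YJ and Px = "\<lambda>_. 1" and Py = "pd J" and Pxy = "\<lambda>w. qJ J (fst w) (snd w)"]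
      distributed_in distributed_out distributed_joint qJ_nonneg less_imp_le[OF pd_pos] inJ.sigma_finite_measure_axioms outJ.sigma_finite_measure_axioms
    by simp
  also have "\<dots> = (\<integral>w. ln (qJ J (fst w) (snd w) / pd J (snd w)) \<partial>density ?S2 (\<lambda>w. ennreal (qJ J (fst w) (snd w))))"
    using qJ_nonneg by (subst integral_density) (auto simp: space_pair_measure log_def split_beta'[symmetric])
  \<comment> \<open>The block law with density \<open>qJ\<close> is the image of the joint law with
    density \<open>kap\<close> on whole sequences.\<close>
  also have "density ?S2 (\<lambda>w. ennreal (qJ J (fst w) (snd w))) =
      distr (density base (\<lambda>w. ennreal (kap J (fst w) (snd w)))) ?S2 (\<lambda>w. (restrict (fst w) J, restrict (snd w) J))"
  proof (rule measure_eqI)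
    fix D assume "D \<in> sets (density ?S2 (\<lambda>w. ennreal (qJ J (fst w) (snd w))))"
    then have D[measurable]: "D \<in> sets ?S2" by simp
    have "emeasure (density ?S2 (\<lambda>w. ennreal (qJ J (fst w) (snd w)))) D = (\<integral>\<^sup>+r. \<integral>\<^sup>+s. ennreal (qJ J r s) * indicator D (r, s) \<partial>outJ \<partial>inJ)"
      by (subst emeasure_density, auto simp: split_beta'[symmetric]) (subst outJ.nn_integral_fst[symmetric], auto simp: split_beta'[symmetric])
    also have "\<dots> = (\<integral>\<^sup>+x. \<integral>\<^sup>+y. ennreal (kap J x y) * indicator D (restrict x J, restrict y J) \<partial>ref_out \<partial>P)"
      using nn_integral_law(2)[of "\<lambda>r s. indicator D (r, s)"] by simp
    also have "\<dots> = (\<integral>\<^sup>+w. ennreal (kap J (fst w) (snd w)) * indicator D (restrict (fst w) J, restrict (snd w) J) \<partial>base)"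
      by (subst ref_out.nn_integral_fst[symmetric]) auto
    also have "\<dots> = (\<integral>\<^sup>+w. indicator D w \<partial>distr (density base (\<lambda>w. ennreal (kap J (fst w) (snd w)))) ?S2 (\<lambda>w. (restrict (fst w) J, restrict (snd w) J)))"
      by (subst nn_integral_distr; (subst nn_integral_density)?) auto
    finally show "emeasure (density ?S2 (\<lambda>w. ennreal (qJ J (fst w) (snd w)))) D =
      emeasure (distr (density base (\<lambda>w. ennreal (kap J (fst w) (snd w)))) ?S2 (\<lambda>w. (restrict (fst w) J, restrict (snd w) J))) D"
      by simp
  qed simp
  also have "(\<integral>w. ln (qJ J (fst w) (snd w) / pd J (snd w)) \<partial>\<dots>) =
      (\<integral>w. kap J (fst w) (snd w) * ln (qJ J (restrict (fst w) J) (restrict (snd w) J) / pd J (restrict (snd w) J)) \<partial>base)"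
    using kap_nonneg by (subst integral_distr; (subst integral_density)?) (auto simp: space_pair_measure split_beta'[symmetric])
  also have "\<dots> = (\<integral>(x, y). kap J x y * ln (qJ J (restrict x J) y / pd J y) \<partial>base)"
    unfolding qJ_def kap_restrict pd_restrict split_beta' ..
  finally show ?thesis .
qed

end

end

section \<open>Comparison of the block information with \<open>a\<close>\<close>

context poisson_input
begin

text \<open>Expectation of the information density \<open>ln (kap J x) - ln (pd J)\<close> over the
  outputs, given the input \<open>x\<close>.\<close>

definition Psi :: "int set \<Rightarrow> (int \<Rightarrow> real) \<Rightarrow> real" where
  "Psi J x = (\<Sum>j\<in>J. theta (rate x j)) - Ups J x"

lemma Psi_integral: "(\<integral>x. Psi {1..int n} x \<partial>P) = a n"
  unfolding Psi_def using theta_rate_integral Ups_integrable[of "{1..int n}"]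
  by (simp add: a_def U_def)

lemma ln_kap:
  assumes "\<And>k. 0 \<le> x k"
  shows "ln (kap J x y) = (\<Sum>j\<in>J. 1 - rate x j + real (y j) * ln (rate x j))"
proof (cases "finite J")
  case True
  have "ln (pwt (rate x j) (y j)) = 1 - rate x j + real (y j) * ln (rate x j)" for j
    using rate_pos[of x j, OF assms] by (simp add: pwt_def ln_mult ln_realpow)
  then show ?thesis
    unfolding kap_def using True less_imp_neq[OF pwt_pos[OF rate_pos[of x, OF assms]], symmetric] by (subst ln_prod) auto
qed (simp add: kap_def)

lemma ln_kap_bound: "x \<in> inputs \<Longrightarrow> \<bar>ln (kap J x y)\<bar> \<le> (\<Sum>j\<in>J. b + c * real (y j))"
using abs_ln_diff_le[of 1 "\<Sum>j\<in>J. b + c * real (y j)" "kap J x y"] kap_bounds[of x] by simp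

lemma integral_ln_kap:
  assumes x: "x \<in> inputs"
  shows "integrable (chan x) (\<lambda>y. ln (kap J x y) - ln (pd J y))"
    and "(\<integral>y. ln (kap J x y) - ln (pd J y) \<partial>chan x) = Psi J x"
proof -
  have nn: "\<And>k. 0 \<le> x k" using x by (auto simp: space_input)
  interpret cx: prob_space "chan x" by (rule prob_space_poisson_channel)
  have m: "has_bochner_integral (chan x) (\<lambda>y. real (y j)) (rate x j)" for j
    by (rule chan_mean[of x, OF nn])
  have 1: "has_bochner_integral (chan x) (\<lambda>y. 1 - rate x j) (1 - rate x j)" for j
    using cx.prob_space by (simp add: has_bochner_integral_iff)
  have "has_bochner_integral (chan x) (\<lambda>y. \<Sum>j\<in>J. 1 - rate x j + real (y j) * ln (rate x j)) (\<Sum>j\<in>J. 1 - rate x j + rate x j * ln (rate x j))"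
    by (intro has_bochner_integral_sum has_bochner_integral_add 1 has_bochner_integral_mult_left m)
  then have k: "has_bochner_integral (chan x) (\<lambda>y. ln (kap J x y)) (\<Sum>j\<in>J. theta (rate x j))"
    unfolding ln_kap[of x, OF nn] theta_def by simp
  have p: "integrable (chan x) (\<lambda>y. ln (pd J y))"
    by (rule chan_bound(1)[of x, OF nn _ ln_pd_bound]) simp
  show "integrable (chan x) (\<lambda>y. ln (kap J x y) - ln (pd J y))"
    "(\<integral>y. ln (kap J x y) - ln (pd J y) \<partial>chan x) = Psi J x"
    using k p by (auto simp: has_bochner_integral_iff Psi_def Ups_def)
qed

lemma kap_split:
  assumes v: "v \<in> inputs" and J: "finite J" "J1 \<subseteq> J"
  shows "exp (- (\<Sum>j\<in>J1. b + c * real (y j))) * kap (J - J1) v y \<le> kap J v y"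
    "kap J v y \<le> exp (\<Sum>j\<in>J1. b + c * real (y j)) * kap (J - J1) v y"
proof -
  have "kap J v y = kap J1 v y * kap (J - J1) v y"
    unfolding kap_def using J by (subst prod.subset_diff[of J1 J]) (auto simp: mult.commute)
  then show "exp (- (\<Sum>j\<in>J1. b + c * real (y j))) * kap (J - J1) v y \<le> kap J v y"
    "kap J v y \<le> exp (\<Sum>j\<in>J1. b + c * real (y j)) * kap (J - J1) v y"
    using kap_bounds[OF v, where J = J1 and y = y] kap_nonneg[OF v, of "J - J1" y] by (auto intro!: mult_right_mono)
qed

text \<open>For the third bound: only outputs at times up to \<open>L\<close> see inputs before time
  1. All other likelihood factors are common to \<open>qJ\<close> and \<open>kap\<close>, and each
  of the two differs from this common part \<open>K\<close> by at most \<open>exp ?s\<close> either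
  way; hence the factor 2.\<close>

lemma qJ_bounds:
  assumes x: "x \<in> inputs"
  shows "exp (- (\<Sum>j\<in>{1..int n}. b + c * real (y j))) \<le> qJ {1..int n} (restrict x {1..int n}) y"
    and "qJ {1..int n} (restrict x {1..int n}) y \<le> exp (\<Sum>j\<in>{1..int n}. b + c * real (y j))"
    and "\<bar>ln (qJ {1..int n} (restrict x {1..int n}) y) - ln (kap {1..int n} x y)\<bar> \<le> (\<Sum>j\<in>{1..int n} \<inter> {..int L}. 2 * b + 2 * c * real (y j))"
proof -
  let ?J = "{1..int n}" and ?J1 = "{1..int n} \<inter> {..int L}"
  let ?v = "\<lambda>x'. mixJ ?J (restrict x ?J) x'"
  let ?s = "\<Sum>j\<in>?J1. b + c * real (y j)"
  have J: "finite ?J" "?J1 \<subseteq> ?J" by auto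
  have r: "restrict x ?J \<in> space (PiM ?J (\<lambda>_. F))" by (rule restrict_in_space[OF _ x]) simp
  have v: "?v x' \<in> inputs" if "x' \<in> space P" for x'
    using that by (intro mixJ_in[OF _ r]) auto
  have int: "integrable P (\<lambda>x'. kap ?J (?v x') y)"
    by (rule qJ_integrable[OF _ r]) simp
  \<comment> \<open>For \<open>j > L\<close> the inputs at \<open>j - L..j\<close> all lie in the
    block, where the spliced sequence equals \<open>x\<close>.\<close>
  have K2: "kap (?J - ?J1) (?v x') y = kap (?J - ?J1) x y" for x'
    unfolding kap_def by (intro prod.cong refl arg_cong2[where f = pwt] rate_cong) (auto simp: mixJ_def)
  define K where "K = kap (?J - ?J1) x y"
  have Kpos: "K > 0" unfolding K_def using x by (intro kap_pos) (auto simp: space_input)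
  let ?q = "qJ ?J (restrict x ?J) y"
  show lo: "exp (- (\<Sum>j\<in>?J. b + c * real (y j))) \<le> ?q"
    unfolding qJ_def by (rule P.integral_ge_const[OF int]) (rule AE_I2, rule kap_bounds, rule v)
  show "?q \<le> exp (\<Sum>j\<in>?J. b + c * real (y j))"
    unfolding qJ_def by (rule P.integral_le_const[OF int]) (rule AE_I2, rule kap_bounds, rule v)
  have v1: "exp (- ?s) * K \<le> kap ?J (?v x') y" and v2: "kap ?J (?v x') y \<le> exp ?s * K" if "x' \<in> space P" for x'
    unfolding K_def K2[symmetric, of x'] by (rule kap_split[OF v[OF that] J])+
  have q1: "exp (- ?s) * K \<le> ?q"
    unfolding qJ_def by (rule P.integral_ge_const[OF int]) (rule AE_I2, rule v1)
  have q2: "?q \<le> exp ?s * K"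
    unfolding qJ_def by (rule P.integral_le_const[OF int]) (rule AE_I2, rule v2)
  have k1: "exp (- ?s) * K \<le> kap ?J x y" and k2: "kap ?J x y \<le> exp ?s * K"
    unfolding K_def by (rule kap_split[OF x J])+
  have "\<bar>ln ?q - ln (kap ?J x y)\<bar> \<le> 2 * ?s"
    using abs_ln_diff_le[OF Kpos q1 q2] abs_ln_diff_le[OF Kpos k1 k2] by linarith
  also have "\<dots> = (\<Sum>j\<in>?J1. 2 * b + 2 * c * real (y j))"
    by (simp add: sum_distrib_left algebra_simps)
  finally show "\<bar>ln ?q - ln (kap ?J x y)\<bar> \<le> (\<Sum>j\<in>?J1. 2 * b + 2 * c * real (y j))" .
qed

lemma qJ_restrict: "qJ J r (restrict y J) = qJ J r y"
proof -
  have "kap J x (restrict y J) = kap J x y" for x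
    by (rule depends_onD[OF kap_depends]) auto
  then show ?thesis by (simp add: qJ_def)
qed

lemma qJ_comp_measurable:
  "(\<lambda>(x, y). qJ {1..int n} (restrict x {1..int n}) y) \<in> borel_measurable (input_space \<Otimes>\<^sub>M output_space)"
proof -
  let ?J = "{1..int n}"
  have "(\<lambda>x. restrict x ?J) \<in> measurable input_space (PiM ?J (\<lambda>_. F))"
    using restrict_in[of ?J] measurable_cong_sets[OF sets_P refl] by blast
  moreover have "(\<lambda>y. restrict y ?J) \<in> measurable output_space (PiM ?J (\<lambda>_. measure_pmf (poisson_pmf 1)))"
    by (rule restrict_out) simp
  ultimately have "(\<lambda>w. (restrict (fst w) ?J, restrict (snd w) ?J)) \<in> measurable (input_space \<Otimes>\<^sub>M output_space)
      (PiM ?J (\<lambda>_. F) \<Otimes>\<^sub>M PiM ?J (\<lambda>_. measure_pmf (poisson_pmf 1)))"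
    by (intro measurable_Pair) (auto intro: measurable_compose[OF measurable_fst] measurable_compose[OF measurable_snd])
  from measurable_compose[OF this qJ_measurable[of ?J]]
  show ?thesis by (simp add: split_beta' qJ_restrict)
qed

text \<open>Both quantities are averages of log-likelihood ratios under the same channel; they
  differ only by \<open>ln (qJ ..) - ln (kap ..)\<close>, which involves at most \<open>L\<close>
  outputs. The cost of ignoring the inputs before the block is therefore bounded in
  \<open>n\<close>.\<close>

lemma block_information_bound: "\<bar>block_information lam0 h L F n - a n\<bar> \<le> real L * (2 * b + 2 * c * M)"
proof -
  let ?J = "{1..int n}" and ?J1 = "{1..int n} \<inter> {..int L}"
  define q where "q x y = qJ ?J (restrict x ?J) y" for x y
  have qpos: "q x y > 0" if "x \<in> inputs" for x y
    unfolding q_def by (rule less_le_trans[OF exp_gt_zero qJ_bounds(1)[OF that]])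
  have qm[measurable]: "(\<lambda>(x, y). q x y) \<in> borel_measurable (input_space \<Otimes>\<^sub>M output_space)"
    unfolding q_def by (rule qJ_comp_measurable)
  have qdep: "outputs_depend ?J (q x)" for x
  proof (rule depends_onI)
    fix y y' :: "int \<Rightarrow> nat" assume "\<forall>i\<in>?J. y i = y' i"
    then have "restrict y ?J = restrict y' ?J" by (auto simp: restrict_def)
    then show "q x y = q x y'" unfolding q_def by (metis qJ_restrict)
  qed
  have qbd: "\<bar>ln (q x y)\<bar> \<le> (\<Sum>j\<in>?J. b + c * real (y j))" if x: "x \<in> inputs" for x y
    using abs_ln_diff_le[of 1 "\<Sum>j\<in>?J. b + c * real (y j)" "q x y"] qJ_bounds(1,2)[OF x, where n = n and y = y]
    by (simp add: q_def)
  let ?f1 = "\<lambda>x y. ln (q x y) - ln (pd ?J y)" and ?f2 = "\<lambda>x y. ln (kap ?J x y) - ln (pd ?J y)"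
  have m1: "case_prod ?f1 \<in> borel_measurable (input_space \<Otimes>\<^sub>M output_space)"
   and m2: "case_prod ?f2 \<in> borel_measurable (input_space \<Otimes>\<^sub>M output_space)"
    using qm by measurable
  have sum2: "(\<Sum>j\<in>?J. b + c * real (y j)) + (\<Sum>j\<in>?J. b + c * real (y j)) = (\<Sum>j\<in>?J. 2 * b + 2 * c * real (y j))" for y :: "int \<Rightarrow> nat"
    by (simp add: sum.distrib[symmetric] algebra_simps)
  have b1: "\<bar>?f1 x y\<bar> \<le> (\<Sum>j\<in>?J. 2 * b + 2 * c * real (y j))" if "x \<in> inputs" for x y
    using qbd[OF that, of y] ln_pd_bound[of ?J y] unfolding sum2[symmetric] by linarith
  have b2: "\<bar>?f2 x y\<bar> \<le> (\<Sum>j\<in>?J. 2 * b + 2 * c * real (y j))" if "x \<in> inputs" for x y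
    using ln_kap_bound[OF that, of ?J y] ln_pd_bound[of ?J y] unfolding sum2[symmetric] by linarith
  have d1: "outputs_depend ?J (?f1 x)" for x
    by (rule depends_on_compose2[OF qdep pd_depends])
  have d2: "outputs_depend ?J (?f2 x)" for x
    by (rule depends_on_compose2[OF kap_depends pd_depends])
  have c2: "2 * c \<ge> 0" using c_nonneg by simp
  have fin: "finite ?J" by simp
  note F1 = fubini_kap[OF fin m1 d1 b1 c2] and F2 = fubini_kap[OF fin m2 d2 b2 c2]
  have "block_information lam0 h L F n = (\<integral>(x, y). kap ?J x y * ln (qJ ?J (restrict x ?J) y / pd ?J y) \<partial>base)"
    unfolding block_information_def by (rule mutual_information_law) simp
  also have "\<dots> = (\<integral>(x, y). kap ?J x y * ?f1 x y \<partial>base)"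
  proof (rule Bochner_Integration.integral_cong[OF refl])
    fix w assume "w \<in> space base"
    then have "fst w \<in> inputs" by (auto simp: space_pair_measure)
    from qpos[OF this, of "snd w"] pd_pos[of ?J "snd w"]
    show "(case w of (x, y) \<Rightarrow> kap ?J x y * ln (qJ ?J (restrict x ?J) y / pd ?J y)) = (case w of (x, y) \<Rightarrow> kap ?J x y * ?f1 x y)"
      by (simp add: split_beta' q_def ln_div)
  qed
  also have "\<dots> = (\<integral>x. (\<integral>y. ?f1 x y \<partial>chan x) \<partial>P)" by (rule F1(2))
  finally have I: "block_information lam0 h L F n = (\<integral>x. (\<integral>y. ?f1 x y \<partial>chan x) \<partial>P)" .
  have A: "a n = (\<integral>x. (\<integral>y. ?f2 x y \<partial>chan x) \<partial>P)"
    unfolding Psi_integral[symmetric] by (rule Bochner_Integration.integral_cong[OF refl]) (simp add: integral_ln_kap)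
  have m1': "?f1 x \<in> borel_measurable output_space" if "x \<in> inputs" for x
    using measurable_Pair2[OF m1 that] by simp
  have m2': "?f2 x \<in> borel_measurable output_space" if "x \<in> inputs" for x
    using measurable_Pair2[OF m2 that] by simp
  have pt: "\<bar>(\<integral>y. ?f1 x y \<partial>chan x) - (\<integral>y. ?f2 x y \<partial>chan x)\<bar> \<le> real L * (2 * b + 2 * c * M)" if x: "x \<in> inputs" for x
  proof -
    have nn: "\<And>k. 0 \<le> x k" using x by (auto simp: space_input)
    have i: "integrable (chan x) (?f1 x)" "integrable (chan x) (?f2 x)"
      by (rule chan_bound(1)[of x, OF nn m1'[OF x] b1[OF x]], rule chan_bound(1)[of x, OF nn m2'[OF x] b2[OF x]])
    have "\<bar>\<integral>y. ?f1 x y - ?f2 x y \<partial>chan x\<bar> \<le> (\<Sum>j\<in>?J1. 2 * b + 2 * c * rate x j)"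
    proof (rule chan_bound(2)[of x, OF nn])
      show "(\<lambda>y. ?f1 x y - ?f2 x y) \<in> borel_measurable output_space" using m1'[OF x] m2'[OF x] by measurable
      show "\<bar>?f1 x y - ?f2 x y\<bar> \<le> (\<Sum>j\<in>?J1. 2 * b + 2 * c * real (y j))" for y
        using qJ_bounds(3)[OF x, where n = n and y = y] by (simp add: q_def)
    qed
    also have "\<dots> \<le> (\<Sum>j\<in>?J1. 2 * b + 2 * c * M)"
      using rate_bounds[OF x] c_nonneg by (intro sum_mono add_left_mono mult_left_mono) auto
    also have "\<dots> = real (card ?J1) * (2 * b + 2 * c * M)" by simp
    also have "\<dots> \<le> real L * (2 * b + 2 * c * M)"
    proof (rule mult_right_mono)
      have "card ?J1 \<le> card {1..int L}" by (rule card_mono) auto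
      then show "real (card ?J1) \<le> real L" by simp
    qed (use b_nonneg c_nonneg M_pos in auto)
    finally show ?thesis unfolding Bochner_Integration.integral_diff[OF i] .
  qed
  have "block_information lam0 h L F n - a n = (\<integral>x. (\<integral>y. ?f1 x y \<partial>chan x) - (\<integral>y. ?f2 x y \<partial>chan x) \<partial>P)"
    unfolding I A using F1(3) F2(3) by simp
  also have "\<bar>\<dots>\<bar> \<le> real L * (2 * b + 2 * c * M)"
    using F1(3) F2(3) pt by (intro P_bounded(2)) (auto simp: measurable_cong_sets[OF sets_P refl, symmetric] intro!: borel_measurable_diff borel_measurable_integrable)
  finally show ?thesis .
qed

text \<open>\<open>information_rate\<close> is defined by \<open>lim\<close> and acquires its
  meaning only once convergence is known; the sandwich identifies it with the \<open>R\<close> of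
  \<open>a_rate\<close>, whose estimates hold at each \<open>n >= 1\<close>.\<close>

lemma information_rate_approx:
  assumes n: "n \<ge> 1"
  shows "real n * information_rate lam0 h L F \<le> a n"
    and "a n \<le> real n * information_rate lam0 h L F + real L * (b + c * M) + real L * (1 + b + 2 * c * M)"
proof -
  obtain R where R: "\<And>n. n \<ge> 1 \<Longrightarrow> real n * R \<le> a n"
    "\<And>n. n \<ge> 1 \<Longrightarrow> a n \<le> real n * R + real L * (b + c * M) + real L * (1 + b + 2 * c * M)"
    using a_rate by blast
  define D where "D = real L * (2 * b + 2 * c * M)"
  define E where "E = real L * (b + c * M) + real L * (1 + b + 2 * c * M)"
  have bd: "R - D / real n \<le> block_information lam0 h L F n / real n \<and> block_information lam0 h L F n / real n \<le> R + (D + E) / real n"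
    if "n \<ge> 1" for n
  proof -
    have "real n * R - D \<le> block_information lam0 h L F n" "block_information lam0 h L F n \<le> real n * R + (D + E)"
      using R[OF that] block_information_bound[of n] unfolding D_def E_def by linarith+
    then have "(real n * R - D) / real n \<le> block_information lam0 h L F n / real n"
      "block_information lam0 h L F n / real n \<le> (real n * R + (D + E)) / real n"
      by (auto intro: divide_right_mono)
    then show ?thesis using that by (simp add: diff_divide_distrib add_divide_distrib)
  qed
  have "(\<lambda>n. block_information lam0 h L F n / real n) \<longlonglongrightarrow> R"
  proof (rule tendsto_sandwich)
    show "(\<lambda>n. R - D / real n) \<longlonglongrightarrow> R" "(\<lambda>n. R + (D + E) / real n) \<longlonglongrightarrow> R" by real_asymp+
    show "\<forall>\<^sub>F n in sequentially. R - D / real n \<le> block_information lam0 h L F n / real n"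
      "\<forall>\<^sub>F n in sequentially. block_information lam0 h L F n / real n \<le> R + (D + E) / real n"
      using bd by (auto intro!: eventually_sequentiallyI[of 1])
  qed
  then have "information_rate lam0 h L F = R"
    unfolding information_rate_def by (rule limI)
  then show "real n * information_rate lam0 h L F \<le> a n"
    "a n \<le> real n * information_rate lam0 h L F + real L * (b + c * M) + real L * (1 + b + 2 * c * M)"
    using R[OF n] by simp_all
qed

end

section \<open>Perturbation of the input law\<close>

context poisson_input
begin

lemma measurable_upd_input [measurable (raw)]:
  assumes f: "f \<in> measurable N input_space" and g: "g \<in> measurable N F"
  shows "(\<lambda>w. (f w)(k := g w)) \<in> measurable N input_space"
proof (rule measurable_fun_upd[of UNIV UNIV])
  show "g \<in> measurable N (restrict_space borel {0..A})"
    using g measurable_cong_sets[OF refl sets_F] by blast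
qed (use f in auto)

lemma upd_in_space: "x \<in> inputs \<Longrightarrow> u \<in> space F \<Longrightarrow> x(k := u) \<in> inputs"
  by (auto simp: space_input space_F)

lemma coordinate_integral:
  fixes \<phi> :: "real \<Rightarrow> real"
  assumes \<phi>: "\<phi> \<in> borel_measurable F"
  shows "(\<integral>x. \<phi> (x k) \<partial>P) = (\<integral>u. \<phi> u \<partial>F)" and "integrable P (\<lambda>x. \<phi> (x k)) \<longleftrightarrow> integrable F \<phi>"
proof -
  have d: "distr P F (\<lambda>x. x k) = F"
    unfolding P_def by (rule distr_PiM_component[OF prob_space_F]) simp
  have m: "(\<lambda>x. x k) \<in> measurable P F"
    unfolding P_def by (rule measurable_component_singleton) simp
  show "(\<integral>x. \<phi> (x k) \<partial>P) = (\<integral>u. \<phi> u \<partial>F)" "integrable P (\<lambda>x. \<phi> (x k)) \<longleftrightarrow> integrable F \<phi>"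
    using integral_distr[OF m \<phi>] integrable_distr_eq[OF m \<phi>] unfolding d by auto
qed

lemma coordinate_indep:
  fixes \<phi> :: "real \<Rightarrow> real"
  assumes \<phi>: "integrable F \<phi>" and G: "integrable P G"
    and inv: "\<And>x u. x \<in> inputs \<Longrightarrow> u \<in> space F \<Longrightarrow> G (x(k := u)) = G x"
  shows "(\<integral>x. \<phi> (x k) * G x \<partial>P) = (\<integral>u. \<phi> u \<partial>F) * (\<integral>x. G x \<partial>P)"
    and "integrable P (\<lambda>x. \<phi> (x k) * G x)"
proof -
  have ik: "integrable P (\<lambda>x. \<phi> (x k))" using \<phi> coordinate_integral(2)[of \<phi> k] by auto
  have dG: "depends_on (- {k}) (space P) G"
    unfolding depends_on_def
  proof (intro ballI impI)
    fix x y assume xy: "x \<in> space P" "y \<in> space P" and eq: "\<forall>i\<in>- {k}. x i = y i"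
    have "y = x(k := y k)" using eq by (auto simp: fun_eq_iff)
    moreover have "y k \<in> space F" using xy by (auto simp: space_input space_F)
    ultimately show "G x = G y" using inv[of x "y k"] xy by simp
  qed
  have d\<phi>: "depends_on {k} (space P) (\<lambda>x. \<phi> (x k))" by (auto simp: depends_on_def)
  show "(\<integral>x. \<phi> (x k) * G x \<partial>P) = (\<integral>u. \<phi> u \<partial>F) * (\<integral>x. G x \<partial>P)"
    "integrable P (\<lambda>x. \<phi> (x k) * G x)"
    using integral_PiM_indep[OF prob_space_F, of "\<lambda>x. \<phi> (x k)" G "{k}"] ik G d\<phi> dG coordinate_integral(1)[of \<phi> k] \<phi>
    unfolding P_def by auto
qed

text \<open>Splicing along the complement of \<open>k\<close> makes the value at time
  \<open>k\<close> independent of the rest. The inner integral, the average of \<open>G\<close> with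
  the input at \<open>k\<close> frozen at \<open>u\<close>, is where the influence functions come
  from.\<close>

lemma coordinate_fubini:
  fixes \<phi> :: "real \<Rightarrow> real"
  assumes \<phi>[measurable]: "\<phi> \<in> borel_measurable F" and \<phi>b: "\<And>u. u \<in> space F \<Longrightarrow> \<bar>\<phi> u\<bar> \<le> B"
    and G[measurable]: "G \<in> borel_measurable input_space" and Gb: "\<And>x. x \<in> inputs \<Longrightarrow> \<bar>G x\<bar> \<le> C"
  shows "(\<integral>x. \<phi> (x k) * G x \<partial>P) = (\<integral>u. \<phi> u * (\<integral>x. G (x(k := u)) \<partial>P) \<partial>F)"
proof -
  interpret FP: pair_prob_space P F ..
  have m1: "(\<lambda>x. x k) \<in> measurable P F"
    unfolding P_def by (rule measurable_component_singleton) simp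
  have m: "(\<lambda>x. \<phi> (x k) * G x) \<in> borel_measurable P" using measurable_compose[OF m1 \<phi>] by measurable
  have B: "0 \<le> B" using \<phi>b[of 0] A_nonneg by (simp add: space_F)
  let ?H = "\<lambda>x u. \<phi> u * G (x(k := u))"
  have Hm: "case_prod ?H \<in> borel_measurable (P \<Otimes>\<^sub>M F)" by measurable
  have Hi: "integrable (P \<Otimes>\<^sub>M F) (case_prod ?H)"
  proof (rule FP.P.integrable_const_bound[where B = "B * C"])
    show "AE w in P \<Otimes>\<^sub>M F. norm (case_prod ?H w) \<le> B * C"
      using \<phi>b Gb[OF upd_in_space] B by (intro AE_I2) (auto simp: space_pair_measure abs_mult intro!: mult_mono)
  qed (rule Hm)
  have "(\<integral>x. \<phi> (x k) * G x \<partial>P) = (\<integral>(x, x'). ?H x (x' k) \<partial>(P \<Otimes>\<^sub>M P))"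
    unfolding P_def
    by (subst integral_PiM_mix(1)[OF prob_space_F m[unfolded P_def], of "- {k}"])
       (auto intro!: Bochner_Integration.integral_cong arg_cong[where f = G] simp: fun_eq_iff)
  also have "\<dots> = (\<integral>w. case_prod ?H w \<partial>distr (P \<Otimes>\<^sub>M P) (P \<Otimes>\<^sub>M F) (\<lambda>(x, x'). (x, x' k)))"
    using m1 Hm by (subst integral_distr) (auto simp: split_beta')
  also have "distr (P \<Otimes>\<^sub>M P) (P \<Otimes>\<^sub>M F) (\<lambda>(x, x'). (x, x' k)) = P \<Otimes>\<^sub>M F"
  proof -
    have d: "distr P F (\<lambda>x. x k) = F"
      unfolding P_def by (rule distr_PiM_component[OF prob_space_F]) simp
    have "distr P P (\<lambda>x. x) \<Otimes>\<^sub>M distr P F (\<lambda>x. x k) = distr (P \<Otimes>\<^sub>M P) (P \<Otimes>\<^sub>M F) (\<lambda>(x, y). (x, y k))"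
      by (rule pair_measure_distr) (use m1 d F.sigma_finite_measure_axioms in auto)
    then show ?thesis by (simp add: d distr_id)
  qed
  also have "(\<integral>w. case_prod ?H w \<partial>(P \<Otimes>\<^sub>M F)) = (\<integral>u. (\<integral>x. ?H x u \<partial>P) \<partial>F)"
    using FP.integral_snd[OF Hi] by simp
  finally show ?thesis by simp
qed

section \<open>Localising the effect of one input\<close>

definition zero_window :: "int \<Rightarrow> (int \<Rightarrow> nat) \<Rightarrow> int \<Rightarrow> nat" where
  "zero_window k y = (\<lambda>j. if j \<in> {k..k + int L} then 0 else y j)"

text \<open>The subtracted term does not see the outputs in the window of \<open>k\<close>, which
  are the only ones affected by the input at \<open>k\<close>. Setting them to 0 rather than
  integrating them out keeps the ratio of likelihoods explicit.\<close>

definition wscore :: "int set \<Rightarrow> int \<Rightarrow> (int \<Rightarrow> nat) \<Rightarrow> real" where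
  "wscore J k y = ln (pd J y) - ln (pd J (zero_window k y))"

text \<open>The part of \<open>Psi\<close> that reacts to the input at time \<open>k\<close>. It
  collects at most \<open>L + 1\<close> terms, however large \<open>J\<close> is.\<close>

definition PsiW :: "int set \<Rightarrow> int \<Rightarrow> (int \<Rightarrow> real) \<Rightarrow> real" where
  "PsiW J k x = (\<Sum>j\<in>J \<inter> {k..k + int L}. theta (rate x j)) - (\<integral>y. wscore J k y \<partial>chan x)"

lemma zero_window_measurable [measurable]: "zero_window k \<in> measurable output_space output_space"
  unfolding zero_window_def[abs_def] by (rule measurable_PiM_single') (auto simp: space_PiM)

lemma wscore_measurable [measurable]: "wscore J k \<in> borel_measurable output_space"
  unfolding wscore_def[abs_def] by measurable

lemma zero_window_depends: "outputs_depend (J - {k..k + int L}) (\<lambda>y. ln (pd J (zero_window k y)))"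
proof (rule depends_onI)
  fix y y' :: "int \<Rightarrow> nat" assume "\<forall>i\<in>J - {k..k + int L}. y i = y' i"
  then have "pd J (zero_window k y) = pd J (zero_window k y')"
    by (intro depends_onD[OF pd_depends]) (auto simp: zero_window_def)
  then show "ln (pd J (zero_window k y)) = ln (pd J (zero_window k y'))" by simp
qed

lemma wscore_depends: "outputs_depend J (wscore J k)"
  unfolding wscore_def[abs_def]
  by (rule depends_on_compose2[OF pd_depends[THEN depends_on_compose] depends_on_mono[OF zero_window_depends]]) auto

text \<open>Zeroing the window divides the likelihood by the product of
  \<open>rate x j ^ y j\<close> over the window. This product lies between \<open>exp (- ?s)\<close>
  and \<open>exp ?s\<close> for all inputs, and averaging over \<open>P\<close> preserves such
  bounds. The summand \<open>0\<close> only gives the bound the shape expected by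
  \<open>chan_bound\<close>.\<close>

lemma wscore_bound:
  assumes J: "finite J"
  shows "\<bar>wscore J k y\<bar> \<le> (\<Sum>j\<in>J \<inter> {k..k + int L}. 0 + c * real (y j))" (is "_ \<le> ?s")
proof -
  let ?W = "J \<inter> {k..k + int L}" and ?y0 = "zero_window k y"
  have split: "kap J x y = kap J x ?y0 * (\<Prod>j\<in>?W. rate x j ^ y j)" for x
  proof -
    have "pwt (rate x j) (y j) = pwt (rate x j) (?y0 j) * (if j \<in> {k..k + int L} then rate x j ^ y j else 1)" for j
      by (auto simp: zero_window_def pwt_def)
    then show ?thesis unfolding kap_def using J by (simp add: prod.distrib prod.inter_restrict)
  qed
  have lo: "exp (- ?s) \<le> (\<Prod>j\<in>?W. rate x j ^ y j)" and hi: "(\<Prod>j\<in>?W. rate x j ^ y j) \<le> exp ?s" if x: "x \<in> inputs" for x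
  proof -
    have "exp (- ?s) = (\<Prod>j\<in>?W. exp (- (c * real (y j))))" using J by (simp add: exp_sum[symmetric] sum_negf)
    also have "\<dots> \<le> (\<Prod>j\<in>?W. rate x j ^ y j)"
      using power_bounds(1) rate_bounds[OF x] by (intro prod_mono conjI exp_ge_zero) blast
    finally show "exp (- ?s) \<le> (\<Prod>j\<in>?W. rate x j ^ y j)" .
    have "(\<Prod>j\<in>?W. rate x j ^ y j) \<le> (\<Prod>j\<in>?W. exp (c * real (y j)))"
      using power_bounds(2) rate_bounds[OF x] by (intro prod_mono conjI zero_le_power) (blast intro: less_imp_le)+
    then show "(\<Prod>j\<in>?W. rate x j ^ y j) \<le> exp ?s" using J by (simp add: exp_sum)
  qed
  have 1: "exp (- ?s) * pd J ?y0 \<le> pd J y"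
  proof -
    have "(\<integral>x. exp (- ?s) * kap J x ?y0 \<partial>P) \<le> (\<integral>x. kap J x y \<partial>P)"
    proof (rule integral_mono)
      fix x assume "x \<in> space P" then have x: "x \<in> inputs" by simp
      show "exp (- ?s) * kap J x ?y0 \<le> kap J x y"
        unfolding split[of x] using lo[OF x] kap_nonneg[OF x] by (subst mult.commute) (rule mult_left_mono)
    qed (auto intro: kap_integrable)
    then show ?thesis by (simp add: pd_def)
  qed
  have 2: "pd J y \<le> exp ?s * pd J ?y0"
  proof -
    have "(\<integral>x. kap J x y \<partial>P) \<le> (\<integral>x. exp ?s * kap J x ?y0 \<partial>P)"
    proof (rule integral_mono)
      fix x assume "x \<in> space P" then have x: "x \<in> inputs" by simp
      show "kap J x y \<le> exp ?s * kap J x ?y0"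
        unfolding split[of x] using hi[OF x] kap_nonneg[OF x] by (subst (2) mult.commute) (rule mult_left_mono)
    qed (auto intro: kap_integrable)
    then show ?thesis by (simp add: pd_def)
  qed
  show ?thesis
    unfolding wscore_def by (rule abs_ln_diff_le[OF pd_pos 1 2])
qed

lemma wscore_chan:
  assumes x: "\<And>k. 0 \<le> x k" and J: "finite J"
  shows "integrable (chan x) (wscore J k)"
    and "\<bar>\<integral>y. wscore J k y \<partial>chan x\<bar> \<le> (\<Sum>j\<in>J \<inter> {k..k + int L}. c * rate x j)"
  using chan_bound[where x = x and f = "wscore J k" and J = "J \<inter> {k..k + int L}" and b = 0 and c = c, OF x wscore_measurable wscore_bound[OF J]] by auto

lemma card_window: "real (card (J \<inter> {k..k + int L})) \<le> real L + 1"
proof -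
  have "card (J \<inter> {k..k + int L}) \<le> card {k..k + int L}" by (rule card_mono) auto
  then show ?thesis by simp
qed

lemma PsiW_measurable:
  assumes "finite J" shows "PsiW J k \<in> borel_measurable input_space"
proof -
  have [measurable]: "(\<lambda>x. \<integral>y. wscore J k y \<partial>chan x) \<in> borel_measurable input_space"
    by (rule integral_chan_measurable[OF assms wscore_measurable wscore_depends])
  show ?thesis unfolding PsiW_def[abs_def] by measurable
qed

text \<open>A window has at most \<open>L + 1\<close> times; each contributes at most
  \<open>1 + c * M\<close> through \<open>theta\<close> and \<open>c * M\<close> through the
  score.\<close>

definition CW :: real where "CW = (real L + 1) * (1 + 2 * c * M)"

lemma PsiW_bound:
  assumes J: "finite J" and x: "x \<in> inputs" shows "\<bar>PsiW J k x\<bar> \<le> CW"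
proof -
  let ?W = "J \<inter> {k..k + int L}"
  have nn: "\<And>k. 0 \<le> x k" using x by (auto simp: space_input)
  have "\<bar>\<Sum>j\<in>?W. theta (rate x j)\<bar> \<le> (\<Sum>j\<in>?W. 1 + c * M)"
    using theta_bound rate_bounds[OF x] by (intro order_trans[OF sum_abs] sum_mono) auto
  moreover have "(\<Sum>j\<in>?W. c * rate x j) \<le> (\<Sum>j\<in>?W. c * M)"
    using rate_bounds[OF x] c_nonneg by (intro sum_mono mult_left_mono) auto
  ultimately have "\<bar>PsiW J k x\<bar> \<le> (\<Sum>j\<in>?W. 1 + c * M) + (\<Sum>j\<in>?W. c * M)"
    using wscore_chan(2)[of x J k, OF nn J] unfolding PsiW_def by linarith
  also have "\<dots> = real (card ?W) * (1 + 2 * c * M)" by (simp add: algebra_simps)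
  also have "\<dots> \<le> CW"
    unfolding CW_def using card_window[of J k] c_nonneg M_pos by (intro mult_right_mono) auto
  finally show ?thesis .
qed

text \<open>What remains of \<open>Psi\<close> consists of the terms \<open>theta\<close> outside
  the window and the expectation of \<open>ln (pd J)\<close> at the zeroed output. Both depend only
  on rates outside \<open>{k..k + L}\<close>, which do not see the input at
  \<open>k\<close>.\<close>

lemma Psi_diff_invariant:
  assumes J: "finite J" and x: "x \<in> inputs" and u: "u \<in> space F"
  shows "Psi J (x(k := u)) - PsiW J k (x(k := u)) = Psi J x - PsiW J k x"
proof -
  let ?W = "{k..k + int L}"
  have eq: "Psi J v - PsiW J k v = (\<Sum>j\<in>J - ?W. theta (rate v j)) - (\<integral>y. ln (pd J (zero_window k y)) \<partial>chan v)"
    if v: "v \<in> inputs" for v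
  proof -
    have nn: "\<And>k. 0 \<le> v k" using v by (auto simp: space_input)
    have i1: "integrable (chan v) (\<lambda>y. ln (pd J y))"
      by (rule chan_bound(1)[of v, OF nn _ ln_pd_bound]) simp
    have i2: "integrable (chan v) (wscore J k)" by (rule wscore_chan(1)[of v, OF nn J])
    have "(\<integral>y. ln (pd J (zero_window k y)) \<partial>chan v) = (\<integral>y. ln (pd J y) - wscore J k y \<partial>chan v)"
      by (simp add: wscore_def)
    also have "\<dots> = Ups J v - (\<integral>y. wscore J k y \<partial>chan v)"
      unfolding Ups_def by (rule Bochner_Integration.integral_diff[OF i1 i2])
    finally show ?thesis
      unfolding Psi_def PsiW_def using sum.Int_Diff[OF J, of "\<lambda>j. theta (rate v j)" ?W] by simp
  qed
  have "(\<integral>y. ln (pd J (zero_window k y)) \<partial>chan (x(k := u))) = (\<integral>y. ln (pd J (zero_window k y)) \<partial>chan x)"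
    using J by (intro chan_cong[OF _ _ zero_window_depends] rate_upd_same) auto
  moreover have "(\<Sum>j\<in>J - ?W. theta (rate (x(k := u)) j)) = (\<Sum>j\<in>J - ?W. theta (rate x j))"
    by (intro sum.cong refl) (simp add: rate_upd_same)
  ultimately show ?thesis using eq[OF x] eq[OF upd_in_space[OF x u]] by simp
qed

lemma Psi_measurable: "finite J \<Longrightarrow> Psi J \<in> borel_measurable input_space"
  using Ups_measurable[of J] unfolding Psi_def[abs_def] by measurable

lemma Psi_bound:
  assumes "finite J" "x \<in> inputs" shows "\<bar>Psi J x\<bar> \<le> real (card J) * (1 + b + 2 * c * M)"
proof -
  have "\<bar>\<Sum>j\<in>J. theta (rate x j)\<bar> \<le> (\<Sum>j\<in>J. 1 + c * M)"
    using theta_bound rate_bounds[OF assms(2)] by (intro order_trans[OF sum_abs] sum_mono) auto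
  then show ?thesis using Ups_bound[OF assms(2), of J] unfolding Psi_def by (simp add: algebra_simps)
qed

end

section \<open>The tilted input law and its likelihood ratio\<close>

locale perturbed_input = poisson_input +
  fixes g :: "real \<Rightarrow> real" and B t :: real
  assumes g_meas [measurable]: "g \<in> borel_measurable (restrict_space borel {0..A})"
    and g_bound: "\<And>u. 0 \<le> u \<Longrightarrow> u \<le> A \<Longrightarrow> \<bar>g u\<bar> \<le> B"
    and g_int: "(\<integral>u. g u \<partial>F) = 0" and t_small: "\<bar>t\<bar> * B < 1"
begin

lemma B_nonneg: "0 \<le> B"
  using g_bound[of 0] A_nonneg by simp

lemma g_meas_F [measurable]: "g \<in> borel_measurable F"
  using g_meas measurable_cong_sets[OF sets_F refl] by blast

lemma g_bound_F: "u \<in> space F \<Longrightarrow> \<bar>g u\<bar> \<le> B"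
  by (simp add: space_F g_bound)

lemma tg: "0 \<le> u \<Longrightarrow> u \<le> A \<Longrightarrow> 0 < 1 + t * g u \<and> 1 + t * g u \<le> 2"
proof -
  assume "0 \<le> u" "u \<le> A"
  then have "\<bar>t * g u\<bar> \<le> \<bar>t\<bar> * B" using g_bound by (simp add: abs_mult mult_left_mono)
  then show ?thesis using t_small by linarith
qed

lemma g_integrable [simp]: "integrable F g"
  using g_bound_F by (intro F.integrable_const_bound[where B = B]) auto

definition Ft :: "real measure" where "Ft = density F (\<lambda>u. ennreal (1 + t * g u))"

lemma Ft_nn: "(\<integral>\<^sup>+u. ennreal (1 + t * g u) \<partial>F) = 1"
proof -
  have "(\<integral>\<^sup>+u. ennreal (1 + t * g u) \<partial>F) = ennreal (\<integral>u. 1 + t * g u \<partial>F)"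
    using tg by (intro nn_integral_eq_integral) (auto simp: space_F less_imp_le)
  also have "(\<integral>u. 1 + t * g u \<partial>F) = 1" using F.prob_space by (simp add: g_int)
  finally show ?thesis by simp
qed

lemma Ft_space: "Ft \<in> space (prob_algebra (restrict_space borel {0..A}))"
proof -
  have "emeasure Ft (space Ft) = (\<integral>\<^sup>+u. ennreal (1 + t * g u) * indicator (space F) u \<partial>F)"
    unfolding Ft_def by (subst emeasure_density) auto
  also have "\<dots> = (\<integral>\<^sup>+u. ennreal (1 + t * g u) \<partial>F)" by (rule nn_integral_cong) simp
  finally have "prob_space Ft" using Ft_nn by (intro prob_spaceI) simp
  then show ?thesis by (simp add: space_prob_algebra Ft_def sets_F)
qed

lemma Ft_mean: "(\<integral>u. u \<partial>Ft) = (\<integral>u. u \<partial>F) + t * (\<integral>u. u * g u \<partial>F)"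
proof -
  have "(\<lambda>u::real. u) \<in> borel_measurable (restrict_space borel {0..A})"
    by (rule measurable_restrict_space1) simp
  then have id[measurable]: "(\<lambda>u. u) \<in> borel_measurable F"
    using measurable_cong_sets[OF sets_F refl] by blast
  have i: "integrable F (\<lambda>u. u)" by (rule F.integrable_const_bound[where B = A]) (auto simp: space_F)
  have i2: "integrable F (\<lambda>u. u * g u)"
    by (rule F.integrable_const_bound[where B = "A * B"])
       (auto simp: space_F abs_mult intro!: mult_mono g_bound A_nonneg B_nonneg)
  have "(\<integral>u. u \<partial>Ft) = (\<integral>u. (1 + t * g u) * u \<partial>F)"
    unfolding Ft_def using tg by (subst integral_density) (auto simp: space_F less_imp_le)
  also have "\<dots> = (\<integral>u. u + t * (u * g u) \<partial>F)" by (simp add: algebra_simps)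
  also have "\<dots> = (\<integral>u. u \<partial>F) + t * (\<integral>u. u * g u \<partial>F)" using i i2 by simp
  finally show ?thesis .
qed

sublocale T: poisson_input L lam0 A h Ft
  by standard (rule Ft_space)

text \<open>Likelihood ratio of the tilted to the original inputs on the coordinates
  \<open>K\<close>.\<close>

definition w :: "int set \<Rightarrow> (int \<Rightarrow> real) \<Rightarrow> real" where
  "w K x = (\<Prod>k\<in>K. 1 + t * g (x k))"

lemma g_coord [measurable]: "(\<lambda>x. g (x k)) \<in> borel_measurable input_space"
  by (rule measurable_compose[OF measurable_component_singleton[of k UNIV "\<lambda>_. restrict_space borel {0..A}"] g_meas]) simp

lemma w_measurable [measurable]: "w K \<in> borel_measurable input_space"
  unfolding w_def[abs_def] by measurable

lemma w_pos: "x \<in> inputs \<Longrightarrow> 0 < w K x"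
  unfolding w_def using tg by (intro prod_pos) (auto simp: space_input)

lemma w_le: "x \<in> inputs \<Longrightarrow> w K x \<le> 2 ^ card K"
  unfolding w_def using tg prod_mono[of K "\<lambda>k. 1 + t * g (x k)" "\<lambda>_. 2"] by (auto simp: space_input less_imp_le)

lemma w_abs: "x \<in> inputs \<Longrightarrow> \<bar>w K x\<bar> \<le> 2 ^ card K"
  using w_pos[of x K] w_le[of x K] by simp

lemma w_upd: "k \<notin> K \<Longrightarrow> w K (x(k := u)) = w K x"
  unfolding w_def by (intro prod.cong) auto

text \<open>\<open>T.P\<close> is first exchanged for the product in which only the coordinates in
  \<open>K\<close> are tilted, which \<open>f\<close> cannot distinguish from \<open>T.P\<close>;
  that product has density \<open>w K\<close> with respect to \<open>P\<close>.\<close>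

lemma T_integral:
  fixes f :: "(int \<Rightarrow> real) \<Rightarrow> real"
  assumes K: "finite K" and f: "f \<in> borel_measurable input_space" and dep: "depends_on K (inputs) f"
  shows "(\<integral>x. f x \<partial>T.P) = (\<integral>x. w K x * f x \<partial>P)"
proof -
  let ?N = "\<lambda>k. if k \<in> K then density F (\<lambda>u. ennreal (1 + t * g u)) else F"
  have eq: "density P (\<lambda>x. \<Prod>k\<in>K. ennreal (1 + t * g (x k))) = PiM UNIV ?N"
    unfolding P_def by (rule density_PiM) (auto simp: prob_space_F K Ft_nn)
  have N: "prob_space (?N k)" for k
    using T.prob_space_F prob_space_F unfolding Ft_def by simp
  have sN: "sets (PiM UNIV ?N) = sets input_space"
    unfolding eq[symmetric] by simp
  have spN: "space (PiM UNIV ?N) = inputs"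
    using sets_eq_imp_space_eq[OF sN] .
  have fN: "f \<in> borel_measurable (PiM UNIV ?N)"
    using f measurable_cong_sets[OF sN refl] by blast
  have "(\<integral>x. f x \<partial>T.P) = (\<integral>x. f x \<partial>PiM UNIV ?N)"
    unfolding T.P_def
    by (rule integral_PiM_depends_on[OF N T.prob_space_F K _ _ fN]) (use dep in \<open>auto simp: spN Ft_def\<close>)
  also have "\<dots> = (\<integral>x. f x \<partial>density P (\<lambda>x. ennreal (w K x)))"
    unfolding eq[symmetric]
  proof (intro arg_cong2[where f = "lebesgue_integral"] refl density_cong AE_I2)
    fix x assume "x \<in> space P"
    then show "(\<Prod>k\<in>K. ennreal (1 + t * g (x k))) = ennreal (w K x)"
      unfolding w_def using tg by (intro prod_ennreal) (auto simp: space_input less_imp_le)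
  qed measurable
  also have "\<dots> = (\<integral>x. w K x * f x \<partial>P)"
    using f w_pos by (subst integral_density) (auto simp: less_imp_le)
  finally show ?thesis .
qed

definition \<gamma> :: real where "\<gamma> = (\<integral>u. (g u)\<^sup>2 \<partial>F)"

lemma g2_integrable [simp]: "integrable F (\<lambda>u. (g u)\<^sup>2)"
  using g_bound_F B_nonneg by (intro F.integrable_const_bound[where B = "B\<^sup>2"] AE_I2) (auto simp: power2_eq_square[symmetric] abs_le_square_iff[symmetric])

lemma \<gamma>_bounds: "0 \<le> \<gamma>" "\<gamma> \<le> B\<^sup>2"
proof -
  show "0 \<le> \<gamma>" by (simp add: \<gamma>_def)
  show "\<gamma> \<le> B\<^sup>2"
    unfolding \<gamma>_def using g_bound_F B_nonneg by (intro F.integral_le_const AE_I2) (auto simp: abs_le_square_iff[symmetric])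
qed

lemma w_integrable: "integrable P (w K)" and w2_integrable: "integrable P (\<lambda>x. (w K x)\<^sup>2)"
proof -
  show "integrable P (w K)" by (rule P_bounded(1)[OF w_measurable w_abs])
  show "integrable P (\<lambda>x. (w K x)\<^sup>2)"
  proof (rule P_bounded(1))
    fix x assume "x \<in> inputs"
    from w_abs[OF this, of K] show "\<bar>(w K x)\<^sup>2\<bar> \<le> (2 ^ card K)\<^sup>2"
      by (simp add: abs_le_square_iff[symmetric])
  qed measurable
qed

lemma w_moments:
  assumes "finite K" shows "(\<integral>x. w K x \<partial>P) = 1" "(\<integral>x. (w K x)\<^sup>2 \<partial>P) = (1 + t\<^sup>2 * \<gamma>) ^ card K"
  using assms
proof (induction K)
  case empty
  case 1 show ?case by (simp add: w_def)
  case 2 show ?case by (simp add: w_def)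
next
  case (insert k K)
  case 1
  have "(\<integral>x. w (insert k K) x \<partial>P) = (\<integral>x. (1 + t * g (x k)) * w K x \<partial>P)"
    using insert by (simp add: w_def)
  also have "\<dots> = (\<integral>u. 1 + t * g u \<partial>F) * (\<integral>x. w K x \<partial>P)"
    using insert by (intro coordinate_indep w_integrable w_upd) auto
  also have "\<dots> = 1" using insert F.prob_space by (simp add: g_int)
  finally show ?case .
  case 2
  have "(\<integral>x. (w (insert k K) x)\<^sup>2 \<partial>P) = (\<integral>x. (1 + t * g (x k))\<^sup>2 * (w K x)\<^sup>2 \<partial>P)"
    using insert by (simp add: w_def power_mult_distrib)
  also have "\<dots> = (\<integral>u. (1 + t * g u)\<^sup>2 \<partial>F) * (\<integral>x. (w K x)\<^sup>2 \<partial>P)"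
    using insert by (intro coordinate_indep w2_integrable) (auto simp: w_upd power2_sum power_mult_distrib)
  also have "(\<integral>u. (1 + t * g u)\<^sup>2 \<partial>F) = 1 + t\<^sup>2 * \<gamma>"
    using F.prob_space by (simp add: power2_sum power_mult_distrib g_int \<gamma>_def)
  finally show ?case using insert by simp
qed

text \<open>Variance of \<open>w K\<close> for a set of \<open>m\<close> coordinates, equivalently
  the chi-square divergence of the tilted inputs. For \<open>m = n + L\<close> and
  \<open>t = \<kappa> / n\<close> it is of order \<open>1 / n\<close>.\<close>

definition \<delta> :: "nat \<Rightarrow> real" where "\<delta> m = (1 + t\<^sup>2 * \<gamma>) ^ m - 1"

lemma \<delta>_mono: "m \<le> m' \<Longrightarrow> \<delta> m \<le> \<delta> m'"
  unfolding \<delta>_def using \<gamma>_bounds by (auto intro!: power_increasing)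

text \<open>The first absolute moment is at most the root of the second, here as nonnegativity of
  the variance of \<open>\<bar>w K x - 1\<bar>\<close>.\<close>

lemma w_L1:
  assumes K: "finite K" shows "(\<integral>x. \<bar>w K x - 1\<bar> \<partial>P) \<le> sqrt (\<delta> (card K))"
proof -
  have i: "integrable P (\<lambda>x. w K x - 1)" using w_integrable by simp
  have e2: "(\<bar>w K x - 1\<bar>)\<^sup>2 = (w K x)\<^sup>2 - 2 * w K x + 1" for x by (simp add: power2_diff)
  have i2: "integrable P (\<lambda>x. (\<bar>w K x - 1\<bar>)\<^sup>2)"
    unfolding e2 using w_integrable w2_integrable by simp
  have "(\<integral>x. (\<bar>w K x - 1\<bar>)\<^sup>2 \<partial>P) = \<delta> (card K)"
    unfolding e2 \<delta>_def using w_integrable w2_integrable w_moments[OF K] by simp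
  moreover have "0 \<le> (\<integral>x. (\<bar>w K x - 1\<bar>)\<^sup>2 \<partial>P) - (\<integral>x. \<bar>w K x - 1\<bar> \<partial>P)\<^sup>2"
    by (subst P.variance_eq[symmetric]) (use i i2 in \<open>auto intro!: integral_nonneg_AE\<close>)
  ultimately have "(\<integral>x. \<bar>w K x - 1\<bar> \<partial>P)\<^sup>2 \<le> \<delta> (card K)" by simp
  then show ?thesis by (rule real_le_rsqrt)
qed

text \<open>The factors of \<open>w\<close> are added one at a time. For the new factor at
  \<open>k\<close>, the part \<open>\<Psi> - \<Phi> k\<close> does not depend on the input at
  \<open>k\<close>, so it is killed by the mean zero of \<open>g\<close>; the part
  \<open>\<Phi> k\<close> yields the main term plus an error with the factor
  \<open>w K x - 1\<close>, small in mean by \<open>w_L1\<close>. The error involves only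
  \<open>C\<close>, which is uniform in the block length in the application, although the bound
  \<open>D\<close> on \<open>\<Psi>\<close> grows with it.\<close>

lemma telescope:
  fixes \<Psi> :: "(int \<Rightarrow> real) \<Rightarrow> real" and \<Phi> :: "int \<Rightarrow> (int \<Rightarrow> real) \<Rightarrow> real"
  assumes K: "finite K"
    and \<Psi>[measurable]: "\<Psi> \<in> borel_measurable input_space" and \<Psi>b: "\<And>x. x \<in> inputs \<Longrightarrow> \<bar>\<Psi> x\<bar> \<le> D"
    and \<Phi>[measurable]: "\<And>k. \<Phi> k \<in> borel_measurable input_space"
    and \<Phi>b: "\<And>k x. x \<in> inputs \<Longrightarrow> \<bar>\<Phi> k x\<bar> \<le> C"
    and inv: "\<And>k x u. x \<in> inputs \<Longrightarrow> u \<in> space F \<Longrightarrow> \<Psi> (x(k := u)) - \<Phi> k (x(k := u)) = \<Psi> x - \<Phi> k x"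
  shows "\<bar>(\<integral>x. (w K x - 1) * \<Psi> x \<partial>P) - t * (\<Sum>k\<in>K. \<integral>x. g (x k) * \<Phi> k x \<partial>P)\<bar> \<le> real (card K) * (\<bar>t\<bar> * B * C * sqrt (\<delta> (card K)))"
  using K
proof (induction K)
  case empty
  then show ?case by (simp add: w_def)
next
  case (insert k K)
  have x0: "(\<lambda>_. 0) \<in> inputs" by (simp add: space_input A_nonneg)
  have C: "0 \<le> C" using \<Phi>b[OF x0] abs_ge_zero order_trans by blast
  have gk: "\<bar>g (x k)\<bar> \<le> B" if "x \<in> inputs" for x using that g_bound by (auto simp: space_input)
  have wb1: "\<bar>w K x - 1\<bar> \<le> 2 ^ card K + 1" if "x \<in> inputs" for x
    using w_abs[OF that, of K] by linarith
  have i1: "integrable P (\<lambda>x. (w K x - 1) * \<Psi> x)"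
    by (rule P_bounded(1)[where B = "(2 ^ card K + 1) * D"]) (measurable, simp add: abs_mult, intro mult_mono wb1 \<Psi>b, auto)
  have i2: "integrable P (\<lambda>x. g (x k) * (w K x * (\<Psi> x - \<Phi> k x)))"
  proof (rule P_bounded(1)[where B = "B * (2 ^ card K * (D + C))"])
    fix x assume x: "x \<in> inputs"
    have "\<bar>\<Psi> x - \<Phi> k x\<bar> \<le> D + C" using \<Psi>b[OF x] \<Phi>b[OF x, of k] by linarith
    then show "\<bar>g (x k) * (w K x * (\<Psi> x - \<Phi> k x))\<bar> \<le> B * (2 ^ card K * (D + C))"
      unfolding abs_mult using gk[OF x] w_abs[OF x, of K] B_nonneg by (intro mult_mono) auto
  qed measurable
  have i3: "integrable P (\<lambda>x. g (x k) * \<Phi> k x)"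
    by (rule P_bounded(1)[where B = "B * C"]) (measurable, simp add: abs_mult, intro mult_mono gk \<Phi>b B_nonneg, auto)
  have b4: "\<bar>g (x k) * ((w K x - 1) * \<Phi> k x)\<bar> \<le> B * C * \<bar>w K x - 1\<bar>" if x: "x \<in> inputs" for x
  proof -
    have "\<bar>g (x k)\<bar> * \<bar>\<Phi> k x\<bar> * \<bar>w K x - 1\<bar> \<le> B * C * \<bar>w K x - 1\<bar>"
      using gk[OF x] \<Phi>b[OF x, of k] B_nonneg by (intro mult_right_mono mult_mono) auto
    then show ?thesis by (simp add: abs_mult mult_ac)
  qed
  have iw: "integrable P (\<lambda>x. \<bar>w K x - 1\<bar>)" using w_integrable by simp
  have i4: "integrable P (\<lambda>x. g (x k) * ((w K x - 1) * \<Phi> k x))"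
  proof (rule P_bounded(1)[where B = "B * C * (2 ^ card K + 1)"])
    fix x assume x: "x \<in> inputs"
    show "\<bar>g (x k) * ((w K x - 1) * \<Phi> k x)\<bar> \<le> B * C * (2 ^ card K + 1)"
      by (rule order_trans[OF b4[OF x]]) (intro mult_left_mono wb1 x mult_nonneg_nonneg B_nonneg C)
  qed measurable
  have z: "(\<integral>x. g (x k) * (w K x * (\<Psi> x - \<Phi> k x)) \<partial>P) = 0"
  proof -
    have "integrable P (\<lambda>x. w K x * (\<Psi> x - \<Phi> k x))"
    proof (rule P_bounded(1)[where B = "2 ^ card K * (D + C)"])
      fix x assume x: "x \<in> inputs"
      have "\<bar>\<Psi> x - \<Phi> k x\<bar> \<le> D + C" using \<Psi>b[OF x] \<Phi>b[OF x, of k] by linarith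
      then show "\<bar>w K x * (\<Psi> x - \<Phi> k x)\<bar> \<le> 2 ^ card K * (D + C)"
        unfolding abs_mult using w_abs[OF x, of K] by (intro mult_mono) auto
    qed measurable
    then show ?thesis
      using insert inv by (subst coordinate_indep) (auto simp: w_upd g_int)
  qed
  have dec: "(w (insert k K) x - 1) * \<Psi> x = (w K x - 1) * \<Psi> x + t * (g (x k) * (w K x * (\<Psi> x - \<Phi> k x)))
      + t * (g (x k) * \<Phi> k x) + t * (g (x k) * ((w K x - 1) * \<Phi> k x))" for x
    using insert by (simp add: w_def algebra_simps)
  have e: "(\<integral>x. (w (insert k K) x - 1) * \<Psi> x \<partial>P) = (\<integral>x. (w K x - 1) * \<Psi> x \<partial>P)
      + t * (\<integral>x. g (x k) * \<Phi> k x \<partial>P) + t * (\<integral>x. g (x k) * ((w K x - 1) * \<Phi> k x) \<partial>P)"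
    unfolding dec using i1 i2 i3 i4 z by simp
  have r: "\<bar>\<integral>x. g (x k) * ((w K x - 1) * \<Phi> k x) \<partial>P\<bar> \<le> B * C * sqrt (\<delta> (card K))"
  proof -
    have "\<bar>\<integral>x. g (x k) * ((w K x - 1) * \<Phi> k x) \<partial>P\<bar> \<le> (\<integral>x. \<bar>g (x k) * ((w K x - 1) * \<Phi> k x)\<bar> \<partial>P)"
      by (rule integral_abs_bound)
    also have "\<dots> \<le> (\<integral>x. B * C * \<bar>w K x - 1\<bar> \<partial>P)"
      using i4 iw b4 by (intro integral_mono) auto
    also have "\<dots> \<le> B * C * sqrt (\<delta> (card K))"
      using w_L1[of K] insert B_nonneg C by (simp add: mult_left_mono)
    finally show ?thesis .
  qed
  let ?E = "\<bar>t\<bar> * B * C"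
  have E: "0 \<le> ?E" using B_nonneg C by simp
  have mono: "sqrt (\<delta> (card K)) \<le> sqrt (\<delta> (card (insert k K)))"
    using insert by (intro real_sqrt_le_mono \<delta>_mono card_mono) auto
  have r': "\<bar>t * (\<integral>x. g (x k) * ((w K x - 1) * \<Phi> k x) \<partial>P)\<bar> \<le> ?E * sqrt (\<delta> (card (insert k K)))"
  proof -
    have "\<bar>t\<bar> * \<bar>\<integral>x. g (x k) * ((w K x - 1) * \<Phi> k x) \<partial>P\<bar> \<le> \<bar>t\<bar> * (B * C * sqrt (\<delta> (card K)))"
      using r by (rule mult_left_mono) simp
    also have "\<dots> \<le> ?E * sqrt (\<delta> (card (insert k K)))"
      using mult_left_mono[OF mono E] by (simp add: mult_ac)
    finally show ?thesis by (simp add: abs_mult)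
  qed
  have IH: "\<bar>(\<integral>x. (w K x - 1) * \<Psi> x \<partial>P) - t * (\<Sum>k\<in>K. \<integral>x. g (x k) * \<Phi> k x \<partial>P)\<bar> \<le> real (card K) * (?E * sqrt (\<delta> (card (insert k K))))"
    by (rule order_trans[OF insert.IH]) (intro mult_left_mono mono E, simp)
  have "\<bar>(\<integral>x. (w (insert k K) x - 1) * \<Psi> x \<partial>P) - t * (\<Sum>k\<in>insert k K. \<integral>x. g (x k) * \<Phi> k x \<partial>P)\<bar>
    = \<bar>((\<integral>x. (w K x - 1) * \<Psi> x \<partial>P) - t * (\<Sum>k\<in>K. \<integral>x. g (x k) * \<Phi> k x \<partial>P))
        + t * (\<integral>x. g (x k) * ((w K x - 1) * \<Phi> k x) \<partial>P)\<bar>"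
    unfolding e using insert by (simp add: algebra_simps)
  also have "\<dots> \<le> real (card K) * (?E * sqrt (\<delta> (card (insert k K)))) + ?E * sqrt (\<delta> (card (insert k K)))"
    using IH r' by linarith
  also have "\<dots> = real (card (insert k K)) * (?E * sqrt (\<delta> (card (insert k K))))"
    using insert by (simp add: algebra_simps)
  finally show ?case .
qed

end

section \<open>Lower bound for the gain in information\<close>

context perturbed_input
begin

lemma w2_abs: "x \<in> inputs \<Longrightarrow> \<bar>(w K x)\<^sup>2\<bar> \<le> (2 ^ card K)\<^sup>2"
  using w_abs[of x K] by (simp add: abs_le_square_iff[symmetric])

lemma T_pd:
  assumes "\<And>j i. j \<in> J \<Longrightarrow> j - int L \<le> i \<Longrightarrow> i \<le> j \<Longrightarrow> i \<in> K" "finite K"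
  shows "T.pd J y = (\<integral>x. w K x * kap J x y \<partial>P)"
  unfolding T.pd_def by (rule T_integral[OF assms(2)]) (auto intro!: kap_input_depends assms(1))

text \<open>The second moment of \<open>w\<close> bounds the relative entropy of the perturbed output law through the
  chi-square divergence, so no smoothness of the entropy in \<open>t\<close> is needed.\<close>

lemma T_entropy_pointwise:
  assumes K: "\<And>j i. j \<in> J \<Longrightarrow> j - int L \<le> i \<Longrightarrow> i \<le> j \<Longrightarrow> i \<in> K" "finite K"
  shows "T.pd J y * ln (T.pd J y) \<le> T.pd J y * ln (pd J y) + (\<integral>x. (w K x)\<^sup>2 * kap J x y \<partial>P) - T.pd J y"
proof -
  let ?p = "pd J y" and ?q = "T.pd J y"
  have p: "?p > 0" and q: "?q > 0" by (rule pd_pos, rule T.pd_pos)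
  have Tp: "T.pd J y = (\<integral>x. w K x * kap J x y \<partial>P)"
    by (rule T_pd) (use K in auto)
  \<comment> \<open>The conditional mean of \<open>w\<close> given the output \<open>y\<close>. It
    minimises the quadratic form below, whose nonnegativity is then the Cauchy-Schwarz inequality
    \<open>?q * (?q / ?p) <= E\<close>, with \<open>E\<close> the integral of
    \<open>(w K x)\<^sup>2 * kap J x y\<close>.\<close>
  define s where "s = ?q / ?p"
  let ?E = "exp (\<Sum>j\<in>J. b + c * real (y j))"
  have kb: "\<bar>kap J x y\<bar> \<le> ?E" if "x \<in> inputs" for x
    using kap_bounds(2)[OF that, of J y] kap_nonneg[OF that, of J y] by simp
  have i1: "integrable P (\<lambda>x. w K x * kap J x y)"
    by (rule P_bounded(1)[where B = "2 ^ card K * ?E"]) (measurable, unfold abs_mult, intro mult_mono w_abs kb, auto)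
  have i2: "integrable P (\<lambda>x. (w K x)\<^sup>2 * kap J x y)"
    by (rule P_bounded(1)[where B = "(2 ^ card K)\<^sup>2 * ?E"]) (measurable, unfold abs_mult, intro mult_mono w2_abs kb, auto)
  have "0 \<le> (\<integral>x. (w K x - s)\<^sup>2 * kap J x y \<partial>P)"
    using kap_nonneg by (intro integral_nonneg_AE) auto
  also have "\<dots> = (\<integral>x. (w K x)\<^sup>2 * kap J x y - (2 * s) * (w K x * kap J x y) + s\<^sup>2 * kap J x y \<partial>P)"
    by (simp add: power2_diff algebra_simps)
  also have "\<dots> = (\<integral>x. (w K x)\<^sup>2 * kap J x y \<partial>P) - 2 * s * ?q + s\<^sup>2 * ?p"
    using i1 i2 kap_integrable[of J y] Tp by (simp add: pd_def)
  also have "\<dots> = (\<integral>x. (w K x)\<^sup>2 * kap J x y \<partial>P) - ?q * (?q / ?p)"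
    using p by (simp add: s_def power2_eq_square field_simps)
  finally have cs: "?q * (?q / ?p) \<le> (\<integral>x. (w K x)\<^sup>2 * kap J x y \<partial>P)" by simp
  have "ln (?q / ?p) \<le> ?q / ?p - 1" using p q by (intro ln_le_minus_one) auto
  then have "?q * (ln ?q - ln ?p) \<le> ?q * (?q / ?p - 1)"
    using p q by (intro mult_left_mono) (auto simp: ln_div)
  then show ?thesis using cs by (simp add: algebra_simps)
qed

text \<open>The term \<open>n * V\<close> is linear in the input law of the block and is carried
  over exactly by \<open>w\<close>; the relative entropy of the outputs is bounded above by
  \<open>T_entropy_pointwise\<close>, at the price of the chi-square term. The set \<open>K\<close>
  starts at \<open>1 - L\<close> because the outputs at times \<open>1..n\<close> see inputs back to
  that time.\<close>

lemma T_a_lower: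
  assumes n: "n \<ge> 1"
  defines "K \<equiv> {1 - int L..int n}" and "J \<equiv> {1..int n}"
  shows "(\<integral>x. w K x * Psi J x \<partial>P) - \<delta> (card K) \<le> T.a n"
proof -
  have K: "\<And>j i. j \<in> J \<Longrightarrow> j - int L \<le> i \<Longrightarrow> i \<le> j \<Longrightarrow> i \<in> K" "finite K" and J: "finite J"
    by (auto simp: K_def J_def)
  have Tp: "(\<integral>x. w K x * kap J x y \<partial>P) = T.pd J y" for y
    by (rule T_pd[symmetric]) (use K in auto)
  have Te: "T.pd J y * ln (T.pd J y) \<le> T.pd J y * ln (pd J y) + (\<integral>x. (w K x)\<^sup>2 * kap J x y \<partial>P) - T.pd J y" for y
    by (rule T_entropy_pointwise) (use K in auto)
  \<comment> \<open>A nonempty block lets the constant 1 be dominated by a sum over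
    \<open>J\<close>, as \<open>fubini_pd\<close> requires.\<close>
  have cJ: "card J \<ge> 1" using n by (simp add: J_def)
  have wi: "integrable P (\<lambda>x. w K x * \<phi> x)"
    if "\<phi> \<in> borel_measurable input_space" "\<And>x. x \<in> inputs \<Longrightarrow> \<bar>\<phi> x\<bar> \<le> D" for \<phi> :: "(int \<Rightarrow> real) \<Rightarrow> real" and D
  proof (rule P_bounded(1)[where B = "2 ^ card K * D"])
    fix x assume x: "x \<in> inputs"
    show "\<bar>w K x * \<phi> x\<bar> \<le> 2 ^ card K * D"
      unfolding abs_mult using w_abs[OF x] that(2)[OF x] by (intro mult_mono) auto
  qed (use that(1) in measurable)
  have theta_dep: "depends_on K (inputs) (\<lambda>x. theta (rate x j))" if "j \<in> J" for j
    using K(1)[OF that] unfolding depends_on_def by (auto intro!: arg_cong[where f = theta] rate_cong)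
  have tm: "(\<lambda>x. theta (rate x j)) \<in> borel_measurable input_space" for j by measurable
  have thb: "\<bar>theta (rate x j)\<bar> \<le> 1 + c * M" if "x \<in> inputs" for x j
    using theta_bound rate_bounds[OF that] by blast
  have V: "real n * T.V = (\<integral>x. w K x * (\<Sum>j\<in>J. theta (rate x j)) \<partial>P)"
  proof -
    have "real n * T.V = (\<Sum>j\<in>J. T.V)" by (simp add: J_def)
    also have "\<dots> = (\<Sum>j\<in>J. \<integral>x. w K x * theta (rate x j) \<partial>P)"
    proof (rule sum.cong)
      fix j assume "j \<in> J"
      then show "T.V = (\<integral>x. w K x * theta (rate x j) \<partial>P)"
        using T_integral[OF K(2) tm theta_dep] T.theta_rate_integral(2) by simp
    qed simp
    also have "\<dots> = (\<integral>x. (\<Sum>j\<in>J. w K x * theta (rate x j)) \<partial>P)"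
      using wi[OF tm thb] by (intro Bochner_Integration.integral_sum[symmetric]) auto
    finally show ?thesis by (simp add: sum_distrib_left)
  qed
  have lm: "(\<lambda>y. ln (pd J y)) \<in> borel_measurable output_space" "(\<lambda>y. ln (T.pd J y)) \<in> borel_measurable output_space"
    by measurable
  have W: "(0::real) \<le> 2 ^ card K" by simp
  note f1 = fubini_pd[OF J lm(1) ln_pd_depends ln_pd_bound c_nonneg w_measurable w_abs W]
  note f1' = f1[unfolded Tp]
  have one: "\<bar>1::real\<bar> \<le> (\<Sum>j\<in>J. 1 + 0 * real (y j))" for y :: "int \<Rightarrow> nat" using cJ by simp
  have f2: "integrable ref_out (\<lambda>y. (\<integral>x. (w K x)\<^sup>2 * kap J x y \<partial>P) * 1)"
     "(\<integral>x. (w K x)\<^sup>2 * (\<integral>y. 1 \<partial>chan x) \<partial>P) = (\<integral>y. (\<integral>x. (w K x)\<^sup>2 * kap J x y \<partial>P) * 1 \<partial>ref_out)"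
    by (rule fubini_pd[OF J _ _ one _ _ w2_abs]; simp add: depends_on_def)+
  have c1: "measure (chan x) UNIV = 1" for x
    using prob_space.prob_space[OF prob_space_poisson_channel, of lam0 h L x] by simp
  note f3 = T.fubini_pd1[OF J lm(2) T.ln_pd_depends T.ln_pd_bound c_nonneg]
  have "T.U J = (\<integral>y. T.pd J y * ln (T.pd J y) \<partial>ref_out)"
    unfolding T.U_def T.Ups_def by (rule f3(2))
  also have "\<dots> \<le> (\<integral>y. T.pd J y * ln (pd J y) + (\<integral>x. (w K x)\<^sup>2 * kap J x y \<partial>P) - T.pd J y \<partial>ref_out)"
    using f3(1) f1'(1) f2(1) T.pd_integral(1)[OF J] Te by (intro integral_mono) auto
  also have "\<dots> = (\<integral>x. w K x * Ups J x \<partial>P) + (1 + t\<^sup>2 * \<gamma>) ^ card K - 1"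
    using f1'(1,2) f2 T.pd_integral[OF J] w_moments(2)[OF K(2)] unfolding Ups_def by (simp add: c1)
  finally have U: "T.U J \<le> (\<integral>x. w K x * Ups J x \<partial>P) + \<delta> (card K)" by (simp add: \<delta>_def)
  have sb: "\<bar>\<Sum>j\<in>J. theta (rate x j)\<bar> \<le> (\<Sum>j\<in>J. 1 + c * M)" if "x \<in> inputs" for x
    by (intro order_trans[OF sum_abs] sum_mono thb that)
  have "(\<integral>x. w K x * Psi J x \<partial>P) = (\<integral>x. w K x * (\<Sum>j\<in>J. theta (rate x j)) - w K x * Ups J x \<partial>P)"
    unfolding Psi_def by (simp add: right_diff_distrib)
  also have "\<dots> = (\<integral>x. w K x * (\<Sum>j\<in>J. theta (rate x j)) \<partial>P) - (\<integral>x. w K x * Ups J x \<partial>P)"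
    by (intro Bochner_Integration.integral_diff wi[OF Ups_measurable[OF J] Ups_bound] wi[OF _ sb]) (auto intro: tm)
  finally show ?thesis using U V by (simp add: T.a_def J_def)
qed

text \<open>\<open>telescope\<close> is applied with \<open>Psi\<close> as the block functional and
  \<open>PsiW\<close> as its local parts; the two subtracted terms are the linearisation error and
  the chi-square term.\<close>

lemma gain:
  assumes n: "n \<ge> 1"
  defines "K \<equiv> {1 - int L..int n}" and "J \<equiv> {1..int n}"
  shows "t * (\<Sum>k\<in>K. \<integral>x. g (x k) * PsiW J k x \<partial>P) - real (n + L) * (\<bar>t\<bar> * B * CW * sqrt (\<delta> (n + L))) - \<delta> (n + L)
     \<le> T.a n - a n"
proof -
  have K: "finite K" "card K = n + L" and J: "finite J" by (auto simp: K_def J_def)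
  have "(\<integral>x. (w K x - 1) * Psi J x \<partial>P) = (\<integral>x. w K x * Psi J x - Psi J x \<partial>P)"
    by (simp add: left_diff_distrib)
  also have "\<dots> = (\<integral>x. w K x * Psi J x \<partial>P) - a n"
  proof (subst Bochner_Integration.integral_diff)
    show "integrable P (Psi J)" by (rule P_bounded(1)[OF Psi_measurable[OF J] Psi_bound[OF J]])
    show "integrable P (\<lambda>x. w K x * Psi J x)"
    proof (rule P_bounded(1)[where B = "2 ^ card K * (real (card J) * (1 + b + 2 * c * M))"])
      fix x assume x: "x \<in> inputs"
      show "\<bar>w K x * Psi J x\<bar> \<le> 2 ^ card K * (real (card J) * (1 + b + 2 * c * M))"
        unfolding abs_mult using w_abs[OF x] Psi_bound[OF J x] by (intro mult_mono) auto
    qed (use Psi_measurable[OF J] in measurable)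
    show "(\<integral>x. w K x * Psi J x \<partial>P) - (\<integral>x. Psi J x \<partial>P) = (\<integral>x. w K x * Psi J x \<partial>P) - a n"
      unfolding J_def by (simp add: Psi_integral)
  qed
  finally have e: "(\<integral>x. (w K x - 1) * Psi J x \<partial>P) = (\<integral>x. w K x * Psi J x \<partial>P) - a n" .
  have "\<bar>(\<integral>x. (w K x - 1) * Psi J x \<partial>P) - t * (\<Sum>k\<in>K. \<integral>x. g (x k) * PsiW J k x \<partial>P)\<bar>
    \<le> real (card K) * (\<bar>t\<bar> * B * CW * sqrt (\<delta> (card K)))"
    by (rule telescope[OF K(1) Psi_measurable[OF J] Psi_bound[OF J] PsiW_measurable[OF J] PsiW_bound[OF J] Psi_diff_invariant[OF J]])
  then show ?thesis
    using T_a_lower[OF n] e unfolding K_def[symmetric] J_def[symmetric] K(2) by linarith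
qed

lemma \<delta>_le: "\<delta> m \<le> exp (real m * (t\<^sup>2 * B\<^sup>2)) - 1"
proof -
  have "1 + t\<^sup>2 * \<gamma> \<le> exp (t\<^sup>2 * B\<^sup>2)"
    using exp_ge_add_one_self[of "t\<^sup>2 * B\<^sup>2"] mult_left_mono[OF \<gamma>_bounds(2) zero_le_power2, of t] by linarith
  then have "(1 + t\<^sup>2 * \<gamma>) ^ m \<le> exp (t\<^sup>2 * B\<^sup>2) ^ m"
    using \<gamma>_bounds(1) by (intro power_mono) auto
  then show ?thesis by (simp add: \<delta>_def exp_of_nat_mult)
qed

end

section \<open>Influence functions and stationarity\<close>

context poisson_input
begin

text \<open>The sum runs over all \<open>n + L\<close> inputs that reach the block. Division by
  \<open>n\<close> is the normalisation that cancels against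
  \<open>t = \<kappa> / n\<close>.\<close>

definition infl :: "nat \<Rightarrow> real \<Rightarrow> real" where
  "infl n u = (\<Sum>k\<in>{1 - int L..int n}. \<integral>x. PsiW {1..int n} k (x(k := u)) \<partial>P) / real n"

lemma PsiW_upd_integrable:
  assumes "finite J" "u \<in> space F"
  shows "integrable P (\<lambda>x. PsiW J k (x(k := u)))" "\<bar>\<integral>x. PsiW J k (x(k := u)) \<partial>P\<bar> \<le> CW"
proof -
  have "(\<lambda>x. x(k := u)) \<in> measurable input_space input_space"
    using assms(2) by measurable
  then have m: "(\<lambda>x. PsiW J k (x(k := u))) \<in> borel_measurable input_space"
    by (rule measurable_compose[OF _ PsiW_measurable[OF assms(1)]])
  show "integrable P (\<lambda>x. PsiW J k (x(k := u)))" "\<bar>\<integral>x. PsiW J k (x(k := u)) \<partial>P\<bar> \<le> CW"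
    using P_bounded[OF m PsiW_bound[OF assms(1) upd_in_space[OF _ assms(2)]]] by auto
qed

lemma infl_term_measurable:
  assumes J: "finite J" shows "(\<lambda>u. \<integral>x. PsiW J k (x(k := u)) \<partial>P) \<in> borel_measurable F"
proof -
  have "(\<lambda>(u, x). x(k := u)) \<in> measurable (F \<Otimes>\<^sub>M P) input_space" unfolding split_beta' by measurable
  from measurable_compose[OF this PsiW_measurable[OF J]]
  have "(\<lambda>(u, x). PsiW J k (x(k := u))) \<in> borel_measurable (F \<Otimes>\<^sub>M P)" by (simp add: split_beta')
  then show ?thesis by measurable
qed

lemma infl_integral:
  assumes n: "n \<ge> 1" and g: "g \<in> borel_measurable F" and gb: "\<And>u. u \<in> space F \<Longrightarrow> \<bar>g u\<bar> \<le> B"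
  shows "(\<Sum>k\<in>{1 - int L..int n}. \<integral>x. g (x k) * PsiW {1..int n} k x \<partial>P) = real n * (\<integral>u. g u * infl n u \<partial>F)"
proof -
  let ?J = "{1..int n}" and ?K = "{1 - int L..int n}"
  have J: "finite ?J" by simp
  have B: "0 \<le> B" using gb[of 0] A_nonneg by (simp add: space_F)
  have i: "integrable F (\<lambda>u. g u * (\<integral>x. PsiW ?J k (x(k := u)) \<partial>P))" for k
  proof (rule F.integrable_const_bound[where B = "B * CW"])
    show "AE u in F. norm (g u * (\<integral>x. PsiW ?J k (x(k := u)) \<partial>P)) \<le> B * CW"
      using gb PsiW_upd_integrable(2)[OF J] B by (intro AE_I2) (auto simp: abs_mult intro!: mult_mono)
  qed (use g infl_term_measurable[OF J] in measurable)
  have "(\<Sum>k\<in>?K. \<integral>x. g (x k) * PsiW ?J k x \<partial>P) = (\<Sum>k\<in>?K. \<integral>u. g u * (\<integral>x. PsiW ?J k (x(k := u)) \<partial>P) \<partial>F)"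
    by (intro sum.cong refl coordinate_fubini[OF g gb PsiW_measurable[OF J] PsiW_bound[OF J]])
  also have "\<dots> = (\<integral>u. (\<Sum>k\<in>?K. g u * (\<integral>x. PsiW ?J k (x(k := u)) \<partial>P)) \<partial>F)"
    using i by (intro Bochner_Integration.integral_sum[symmetric])
  also have "\<dots> = (\<integral>u. real n * (g u * infl n u) \<partial>F)"
    using n by (simp add: infl_def flip: sum_distrib_left)
  also have "\<dots> = real n * (\<integral>u. g u * infl n u \<partial>F)"
    by (rule Bochner_Integration.integral_mult_right_zero)
  finally show ?thesis .
qed

definition DD :: real where "DD = real L * (b + c * M) + real L * (1 + b + 2 * c * M)"

lemma DD_nonneg: "DD \<ge> 0"
  unfolding DD_def using b_nonneg c_nonneg M_pos by simp

text \<open>At scale \<open>t = \<kappa> / n\<close> the first-order gain \<open>\<kappa> \<integral> g \<sqdot> infl n\<close> is of order one, while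
  the second-order terms vanish as \<open>n\<close> grows.  A large \<open>\<kappa>\<close> therefore beats the constant \<open>DD\<close> by which
  block quantities differ from \<open>n\<close> times the rate.\<close>

lemma infl_upper:
  assumes g: "g \<in> borel_measurable (restrict_space borel {0..A})" and gb: "\<And>u. 0 \<le> u \<Longrightarrow> u \<le> A \<Longrightarrow> \<bar>g u\<bar> \<le> B"
    and g0: "(\<integral>u. g u \<partial>F) = 0" and g1: "(\<integral>u. u * g u \<partial>F) = 0"
    and opt: "\<And>G. G \<in> space (prob_algebra (restrict_space borel {0..A})) \<Longrightarrow> (\<integral>u. u \<partial>G) = (\<integral>u. u \<partial>F) \<Longrightarrow>
      information_rate lam0 h L G \<le> information_rate lam0 h L F"
    and e: "e > 0"
  shows "\<forall>\<^sub>F n in sequentially. (\<integral>u. g u * infl n u \<partial>F) < e"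
proof -
  have B: "0 \<le> B" using gb[of 0] A_nonneg by simp
  have gF: "g \<in> borel_measurable F" using g measurable_cong_sets[OF sets_F refl] by blast
  \<comment> \<open>Chosen so that \<open>\<kappa> * e = DD + 2\<close>: \<open>DD\<close> pays for
    passing from rates to blocks, 1 for the error \<open>err n\<close>, and the last unit leaves
    slack.\<close>
  define \<kappa> where "\<kappa> = (DD + 2) / e"
  have \<kappa>: "\<kappa> > 0" unfolding \<kappa>_def using e DD_nonneg by simp
  define q where "q = \<kappa>\<^sup>2 * B\<^sup>2"
  define d where "d n = exp (real (n + L) * (q / (real n)\<^sup>2)) - 1" for n
  \<comment> \<open>\<open>d n\<close> dominates the chi-square term \<open>\<delta> (n + L)\<close>
    and is of order \<open>1 / n\<close>. The factor \<open>n + L\<close> is compensated by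
    \<open>\<kappa> / n\<close>, so \<open>err\<close> decays like the root of
    \<open>d n\<close>.\<close>
  define err where "err n = real (n + L) * (\<kappa> / real n * B * CW * sqrt (d n)) + d n" for n
  have CW: "CW \<ge> 0" unfolding CW_def using c_nonneg M_pos by simp
  have d0: "d \<longlonglongrightarrow> 0"
  proof -
    have "(\<lambda>n. real (n + L) * (q / (real n)\<^sup>2)) \<longlonglongrightarrow> 0" by real_asymp
    from tendsto_diff[OF tendsto_exp[OF this] tendsto_const[of 1]] show ?thesis by (simp add: d_def[abs_def])
  qed
  have "err \<longlonglongrightarrow> 0"
  proof -
    have "(\<lambda>n. real (n + L) * \<kappa> / real n) \<longlonglongrightarrow> \<kappa>" by real_asymp
    then have "(\<lambda>n. (real (n + L) * \<kappa> / real n) * (B * CW) * sqrt (d n) + d n) \<longlonglongrightarrow> \<kappa> * (B * CW) * sqrt 0 + 0"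
      by (intro tendsto_intros d0)
    then show ?thesis by (simp add: err_def[abs_def] mult_ac)
  qed
  then have "\<forall>\<^sub>F n in sequentially. err n < 1" by (rule order_tendstoD) simp
  moreover have "\<forall>\<^sub>F n in sequentially. \<kappa> / real n * B < 1"
  proof -
    have "(\<lambda>n. \<kappa> / real n * B) \<longlonglongrightarrow> 0" by real_asymp
    then show ?thesis by (rule order_tendstoD) simp
  qed
  ultimately show ?thesis
    using eventually_ge_at_top[of 1]
  proof eventually_elim
    case (elim n)
    then have n: "n \<ge> 1" by simp
    define t where "t = \<kappa> / real n"
    have t: "t > 0" unfolding t_def using \<kappa> n by simp
    interpret X: perturbed_input L lam0 A h F g B t
      by standard (use g gb g0 elim t \<kappa> in \<open>simp_all add: t_def\<close>)
    have "information_rate lam0 h L X.Ft \<le> information_rate lam0 h L F"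
      by (rule opt[OF X.Ft_space]) (simp add: X.Ft_mean g1)
    then have "real n * information_rate lam0 h L X.Ft \<le> real n * information_rate lam0 h L F"
      by (intro mult_left_mono) auto
    then have "X.T.a n - a n \<le> DD"
      using X.T.information_rate_approx(2)[OF n] information_rate_approx(1)[OF n] unfolding DD_def by linarith
    moreover have "t * (real n * (\<integral>u. g u * infl n u \<partial>F)) - real (n + L) * (\<bar>t\<bar> * B * CW * sqrt (X.\<delta> (n + L))) - X.\<delta> (n + L) \<le> X.T.a n - a n"
      using X.gain[OF n] infl_integral[OF n gF X.g_bound_F] by simp
    moreover have "real (n + L) * (\<bar>t\<bar> * B * CW * sqrt (X.\<delta> (n + L))) + X.\<delta> (n + L) \<le> err n"
    proof -
      have "X.\<delta> (n + L) \<le> d n"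
        using X.\<delta>_le[of "n + L"] by (simp add: d_def t_def q_def power_divide)
      moreover from this have "(t * B * CW) * sqrt (X.\<delta> (n + L)) \<le> (t * B * CW) * sqrt (d n)"
        using t B CW by (intro mult_left_mono real_sqrt_le_mono) simp_all
      then have "real (n + L) * ((t * B * CW) * sqrt (X.\<delta> (n + L))) \<le> real (n + L) * ((t * B * CW) * sqrt (d n))"
        by (rule mult_left_mono) simp
      ultimately show ?thesis
        unfolding err_def t_def[symmetric] using t by simp
    qed
    moreover have "t * (real n * (\<integral>u. g u * infl n u \<partial>F)) = \<kappa> * (\<integral>u. g u * infl n u \<partial>F)"
      using n by (simp add: t_def)
    ultimately have "\<kappa> * (\<integral>u. g u * infl n u \<partial>F) < DD + 2" using elim by linarith
    moreover have "DD + 2 = \<kappa> * e" using e by (simp add: \<kappa>_def)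
    ultimately show ?case using \<kappa> by simp
  qed
qed

text \<open>The tilt in the direction \<open>- g\<close> preserves mass and mean as well, so the
  upper bound holds for both signs.\<close>

lemma infl_stationary:
  assumes g: "g \<in> borel_measurable (restrict_space borel {0..A})" and gb: "\<And>u. 0 \<le> u \<Longrightarrow> u \<le> A \<Longrightarrow> \<bar>g u\<bar> \<le> B"
    and g0: "(\<integral>u. g u \<partial>F) = 0" and g1: "(\<integral>u. u * g u \<partial>F) = 0"
    and opt: "\<And>G. G \<in> space (prob_algebra (restrict_space borel {0..A})) \<Longrightarrow> (\<integral>u. u \<partial>G) = (\<integral>u. u \<partial>F) \<Longrightarrow>
      information_rate lam0 h L G \<le> information_rate lam0 h L F"
  shows "(\<lambda>n. \<integral>u. g u * infl n u \<partial>F) \<longlonglongrightarrow> 0"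
proof (rule order_tendstoI)
  fix e :: real assume e: "e > 0"
  show "\<forall>\<^sub>F n in sequentially. (\<integral>u. g u * infl n u \<partial>F) < e"
    by (rule infl_upper[OF assms e])
next
  fix e :: real assume e: "e < 0"
  have "\<forall>\<^sub>F n in sequentially. (\<integral>u. - g u * infl n u \<partial>F) < - e"
    by (rule infl_upper[where B = B]) (use assms e in auto)
  then show "\<forall>\<^sub>F n in sequentially. e < (\<integral>u. g u * infl n u \<partial>F)" by simp
qed

end

section \<open>Holomorphic influence functions\<close>

text \<open>Dominated convergence for difference quotients. Only \<open>G\<close> has to be
  dominated locally: Cauchy's inequality on a smaller disc bounds the derivatives, and the mean
  value bound on that disc transfers this to the quotients.\<close>

lemma holomorphic_on_parametric_integral:
  fixes G :: "'a \<Rightarrow> complex \<Rightarrow> complex"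
  assumes S: "open S" and hol: "\<And>w. w \<in> space N \<Longrightarrow> G w holomorphic_on S"
    and meas: "\<And>u. u \<in> S \<Longrightarrow> (\<lambda>w. G w u) \<in> borel_measurable N"
    and dom: "\<And>z. z \<in> S \<Longrightarrow> \<exists>r>0. \<exists>D. integrable N D \<and> (\<forall>w\<in>space N. \<forall>u\<in>S \<inter> ball z r. norm (G w u) \<le> D w)"
  shows "(\<lambda>u. \<integral>w. G w u \<partial>N) holomorphic_on S"
proof (rule holomorphic_onI)
  fix z assume z: "z \<in> S"
  obtain r D where r: "r > 0" and D: "integrable N D" and bd: "\<And>w u. w \<in> space N \<Longrightarrow> u \<in> S \<Longrightarrow> u \<in> ball z r \<Longrightarrow> norm (G w u) \<le> D w"
    using dom[OF z] by blast
  obtain r0 where r0: "r0 > 0" "ball z r0 \<subseteq> S" using S z openE by blast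
  \<comment> \<open>Half of the smaller radius keeps the closed disc inside both \<open>S\<close>
    and the region of domination; discs of radius \<open>\<rho> / 2\<close> around points of
    \<open>?T\<close> still fit into it.\<close>
  define \<rho> where "\<rho> = min r r0 / 2"
  have \<rho>: "\<rho> > 0" using r r0 by (simp add: \<rho>_def)
  have cb: "cball z \<rho> \<subseteq> S \<inter> ball z r"
  proof
    fix u assume "u \<in> cball z \<rho>"
    then have "dist z u < r0" "dist z u < r" using r r0 by (auto simp: \<rho>_def)
    then show "u \<in> S \<inter> ball z r" using r0 by auto
  qed
  let ?T = "ball z (\<rho> / 2)"
  define C where "C w = D w / (\<rho> / 2)" for w
  have zT: "z \<in> ?T" using \<rho> by simp
  have sub: "cball u (\<rho> / 2) \<subseteq> cball z \<rho>" if "u \<in> ?T" for u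
  proof
    fix v assume "v \<in> cball u (\<rho> / 2)"
    then show "v \<in> cball z \<rho>" using that dist_triangle[of z v u] by simp
  qed
  have TS: "?T \<subseteq> S" using cb \<rho> by (auto dest!: subsetD)
  have db: "norm (deriv (G w) u) \<le> C w" if w: "w \<in> space N" and u: "u \<in> ?T" for w u
  proof -
    have "norm ((deriv ^^ 1) (G w) u) \<le> fact 1 * D w / (\<rho> / 2) ^ 1"
    proof (rule Cauchy_inequality)
      have s: "cball u (\<rho> / 2) \<subseteq> S" using sub[OF u] cb by blast
      then show "G w holomorphic_on ball u (\<rho> / 2)" using hol[OF w] holomorphic_on_subset ball_subset_cball by blast
      show "continuous_on (cball u (\<rho> / 2)) (G w)" using hol[OF w] s holomorphic_on_subset holomorphic_on_imp_continuous_on by blast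
      fix x assume "norm (u - x) = \<rho> / 2"
      then have "x \<in> cball u (\<rho> / 2)" by (simp add: dist_norm)
      then show "norm (G w x) \<le> D w" using sub[OF u] cb bd[OF w] by blast
    qed (use \<rho> in simp)
    then show ?thesis by (simp add: C_def)
  qed
  define Q where "Q w u = (G w u - G w z) / (u - z)" for w u
  have Qb: "norm (Q w u) \<le> C w" if w: "w \<in> space N" and u: "u \<in> ?T - {z}" for w u
  proof -
    have "norm (G w u - G w z) \<le> C w * norm (u - z)"
    proof (rule field_differentiable_bound[of ?T])
      show "(G w has_field_derivative deriv (G w) v) (at v within ?T)" if "v \<in> ?T" for v
        using holomorphic_derivI[OF hol[OF w] S, of v] that TS by (blast intro: DERIV_subset has_field_derivative_at_within)
    qed (use db[OF w] u zT in auto)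
    then show ?thesis using u by (simp add: Q_def norm_divide divide_le_eq)
  qed
  have Gi: "integrable N (\<lambda>w. G w u)" if "u \<in> ?T" for u
  proof (rule Bochner_Integration.integrable_bound[OF D])
    have "u \<in> cball z \<rho>" using that \<rho> by simp
    then show "AE w in N. norm (G w u) \<le> norm (D w)"
      using cb bd by (intro AE_I2) (force intro: order_trans[OF _ abs_ge_self])
  qed (use that TS meas in blast)
  have "((\<lambda>u. ((\<integral>w. G w u \<partial>N) - (\<integral>w. G w z \<partial>N)) / (u - z)) \<longlongrightarrow> (\<integral>w. deriv (G w) z \<partial>N)) (at z within ?T)"
    unfolding tendsto_at_iff_sequentially
  proof (intro allI impI)
    fix X assume X: "\<forall>i. X i \<in> ?T - {z}" and lim: "X \<longlonglongrightarrow> z"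
    have eq: "((\<integral>w. G w (X i) \<partial>N) - (\<integral>w. G w z \<partial>N)) / (X i - z) = (\<integral>w. Q w (X i) \<partial>N)" for i
      unfolding Q_def using X Gi zT by simp
    have Qm: "(\<lambda>w. Q w (X i)) \<in> borel_measurable N" for i
    proof -
      have "X i \<in> S" using X TS by blast
      then show ?thesis unfolding Q_def using meas[of "X i"] meas[OF z] by simp
    qed
    have Ql: "(\<lambda>i. Q w (X i)) \<longlonglongrightarrow> deriv (G w) z" if w: "w \<in> space N" for w
    proof -
      have "(G w has_field_derivative deriv (G w) z) (at z within ?T)"
        using holomorphic_derivI[OF hol[OF w] S z] by (rule has_field_derivative_at_within)
      then have "((\<lambda>u. Q w u) \<longlongrightarrow> deriv (G w) z) (at z within ?T)"
        unfolding has_field_derivative_iff Q_def .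
      then show ?thesis
        unfolding tendsto_at_iff_sequentially using X lim by (auto simp: o_def)
    qed
    have "(\<lambda>i. \<integral>w. Q w (X i) \<partial>N) \<longlonglongrightarrow> (\<integral>w. deriv (G w) z \<partial>N)"
    proof (rule integral_dominated_convergence[where w = C])
      show "(\<lambda>w. deriv (G w) z) \<in> borel_measurable N"
        by (rule borel_measurable_LIMSEQ_metric[OF Qm Ql])
      show "integrable N C" unfolding C_def using D by simp
    qed (use Qm Ql Qb X in auto)
    then show "((\<lambda>u. ((\<integral>w. G w u \<partial>N) - (\<integral>w. G w z \<partial>N)) / (u - z)) \<circ> X) \<longlonglongrightarrow> (\<integral>w. deriv (G w) z \<partial>N)"
      by (simp add: o_def eq)
  qed
  then have "((\<lambda>u. \<integral>w. G w u \<partial>N) has_field_derivative (\<integral>w. deriv (G w) z \<partial>N)) (at z within ?T)"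
    by (simp add: has_field_derivative_iff)
  then have "((\<lambda>u. \<integral>w. G w u \<partial>N) has_field_derivative (\<integral>w. deriv (G w) z \<partial>N)) (at z)"
    using at_within_open[OF zT] by simp
  then show "(\<lambda>u. \<integral>w. G w u \<partial>N) field_differentiable at z within S"
    by (meson field_differentiable_at_within field_differentiable_def)
qed

section \<open>Extension of likelihoods and scores to complex inputs\<close>

definition cpwt :: "complex \<Rightarrow> nat \<Rightarrow> complex" where
  "cpwt z m = exp (1 - z) * z ^ m"

definition ctheta :: "complex \<Rightarrow> complex" where
  "ctheta z = 1 - z + z * Ln z"

lemma cpwt_of_real: "cpwt (of_real z) m = of_real (pwt z m)"
  by (simp add: cpwt_def pwt_def exp_of_real[symmetric])

lemma ctheta_of_real: "z > 0 \<Longrightarrow> ctheta (of_real z) = of_real (theta z)"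
  by (simp add: ctheta_def theta_def Ln_of_real)

lemma cpwt_measurable [measurable (raw)]:
  assumes [measurable]: "f \<in> borel_measurable N" and g: "g \<in> measurable N (count_space UNIV)"
  shows "(\<lambda>w. cpwt (f w) (g w)) \<in> borel_measurable N"
proof -
  have "(\<lambda>w. cpwt (f w) m) \<in> borel_measurable N" for m
    unfolding cpwt_def by measurable
  then show ?thesis by (rule measurable_compose_countable[OF _ g])
qed

context poisson_input
begin

definition zet :: "int \<Rightarrow> int \<Rightarrow> (int \<Rightarrow> real) \<Rightarrow> complex \<Rightarrow> complex" where
  "zet k j x u = of_real (rate (x(k := 0)) j) + of_real (h (nat (j - k))) * u"

definition kapC :: "int set \<Rightarrow> int \<Rightarrow> (int \<Rightarrow> real) \<Rightarrow> complex \<Rightarrow> (int \<Rightarrow> nat) \<Rightarrow> complex" where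
  "kapC J k x u y = of_real (kap (J - {k..k + int L}) x y) * (\<Prod>j\<in>J \<inter> {k..k + int L}. cpwt (zet k j x u) (y j))"

definition thetaC :: "int set \<Rightarrow> int \<Rightarrow> complex \<Rightarrow> complex" where
  "thetaC J k u = (\<integral>x. (\<Sum>j\<in>J \<inter> {k..k + int L}. ctheta (zet k j x u)) \<partial>P)"

text \<open>The score \<open>wscore\<close> is a function of the outputs only and stays real; the
  complex input enters solely through the likelihood factors in the window.\<close>

definition scoreC :: "int set \<Rightarrow> int \<Rightarrow> complex \<Rightarrow> complex" where
  "scoreC J k u = (\<integral>w. kapC J k (fst w) u (snd w) * of_real (wscore J k (snd w)) \<partial>base)"

text \<open>On this half plane every rate in the window has real part at least
  \<open>lam0 / 2\<close>, so the principal logarithm is holomorphic there. It is connected and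
  contains \<open>[0, \<infinity>)\<close>.\<close>

definition dom :: "complex set" where "dom = {u. Re u > - (lam0 / 2)}"

lemma open_dom: "open dom" and convex_dom: "convex dom"
  unfolding dom_def by (rule open_halfspace_Re_gt, rule convex_halfspace_Re_gt)

lemma of_real_in_dom: "0 \<le> u \<Longrightarrow> of_real u \<in> dom"
  unfolding dom_def using lam0_pos by simp

lemma upd0: "x \<in> inputs \<Longrightarrow> x(k := 0) \<in> inputs"
  using A_nonneg by (auto simp: space_input)

lemma upd0_measurable [measurable]: "(\<lambda>x. x(k := 0)) \<in> measurable input_space input_space"
  by (rule measurable_upd_input) (auto simp: space_F A_nonneg)

lemma zet_measurable [measurable (raw)]:
  assumes f: "f \<in> measurable N input_space"
  shows "(\<lambda>w. zet k j (f w) u) \<in> borel_measurable N"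
  using measurable_compose[OF f measurable_compose[OF upd0_measurable rate_measurable]]
  unfolding zet_def by measurable

lemma zet_real: "j \<in> {k..k + int L} \<Longrightarrow> zet k j x (of_real u) = of_real (rate (x(k := u)) j)"
  unfolding zet_def by (subst rate_upd[of j k x u]) auto

lemma kapC_real:
  assumes J: "finite J" shows "kapC J k x (of_real u) y = of_real (kap J (x(k := u)) y)"
proof -
  have "kap J (x(k := u)) y = kap (J - {k..k + int L}) x y * (\<Prod>j\<in>J \<inter> {k..k + int L}. pwt (rate (x(k := u)) j) (y j))"
    unfolding kap_def prod.Int_Diff[OF J, of _ "{k..k + int L}"]
    by (subst mult.commute) (simp add: rate_upd_same)
  then show ?thesis by (simp add: kapC_def zet_real cpwt_of_real)
qed

lemma h_window: "j \<in> {k..k + int L} \<Longrightarrow> 0 \<le> h (nat (j - k)) \<and> h (nat (j - k)) \<le> 1"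
  using h_nonneg[of "nat (j - k)"] h_le_1[of "nat (j - k)"] by auto

lemma zet_bounds:
  assumes x: "x \<in> inputs" and j: "j \<in> {k..k + int L}" and u: "norm u \<le> R"
  shows "norm (zet k j x u) \<le> rate (x(k := R)) j" "rate (x(k := R)) j - 2 * R \<le> Re (zet k j x u)" "rate (x(k := R)) j \<le> M + R"
proof -
  let ?r = "rate (x(k := 0)) j" and ?h = "h (nat (j - k))"
  have r: "lam0 \<le> ?r" "?r \<le> M" "0 < ?r" using rate_bounds[OF upd0[OF x], of k j] by auto
  have hh: "0 \<le> ?h" "?h \<le> 1" using h_window[OF j] by auto
  have R: "0 \<le> R" using u norm_ge_zero order_trans by blast
  have e: "rate (x(k := R)) j = ?r + ?h * R" by (rule rate_upd[OF j])
  have "norm (zet k j x u) \<le> ?r + ?h * norm u"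
    unfolding zet_def using r hh norm_triangle_ineq[of "complex_of_real ?r" "complex_of_real ?h * u"] by (simp add: norm_mult)
  also have "\<dots> \<le> rate (x(k := R)) j" unfolding e using u hh by (simp add: mult_left_mono)
  finally show "norm (zet k j x u) \<le> rate (x(k := R)) j" .
  have hR: "?h * R \<le> R" using hh R mult_right_mono[of ?h 1 R] by simp
  have "- R \<le> Re u" using u abs_Re_le_cmod[of u] by linarith
  then have "?h * (- R) \<le> ?h * Re u" using hh by (intro mult_left_mono)
  then show "rate (x(k := R)) j - 2 * R \<le> Re (zet k j x u)"
    unfolding e zet_def using hR by simp
  show "rate (x(k := R)) j \<le> M + R" unfolding e using r hR by linarith
qed

lemma zet_Re:
  assumes x: "x \<in> inputs" and j: "j \<in> {k..k + int L}" and u: "u \<in> dom"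
  shows "lam0 / 2 \<le> Re (zet k j x u)"
proof -
  let ?r = "rate (x(k := 0)) j" and ?h = "h (nat (j - k))"
  have r: "lam0 \<le> ?r" using rate_bounds[OF upd0[OF x], of k j] by auto
  have hh: "0 \<le> ?h" "?h \<le> 1" using h_window[OF j] by auto
  have "?h * (- (lam0 / 2)) \<le> ?h * Re u" using u hh by (intro mult_left_mono) (auto simp: dom_def)
  moreover have "?h * (lam0 / 2) \<le> lam0 / 2" using hh lam0_pos mult_right_mono[of ?h 1 "lam0 / 2"] by simp
  ultimately show ?thesis unfolding zet_def using r by simp
qed

text \<open>The complex likelihood is compared with the real one at the input \<open>R\<close>. With
  \<open>r\<close> the rate for input \<open>R\<close>, the complex rate has modulus at most
  \<open>r\<close> and real part at least \<open>r - 2 * R\<close>, so each of the at most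
  \<open>L + 1\<close> window factors costs \<open>exp (2 * R)\<close>. The dominating function is
  again a Poisson likelihood.\<close>

lemma kapC_bound:
  assumes J: "finite J" and x: "x \<in> inputs" and u: "norm u \<le> R"
  shows "norm (kapC J k x u y) \<le> exp (2 * R) ^ (L + 1) * kap J (x(k := R)) y"
proof -
  let ?W = "J \<inter> {k..k + int L}"
  have R: "0 \<le> R" using u norm_ge_zero order_trans by blast
  have pos: "0 < rate (x(k := R)) j" for j
    by (rule rate_pos) (use x R in \<open>auto simp: space_input\<close>)
  have f: "norm (cpwt (zet k j x u) m) \<le> exp (2 * R) * pwt (rate (x(k := R)) j) m" if j: "j \<in> ?W" for j m
  proof -
    have j': "j \<in> {k..k + int L}" using j by simp
    have "norm (cpwt (zet k j x u) m) = exp (1 - Re (zet k j x u)) * norm (zet k j x u) ^ m"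
      by (simp add: cpwt_def norm_mult norm_power)
    also have "\<dots> \<le> exp (2 * R + (1 - rate (x(k := R)) j)) * rate (x(k := R)) j ^ m"
      using zet_bounds(1,2)[OF x j' u] by (intro mult_mono power_mono) auto
    also have "\<dots> = exp (2 * R) * pwt (rate (x(k := R)) j) m"
      unfolding pwt_def by (simp add: exp_add)
    finally show ?thesis .
  qed
  have "norm (\<Prod>j\<in>?W. cpwt (zet k j x u) (y j)) \<le> (\<Prod>j\<in>?W. exp (2 * R) * pwt (rate (x(k := R)) j) (y j))"
    unfolding prod_norm[symmetric] using f by (intro prod_mono) auto
  also have "\<dots> = exp (2 * R) ^ card ?W * (\<Prod>j\<in>?W. pwt (rate (x(k := R)) j) (y j))"
    by (simp add: prod.distrib)
  also have "\<dots> \<le> exp (2 * R) ^ (L + 1) * (\<Prod>j\<in>?W. pwt (rate (x(k := R)) j) (y j))"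
  proof (rule mult_right_mono)
    have "card ?W \<le> card {k..k + int L}" by (rule card_mono) auto
    then show "exp (2 * R) ^ card ?W \<le> exp (2 * R) ^ (L + 1)" using R by (intro power_increasing) auto
  qed (intro prod_nonneg ballI less_imp_le pwt_pos pos)
  finally have w: "norm (\<Prod>j\<in>?W. cpwt (zet k j x u) (y j)) \<le> exp (2 * R) ^ (L + 1) * (\<Prod>j\<in>?W. pwt (rate (x(k := R)) j) (y j))" .
  have "kap J (x(k := R)) y = kap (J - {k..k + int L}) x y * (\<Prod>j\<in>?W. pwt (rate (x(k := R)) j) (y j))"
    unfolding kap_def prod.Int_Diff[OF J, of _ "{k..k + int L}"]
    by (subst mult.commute) (simp add: rate_upd_same)
  then show ?thesis
    using mult_left_mono[OF w kap_nonneg[OF x, of "J - {k..k + int L}" y]] kap_nonneg[OF x, of "J - {k..k + int L}" y]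
    by (simp add: kapC_def norm_mult mult_ac)
qed

text \<open>For \<open>R > A\<close> the updated sequence leaves \<open>input_space\<close>, so
  measurability comes from the affine form of the rates in the window.\<close>

lemma kap_upd_measurable:
  assumes J: "finite J"
  shows "(\<lambda>(x, y). kap J (x(k := R)) y) \<in> borel_measurable (input_space \<Otimes>\<^sub>M output_space)"
proof -
  have "(\<lambda>x. rate (x(k := R)) j) \<in> borel_measurable input_space" for j
  proof (cases "j \<in> {k..k + int L}")
    case True
    have "(\<lambda>x. rate (x(k := 0)) j + h (nat (j - k)) * R) \<in> borel_measurable input_space"
      using measurable_compose[OF upd0_measurable rate_measurable] by measurable
    then show ?thesis by (simp only: rate_upd[OF True, of _ R])
  next
    case False
    then have "(\<lambda>x. rate (x(k := R)) j) = (\<lambda>x. rate x j)" by (intro ext rate_upd_same)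
    then show ?thesis by simp
  qed
  then have [measurable]: "(\<lambda>w. rate ((fst w)(k := R)) j) \<in> borel_measurable (input_space \<Otimes>\<^sub>M output_space)" for j
    by (rule measurable_compose[OF measurable_fst])
  show ?thesis unfolding kap_def split_beta' by measurable
qed

text \<open>Expectations of the score with the input at \<open>k\<close> frozen at \<open>R\<close>,
  which may exceed \<open>A\<close>. The third bound is linear in \<open>R\<close> and does not
  involve the block; the growth argument rests on this.\<close>

lemma wscore_pair:
  assumes J: "finite J" and R: "0 \<le> R"
  shows "integrable base (\<lambda>(x, y). kap J (x(k := R)) y * wscore J k y)"
    and "integrable base (\<lambda>(x, y). kap J (x(k := R)) y * \<bar>wscore J k y\<bar>)"
    and "(\<integral>(x, y). kap J (x(k := R)) y * \<bar>wscore J k y\<bar> \<partial>base) \<le> (real L + 1) * c * (M + R)"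
    and "integrable P (\<lambda>x. \<integral>y. wscore J k y \<partial>chan (x(k := R)))"
    and "(\<integral>(x, y). kap J (x(k := R)) y * wscore J k y \<partial>base) = (\<integral>x. (\<integral>y. wscore J k y \<partial>chan (x(k := R))) \<partial>P)"
proof -
  let ?W = "J \<inter> {k..k + int L}"
  note km[measurable] = kap_upd_measurable[OF J, of k R]
  have nn: "0 \<le> (x(k := R)) i" if "x \<in> inputs" for x i using that R by (auto simp: space_input)
  have kn: "0 \<le> kap J (x(k := R)) y" if "x \<in> inputs" for x y
    using kap_pos[of "x(k := R)", OF nn[OF that]] by (simp add: less_imp_le)
  have in1: "(\<integral>y. kap J (x(k := R)) y * wscore J k y \<partial>ref_out) = (\<integral>y. wscore J k y \<partial>chan (x(k := R)))"
    and in2: "(\<integral>y. kap J (x(k := R)) y * \<bar>wscore J k y\<bar> \<partial>ref_out) = (\<integral>y. \<bar>wscore J k y\<bar> \<partial>chan (x(k := R)))"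
    and in3: "integrable ref_out (\<lambda>y. kap J (x(k := R)) y * wscore J k y)"
    and in4: "(\<integral>y. \<bar>wscore J k y\<bar> \<partial>chan (x(k := R))) \<le> (real L + 1) * c * (M + R)"
    if x: "x \<in> inputs" for x
  proof -
    show "(\<integral>y. kap J (x(k := R)) y * wscore J k y \<partial>ref_out) = (\<integral>y. wscore J k y \<partial>chan (x(k := R)))"
      by (rule integral_chan(1)[symmetric, OF nn[OF x] J wscore_measurable wscore_depends])
    show "(\<integral>y. kap J (x(k := R)) y * \<bar>wscore J k y\<bar> \<partial>ref_out) = (\<integral>y. \<bar>wscore J k y\<bar> \<partial>chan (x(k := R)))"
      by (rule integral_chan(1)[symmetric, OF nn[OF x] J _ depends_on_compose[OF wscore_depends]]) measurable
    show "integrable ref_out (\<lambda>y. kap J (x(k := R)) y * wscore J k y)"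
      by (rule integral_chan(2)[THEN iffD1, OF nn[OF x] J wscore_measurable wscore_depends wscore_chan(1)[OF nn[OF x] J]])
    have "(\<integral>y. \<bar>wscore J k y\<bar> \<partial>chan (x(k := R))) \<le> (\<Sum>j\<in>?W. 0 + c * rate (x(k := R)) j)"
      by (rule chan_bound(3)[OF nn[OF x] wscore_measurable wscore_bound[OF J]])
    also have "\<dots> \<le> (\<Sum>j\<in>?W. c * (M + R))"
      using zet_bounds(3)[OF x, of _ k 0 R] R c_nonneg by (intro sum_mono) (auto intro!: mult_left_mono)
    also have "\<dots> = real (card ?W) * (c * (M + R))" by simp
    also have "\<dots> \<le> (real L + 1) * (c * (M + R))"
      using card_window[of J k] c_nonneg M_pos R by (intro mult_right_mono) auto
    finally show "(\<integral>y. \<bar>wscore J k y\<bar> \<partial>chan (x(k := R))) \<le> (real L + 1) * c * (M + R)" by (simp add: mult_ac)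
  qed
  have na: "(\<integral>y. norm (kap J (x(k := R)) y * wscore J k y) \<partial>ref_out) = (\<integral>y. \<bar>wscore J k y\<bar> \<partial>chan (x(k := R)))"
    if x: "x \<in> inputs" for x
    using in2[OF x] kn[OF x] by (simp add: abs_mult)
  let ?B = "(real L + 1) * c * (M + R)"
  have ws[measurable]: "(\<lambda>w. wscore J k (snd w)) \<in> borel_measurable base"
    by measurable
  have km'[measurable]: "(\<lambda>w. kap J ((fst w)(k := R)) (snd w)) \<in> borel_measurable base"
    using km by (simp add: split_beta' measurable_cong_sets[OF sets_pair_measure_cong[OF sets_P sets_ref_out] refl])
  have i: "integrable base (\<lambda>(x, y). kap J (x(k := R)) y * wscore J k y)"
  proof (rule PR.Fubini_integrable)
    show m: "(\<lambda>(x, y). kap J (x(k := R)) y * wscore J k y) \<in> borel_measurable base"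
      unfolding split_beta' by measurable
    show "integrable P (\<lambda>x. \<integral>y. norm (case (x, y) of (x, y) \<Rightarrow> kap J (x(k := R)) y * wscore J k y) \<partial>ref_out)"
    proof (rule P.integrable_const_bound[where B = ?B])
      show "AE x in P. norm (\<integral>y. norm (case (x, y) of (x, y) \<Rightarrow> kap J (x(k := R)) y * wscore J k y) \<partial>ref_out) \<le> ?B"
        using na in4 by (intro AE_I2) simp
      show "(\<lambda>x. \<integral>y. norm (case (x, y) of (x, y) \<Rightarrow> kap J (x(k := R)) y * wscore J k y) \<partial>ref_out) \<in> borel_measurable P"
        using m by measurable
    qed
    show "AE x in P. integrable ref_out (\<lambda>y. case (x, y) of (x, y) \<Rightarrow> kap J (x(k := R)) y * wscore J k y)"
      using in3 by (intro AE_I2) simp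
  qed
  then show "integrable base (\<lambda>(x, y). kap J (x(k := R)) y * wscore J k y)" .
  show "integrable P (\<lambda>x. \<integral>y. wscore J k y \<partial>chan (x(k := R)))"
    using PR.integrable_fst[OF i]
    by (rule Bochner_Integration.integrable_cong[THEN iffD1, rotated -1]) (simp_all add: in1)
  show "(\<integral>(x, y). kap J (x(k := R)) y * wscore J k y \<partial>base) = (\<integral>x. (\<integral>y. wscore J k y \<partial>chan (x(k := R))) \<partial>P)"
    unfolding PR.integral_fst[OF i, symmetric] by (rule Bochner_Integration.integral_cong[OF refl]) (simp add: in1)
  have ia: "integrable base (\<lambda>w. \<bar>case w of (x, y) \<Rightarrow> kap J (x(k := R)) y * wscore J k y\<bar>)"
    using i by (rule integrable_abs)
  show i2: "integrable base (\<lambda>(x, y). kap J (x(k := R)) y * \<bar>wscore J k y\<bar>)"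
    using ia
  proof (rule Bochner_Integration.integrable_cong[THEN iffD1, rotated -1, OF _ refl])
    fix w assume "w \<in> space base"
    then show "\<bar>case w of (x, y) \<Rightarrow> kap J (x(k := R)) y * wscore J k y\<bar> = (case w of (x, y) \<Rightarrow> kap J (x(k := R)) y * \<bar>wscore J k y\<bar>)"
      using kn by (auto simp: space_pair_measure abs_mult)
  qed
  have "(\<integral>(x, y). kap J (x(k := R)) y * \<bar>wscore J k y\<bar> \<partial>base) = (\<integral>x. (\<integral>y. kap J (x(k := R)) y * \<bar>wscore J k y\<bar> \<partial>ref_out) \<partial>P)"
    by (rule PR.integral_fst[OF i2, symmetric])
  also have "\<dots> \<le> ?B"
    using PR.integrable_fst[OF i2] in2 in4 by (intro P.integral_le_const AE_I2) auto
  finally show "(\<integral>(x, y). kap J (x(k := R)) y * \<bar>wscore J k y\<bar> \<partial>base) \<le> ?B" .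
qed

text \<open>The bound is the same for all \<open>J\<close> and \<open>k\<close>, as local
  boundedness in the block length demands.\<close>

lemma scoreC_holomorphic_bound:
  assumes J: "finite J"
  shows "scoreC J k holomorphic_on UNIV"
    and "norm u \<le> R \<Longrightarrow> norm (scoreC J k u) \<le> exp (2 * R) ^ (L + 1) * ((real L + 1) * c * (M + R))"
proof -
  let ?G = "\<lambda>w u. kapC J k (fst w) u (snd w) * of_real (wscore J k (snd w))"
  let ?D = "\<lambda>R w. exp (2 * R) ^ (L + 1) * (case w of (x, y) \<Rightarrow> kap J (x(k := R)) y * \<bar>wscore J k y\<bar>)"
  have bd: "norm (?G w u) \<le> ?D R w" if "w \<in> space base" "norm u \<le> R" for w u R
  proof -
    have x: "fst w \<in> inputs" using that by (auto simp: space_pair_measure)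
    show ?thesis
      using mult_right_mono[OF kapC_bound[OF J x that(2), of k "snd w"], of "\<bar>wscore J k (snd w)\<bar>"]
      by (simp add: norm_mult split_beta' mult_ac)
  qed
  have m: "(\<lambda>w. ?G w u) \<in> borel_measurable base" for u
    unfolding kapC_def by measurable
  have Di: "integrable base (?D R)" if "0 \<le> R" for R
    using wscore_pair(2)[OF J that, of k] by simp
  show "scoreC J k holomorphic_on UNIV"
    unfolding scoreC_def[abs_def]
  proof (rule holomorphic_on_parametric_integral)
    show "(\<lambda>u. ?G w u) holomorphic_on UNIV" for w
      unfolding kapC_def cpwt_def zet_def by (intro holomorphic_intros)
    fix z :: complex
    show "\<exists>r>0. \<exists>D. integrable base D \<and> (\<forall>w\<in>space base. \<forall>u\<in>UNIV \<inter> ball z r. norm (?G w u) \<le> D w)"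
    proof (intro exI[of _ 1] conjI exI[of _ "?D (norm z + 1)"] ballI)
      fix w u assume "w \<in> space base" "u \<in> UNIV \<inter> ball z 1"
      moreover from this have "norm u \<le> norm z + 1"
        using norm_triangle_ineq[of z "u - z"] by (simp add: dist_norm norm_minus_commute)
      ultimately show "norm (?G w u) \<le> ?D (norm z + 1) w" by (intro bd)
    qed (use Di in auto)
  qed (use m in auto)
  assume u: "norm u \<le> R"
  have R: "0 \<le> R" using u norm_ge_zero order_trans by blast
  have "norm (scoreC J k u) \<le> (\<integral>w. ?D R w \<partial>base)"
    unfolding scoreC_def
  proof (rule order_trans[OF integral_norm_bound integral_mono[OF integrable_norm Di[OF R]]])
    show "integrable base (\<lambda>w. ?G w u)"
      by (rule Bochner_Integration.integrable_bound[OF Di[OF R] m])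
         (rule AE_I2, rule order_trans[OF bd[OF _ u]], assumption, simp only: real_norm_def abs_ge_self)
  qed (rule bd[OF _ u])
  also have "\<dots> \<le> exp (2 * R) ^ (L + 1) * ((real L + 1) * c * (M + R))"
    using wscore_pair(3)[OF J R, of k] by (simp add: mult_left_mono)
  finally show "norm (scoreC J k u) \<le> exp (2 * R) ^ (L + 1) * ((real L + 1) * c * (M + R))" .
qed

text \<open>Bound for \<open>ctheta\<close> at points of modulus between \<open>lam0 / 2\<close> and
  \<open>M + R\<close>; \<open>pi\<close> accounts for the argument in the principal
  logarithm.\<close>

definition thetaR :: "real \<Rightarrow> real" where
  "thetaR R = 1 + (M + R) * (1 + (\<bar>ln (lam0 / 2)\<bar> + \<bar>ln (M + R)\<bar> + pi))"

lemma ctheta_bound: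
  assumes x: "x \<in> inputs" and j: "j \<in> {k..k + int L}" and u: "u \<in> dom" "norm u \<le> R"
  shows "norm (ctheta (zet k j x u)) \<le> thetaR R"
proof -
  let ?z = "zet k j x u"
  have z1: "norm ?z \<le> M + R" using zet_bounds(1,3)[OF x j u(2)] by linarith
  have z2: "lam0 / 2 \<le> norm ?z" using zet_Re[OF x j u(1)] complex_Re_le_cmod[of ?z] by linarith
  have z0: "norm ?z > 0" "?z \<noteq> 0" using z2 lam0_pos by auto
  have "\<bar>ln (norm ?z)\<bar> \<le> \<bar>ln (lam0 / 2)\<bar> + \<bar>ln (M + R)\<bar>"
  proof -
    have "ln (lam0 / 2) \<le> ln (norm ?z)" using z2 lam0_pos z0 by simp
    moreover have "ln (norm ?z) \<le> ln (M + R)"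
    proof -
      have "0 < M + R" using z1 z0 by linarith
      from ln_le_cancel_iff[OF z0(1) this] show ?thesis using z1 by blast
    qed
    ultimately show ?thesis by linarith
  qed
  moreover have "norm (Ln ?z) \<le> \<bar>ln (norm ?z)\<bar> + pi"
  proof -
    have "norm (Ln ?z) \<le> \<bar>Re (Ln ?z)\<bar> + \<bar>Im (Ln ?z)\<bar>" by (rule cmod_le)
    then show ?thesis using z0 Im_Ln_le_pi[of ?z] mpi_less_Im_Ln[of ?z] by simp
  qed
  ultimately have l: "norm (Ln ?z) \<le> \<bar>ln (lam0 / 2)\<bar> + \<bar>ln (M + R)\<bar> + pi" by linarith
  have "norm (ctheta ?z) \<le> norm (1 - ?z) + norm (?z * Ln ?z)"
    unfolding ctheta_def by (rule norm_triangle_ineq)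
  also have "\<dots> \<le> (1 + norm ?z) + norm ?z * norm (Ln ?z)"
    using norm_triangle_ineq4[of 1 ?z] by (simp add: norm_mult)
  also have "\<dots> \<le> (1 + (M + R)) + (M + R) * (\<bar>ln (lam0 / 2)\<bar> + \<bar>ln (M + R)\<bar> + pi)"
    using z1 l z0 order_trans[OF norm_ge_zero z1] by (intro add_mono mult_mono order_refl) simp_all
  finally show ?thesis by (simp add: thetaR_def algebra_simps)
qed

lemma thetaC_holomorphic_bound:
  shows "thetaC J k holomorphic_on dom"
    and "u \<in> dom \<Longrightarrow> norm u \<le> R \<Longrightarrow> norm (thetaC J k u) \<le> (real L + 1) * thetaR R"
proof -
  let ?W = "J \<inter> {k..k + int L}"
  let ?G = "\<lambda>x u. \<Sum>j\<in>?W. ctheta (zet k j x u)"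
  have bd: "norm (?G x u) \<le> (real L + 1) * thetaR R" if "x \<in> inputs" "u \<in> dom" "norm u \<le> R" for x u R
  proof -
    have "norm (?G x u) \<le> (\<Sum>j\<in>?W. thetaR R)"
      using ctheta_bound[OF that(1) _ that(2,3)] by (intro sum_norm_le) auto
    also have "\<dots> = real (card ?W) * thetaR R" by simp
    also have "\<dots> \<le> (real L + 1) * thetaR R"
    proof (rule mult_right_mono[OF card_window])
      show "0 \<le> thetaR R"
        by (rule order_trans[OF norm_ge_zero ctheta_bound[OF that(1) _ that(2,3), of k k]]) simp
    qed
    finally show ?thesis .
  qed
  have m: "(\<lambda>x. ?G x u) \<in> borel_measurable P" for u
    unfolding ctheta_def by measurable
  show "thetaC J k holomorphic_on dom"
    unfolding thetaC_def[abs_def]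
  proof (rule holomorphic_on_parametric_integral[OF open_dom])
    fix x assume "x \<in> space P"
    then have x: "x \<in> inputs" by simp
    show "(\<lambda>u. ?G x u) holomorphic_on dom"
      unfolding ctheta_def
    proof (intro holomorphic_intros)
      fix j u assume "j \<in> ?W" "u \<in> dom"
      then have "0 < Re (zet k j x u)" using zet_Re[OF x, of j k u] lam0_pos by auto
      then show "zet k j x u \<notin> \<real>\<^sub>\<le>\<^sub>0" by (auto simp: complex_nonpos_Reals_iff)
    qed (auto simp: zet_def[abs_def] intro!: holomorphic_intros)
  next
    fix z assume z: "z \<in> dom"
    show "\<exists>r>0. \<exists>D. integrable P D \<and> (\<forall>x\<in>space P. \<forall>u\<in>dom \<inter> ball z r. norm (?G x u) \<le> D x)"
    proof (intro exI[of _ 1] conjI exI[of _ "\<lambda>_. (real L + 1) * thetaR (norm z + 1)"] ballI)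
      fix x u assume "x \<in> space P" "u \<in> dom \<inter> ball z 1"
      moreover from this have "norm u \<le> norm z + 1"
        using norm_triangle_ineq[of z "u - z"] by (simp add: dist_norm norm_minus_commute)
      ultimately show "norm (?G x u) \<le> (real L + 1) * thetaR (norm z + 1)" by (intro bd) auto
    qed auto
  qed (rule m)
  assume u: "u \<in> dom" "norm u \<le> R"
  have i: "integrable P (\<lambda>x. ?G x u)"
    using bd[OF _ u] m by (intro P.integrable_const_bound[where B = "(real L + 1) * thetaR R"]) auto
  have "norm (thetaC J k u) \<le> (\<integral>x. (real L + 1) * thetaR R \<partial>P)"
    unfolding thetaC_def using i bd[OF _ u] by (intro order_trans[OF integral_norm_bound integral_mono]) auto
  then show "norm (thetaC J k u) \<le> (real L + 1) * thetaR R" by simp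
qed

lemma scoreC_real:
  assumes "finite J" "0 \<le> u"
  shows "scoreC J k (of_real u) = of_real (\<integral>x. (\<integral>y. wscore J k y \<partial>chan (x(k := u))) \<partial>P)"
proof -
  have "scoreC J k (of_real u) = (\<integral>w. of_real (case w of (x, y) \<Rightarrow> kap J (x(k := u)) y * wscore J k y) \<partial>base)"
    unfolding scoreC_def by (simp add: kapC_real assms split_beta')
  also have "\<dots> = of_real (\<integral>(x, y). kap J (x(k := u)) y * wscore J k y \<partial>base)"
    by (rule integral_complex_of_real)
  finally show ?thesis using wscore_pair(5)[OF assms] by simp
qed

lemma thetaC_real:
  assumes u: "0 \<le> u"
  shows "thetaC J k (of_real u) = of_real (\<integral>x. (\<Sum>j\<in>J \<inter> {k..k + int L}. theta (rate (x(k := u)) j)) \<partial>P)"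
    and "integrable P (\<lambda>x. \<Sum>j\<in>J \<inter> {k..k + int L}. theta (rate (x(k := u)) j))"
proof -
  let ?W = "J \<inter> {k..k + int L}"
  have eq: "(\<Sum>j\<in>?W. ctheta (zet k j x (of_real u))) = of_real (\<Sum>j\<in>?W. theta (rate (x(k := u)) j))" if x: "x \<in> inputs" for x
  proof -
    have "0 < rate (x(k := u)) j" for j
      by (rule rate_pos) (use x u in \<open>auto simp: space_input\<close>)
    then show ?thesis by (simp add: zet_real ctheta_of_real)
  qed
  have "thetaC J k (of_real u) = (\<integral>x. of_real (\<Sum>j\<in>?W. theta (rate (x(k := u)) j)) \<partial>P)"
    unfolding thetaC_def by (rule Bochner_Integration.integral_cong[OF refl]) (simp add: eq)
  also have "\<dots> = of_real (\<integral>x. (\<Sum>j\<in>?W. theta (rate (x(k := u)) j)) \<partial>P)"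
    by (rule integral_complex_of_real)
  finally show "thetaC J k (of_real u) = of_real (\<integral>x. (\<Sum>j\<in>?W. theta (rate (x(k := u)) j)) \<partial>P)" .
  have "integrable P (\<lambda>x. \<Sum>j\<in>?W. ctheta (zet k j x (of_real u)))"
  proof (rule P.integrable_const_bound[where B = "real (card ?W) * thetaR u"])
    show "AE x in P. norm (\<Sum>j\<in>?W. ctheta (zet k j x (of_real u))) \<le> real (card ?W) * thetaR u"
    proof (rule AE_I2)
      fix x assume "x \<in> space P"
      then have "norm (\<Sum>j\<in>?W. ctheta (zet k j x (of_real u))) \<le> (\<Sum>j\<in>?W. thetaR u)"
        using u of_real_in_dom[OF u] by (intro sum_norm_le ctheta_bound) auto
      then show "norm (\<Sum>j\<in>?W. ctheta (zet k j x (of_real u))) \<le> real (card ?W) * thetaR u" by simp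
    qed
  qed (unfold ctheta_def, measurable)
  then have "integrable P (\<lambda>x. complex_of_real (\<Sum>j\<in>?W. theta (rate (x(k := u)) j)))"
    by (rule Bochner_Integration.integrable_cong[THEN iffD1, rotated -1]) (simp_all add: eq)
  then show "integrable P (\<lambda>x. \<Sum>j\<in>?W. theta (rate (x(k := u)) j))"
    by (simp only: complex_of_real_integrable_eq)
qed

definition inflC :: "nat \<Rightarrow> complex \<Rightarrow> complex" where
  "inflC n u = (\<Sum>k\<in>{1 - int L..int n}. thetaC {1..int n} k u - scoreC {1..int n} k u) / of_nat n"

lemma block_length: "n \<ge> 1 \<Longrightarrow> real (n + L) \<le> real n * (1 + real L)"
  by (simp add: distrib_left mult_le_cancel_right1)

lemma inflC_holomorphic: "inflC n holomorphic_on dom"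
  unfolding inflC_def[abs_def] divide_inverse
  by (intro holomorphic_intros thetaC_holomorphic_bound holomorphic_on_subset[OF scoreC_holomorphic_bound(1)]) auto

lemma inflC_bound:
  assumes u: "u \<in> dom" "norm u \<le> R" and n: "n \<ge> 1"
  shows "norm (inflC n u) \<le> (1 + real L) * ((real L + 1) * thetaR R + exp (2 * R) ^ (L + 1) * ((real L + 1) * c * (M + R)))"
proof -
  let ?B = "(real L + 1) * thetaR R + exp (2 * R) ^ (L + 1) * ((real L + 1) * c * (M + R))"
  have t: "norm (thetaC {1..int n} k u - scoreC {1..int n} k u) \<le> ?B" for k
    using norm_triangle_ineq4[of "thetaC {1..int n} k u" "scoreC {1..int n} k u"]
      thetaC_holomorphic_bound(2)[OF u, of "{1..int n}" k] scoreC_holomorphic_bound(2)[OF _ u(2), of "{1..int n}" k] by simp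
  have B: "0 \<le> ?B" using t[of 0] norm_ge_zero order_trans by blast
  have "norm (\<Sum>k\<in>{1 - int L..int n}. thetaC {1..int n} k u - scoreC {1..int n} k u) \<le> (\<Sum>k\<in>{1 - int L..int n}. ?B)"
    by (rule sum_norm_le) (rule t)
  also have "\<dots> = real (n + L) * ?B" by simp
  also have "\<dots> \<le> (real n * (1 + real L)) * ?B"
    using block_length[OF n] B by (rule mult_right_mono)
  finally have "norm (inflC n u) \<le> real n * (1 + real L) * ?B / real n"
    unfolding inflC_def norm_divide norm_of_nat by (rule divide_right_mono) simp
  also have "\<dots> = (1 + real L) * ?B" using n by (simp only: mult.assoc) simp
  finally show ?thesis .
qed

lemma inflC_real:
  assumes u: "u \<in> space F" shows "inflC n (of_real u) = of_real (infl n u)"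
proof -
  have u0: "0 \<le> u" using u by (simp add: space_F)
  have "thetaC {1..int n} k (of_real u) - scoreC {1..int n} k (of_real u) = of_real (\<integral>x. PsiW {1..int n} k (x(k := u)) \<partial>P)" for k
    unfolding PsiW_def using thetaC_real[OF u0, where J = "{1..int n}" and k = k] wscore_pair(4)[OF _ u0, where J = "{1..int n}" and k = k]
      scoreC_real[OF _ u0, where J = "{1..int n}" and k = k]
    by simp
  then show ?thesis unfolding inflC_def infl_def by simp
qed

text \<open>For an input \<open>u\<close> at a time \<open>k\<close> in the block, the output at
  \<open>k\<close> has rate at least \<open>h 0 * u\<close>, and the tangent line at
  \<open>\<alpha>\<close> turns this into the slope \<open>h 0 * ln \<alpha>\<close>. The scores
  cost at most a linear term whose coefficient does not depend on \<open>\<alpha>\<close>, so a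
  large \<open>\<alpha>\<close> wins. All constants are uniform in \<open>n\<close> and survive a
  limit.\<close>

lemma inflC_growth:
  assumes u: "0 \<le> u" and \<alpha>: "1 \<le> \<alpha>" and n: "n \<ge> 1"
  shows "h 0 * u * ln \<alpha> - \<alpha> - (1 + real L) * ((real L + 1) * c * (M + u)) \<le> Re (inflC n (of_real u))"
proof -
  let ?J = "{1..int n}" and ?K = "{1 - int L..int n}"
  let ?s = "(real L + 1) * c * (M + u)"
  have s0: "0 \<le> ?s" using c_nonneg M_pos u by simp
  have l0: "0 \<le> ln \<alpha>" using \<alpha> by simp
  have sc: "Re (scoreC ?J k (of_real u)) \<le> ?s" for k
  proof -
    have "Re (scoreC ?J k (of_real u)) = (\<integral>(x, y). kap ?J (x(k := u)) y * wscore ?J k y \<partial>base)"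
      using scoreC_real[OF _ u, where J = ?J and k = k] wscore_pair(5)[OF _ u, where J = ?J and k = k] by simp
    also have "\<dots> \<le> (\<integral>(x, y). kap ?J (x(k := u)) y * \<bar>wscore ?J k y\<bar> \<partial>base)"
    proof (rule integral_mono)
      fix w assume "w \<in> space base"
      then have "0 \<le> kap ?J ((fst w)(k := u)) (snd w)"
        using u by (intro less_imp_le[OF kap_pos]) (auto simp: space_pair_measure space_input)
      then show "(case w of (x, y) \<Rightarrow> kap ?J (x(k := u)) y * wscore ?J k y) \<le> (case w of (x, y) \<Rightarrow> kap ?J (x(k := u)) y * \<bar>wscore ?J k y\<bar>)"
        by (auto simp: split_beta' intro!: mult_left_mono)
    qed (use wscore_pair(1,2)[OF _ u] in auto)
    also have "\<dots> \<le> ?s" by (rule wscore_pair(3)[OF _ u]) simp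
    finally show ?thesis .
  qed
  have pos: "0 < rate (x(k := u)) j" if "x \<in> inputs" for x k j
    by (rule rate_pos) (use that u in \<open>auto simp: space_input\<close>)
  \<comment> \<open>An input at a time \<open>k <= 0\<close> precedes the block and its own output
    is not part of it; there only \<open>theta >= 0\<close> is used.\<close>
  have th: "(if k \<in> ?J then h 0 * u * ln \<alpha> - \<alpha> else 0) \<le> Re (thetaC ?J k (of_real u))" for k
  proof -
    have "(if k \<in> ?J then h 0 * u * ln \<alpha> - \<alpha> else 0) \<le> (\<integral>x. (\<Sum>j\<in>?J \<inter> {k..k + int L}. theta (rate (x(k := u)) j)) \<partial>P)"
    proof (rule P.integral_ge_const[OF thetaC_real(2)[OF u]], rule AE_I2)
      fix x assume "x \<in> space P"
      then have x: "x \<in> inputs" by simp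
      have nn: "0 \<le> theta (rate (x(k := u)) j)" for j by (rule theta_nonneg[OF pos[OF x]])
      show "(if k \<in> ?J then h 0 * u * ln \<alpha> - \<alpha> else 0) \<le> (\<Sum>j\<in>?J \<inter> {k..k + int L}. theta (rate (x(k := u)) j))"
      proof (cases "k \<in> ?J")
        case True
        have r: "h 0 * u \<le> rate (x(k := u)) k"
          using rate_upd[of k k x u] rate_bounds[OF upd0[OF x], of k k] by simp
        have "h 0 * u * ln \<alpha> - \<alpha> \<le> 1 + rate (x(k := u)) k * ln \<alpha> - \<alpha>"
          using mult_right_mono[OF r l0] by simp
        also have "\<dots> \<le> theta (rate (x(k := u)) k)" using theta_ge[OF pos[OF x]] \<alpha> by simp
        also have "\<dots> \<le> (\<Sum>j\<in>?J \<inter> {k..k + int L}. theta (rate (x(k := u)) j))"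
          using True nn by (intro member_le_sum) auto
        finally show ?thesis using True by simp
      next
        case False
        then show ?thesis using nn by (simp only: if_False) (intro sum_nonneg)
      qed
    qed
    then show ?thesis using thetaC_real(1)[OF u, where J = ?J and k = k] by simp
  qed
  have "real n * (h 0 * u * ln \<alpha> - \<alpha>) - real (n + L) * ?s = (\<Sum>k\<in>?K. (if k \<in> ?J then h 0 * u * ln \<alpha> - \<alpha> else 0) - ?s)"
  proof -
    have KJ: "?K \<inter> ?J = ?J" by auto
    have "(\<Sum>k\<in>?K. if k \<in> ?J then h 0 * u * ln \<alpha> - \<alpha> else 0) = (\<Sum>k\<in>?K \<inter> ?J. h 0 * u * ln \<alpha> - \<alpha>)"
      by (rule sum.inter_restrict[symmetric]) simp
    also have "\<dots> = real n * (h 0 * u * ln \<alpha> - \<alpha>)" unfolding KJ by simp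
    finally show ?thesis unfolding sum_subtractf by simp
  qed
  also have "\<dots> \<le> (\<Sum>k\<in>?K. Re (thetaC ?J k (of_real u) - scoreC ?J k (of_real u)))"
    using th sc by (intro sum_mono) (simp only: minus_complex.simps, intro diff_mono)
  finally have "(real n * (h 0 * u * ln \<alpha> - \<alpha>) - real (n + L) * ?s) / real n \<le> Re (inflC n (of_real u))"
    unfolding inflC_def by (simp add: divide_right_mono Re_divide_of_nat)
  moreover have "(h 0 * u * ln \<alpha> - \<alpha>) - (1 + real L) * ?s \<le> (real n * (h 0 * u * ln \<alpha> - \<alpha>) - real (n + L) * ?s) / real n"
  proof -
    have "real (n + L) * ?s \<le> real n * (1 + real L) * ?s"
      using block_length[OF n] s0 by (rule mult_right_mono)
    then have "real n * ((h 0 * u * ln \<alpha> - \<alpha>) - (1 + real L) * ?s) \<le> real n * (h 0 * u * ln \<alpha> - \<alpha>) - real (n + L) * ?s"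
      by (simp add: algebra_simps)
    then show ?thesis using n by (simp add: field_simps)
  qed
  ultimately show ?thesis by linarith
qed

end

section \<open>Finiteness of the support\<close>

text \<open>The set where \<open>f\<close> is nonzero is relatively open and null, so it contains no
  point of the support.\<close>

lemma closed_support_AE_zero:
  fixes f :: "real \<Rightarrow> real"
  assumes sp: "space F = {0..A}" and f: "continuous_on {0..A} f" and ae: "AE u in F. f u = 0" and s: "s \<in> closed_support F"
    and fm: "f \<in> borel_measurable F"
  shows "f s = 0"
proof (rule ccontr)
  assume ns: "f s \<noteq> 0"
  have sA: "s \<in> {0..A}" using s sp by (simp add: closed_support_def)
  obtain U where U: "open U" "U \<inter> {0..A} = f -` (- {0}) \<inter> {0..A}"
    using continuous_on_open_invariant[THEN iffD1, OF f, rule_format, of "- {0}"] by auto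
  have "s \<in> U" using U(2) ns sA by blast
  then have pos: "emeasure F (U \<inter> space F) > 0" using s U(1) by (simp add: closed_support_def)
  have e: "U \<inter> space F = {u \<in> space F. f u \<noteq> 0}" using U(2) sp by auto
  have "{u \<in> space F. f u \<noteq> 0} \<in> sets F" using fm by measurable
  then have "emeasure F (U \<inter> space F) = 0"
    using ae unfolding e by (subst (asm) AE_iff_measurable) auto
  then show False using pos by simp
qed

context poisson_input
begin

text \<open>If the variance about \<open>m\<close> vanished, the support would lie in
  \<open>{m}\<close>. Positivity allows the projection onto affine functions to be formed by
  division.\<close>

lemma infinite_support_variance:
  assumes inf: "infinite (closed_support F)"
  shows "(\<integral>u. (u - m)\<^sup>2 \<partial>F) > 0"
proof -
  have idm[measurable]: "(\<lambda>u. u) \<in> borel_measurable F"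
  proof -
    have "(\<lambda>u::real. u) \<in> borel_measurable (restrict_space borel {0..A})"
      by (rule measurable_restrict_space1) simp
    then show ?thesis using measurable_cong_sets[OF sets_F refl] by blast
  qed
  have int: "integrable F (\<lambda>u. (u - m)\<^sup>2)"
  proof (rule F.integrable_const_bound[where B = "(A + \<bar>m\<bar>)\<^sup>2"])
    show "AE u in F. norm ((u - m)\<^sup>2) \<le> (A + \<bar>m\<bar>)\<^sup>2"
      using A_nonneg by (intro AE_I2) (auto simp: space_F abs_le_square_iff[symmetric])
  qed measurable
  have nn: "0 \<le> (\<integral>u. (u - m)\<^sup>2 \<partial>F)" by simp
  moreover have "(\<integral>u. (u - m)\<^sup>2 \<partial>F) \<noteq> 0"
  proof
    assume "(\<integral>u. (u - m)\<^sup>2 \<partial>F) = 0"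
    then have ae: "AE u in F. u - m = 0"
      using integral_nonneg_eq_0_iff_AE[OF int] by simp
    have "closed_support F \<subseteq> {m}"
    proof
      fix s assume "s \<in> closed_support F"
      then have "s - m = 0"
        by (intro closed_support_AE_zero[OF space_F _ ae]) (auto intro!: continuous_intros)
      then show "s \<in> {m}" by simp
    qed
    then show False using inf finite_subset by blast
  qed
  ultimately show ?thesis by linarith
qed

text \<open>A subsequential limit of the holomorphic influence functions is affine on the support by
  stationarity, hence affine on the whole half plane if the support is infinite.  It grows at least like
  \<open>u ln u\<close> along the positive reals, though.\<close>

lemma finite_support_of_optimal:
  assumes opt: "\<And>G. G \<in> space (prob_algebra (restrict_space borel {0..A})) \<Longrightarrow> (\<integral>u. u \<partial>G) = (\<integral>u. u \<partial>F) \<Longrightarrow>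
      information_rate lam0 h L G \<le> information_rate lam0 h L F"
  shows "finite (closed_support F)"
proof (rule ccontr)
  assume inf: "infinite (closed_support F)"
  define BB where "BB R = (1 + real L) * ((real L + 1) * thetaR R + exp (2 * R) ^ (L + 1) * ((real L + 1) * c * (M + R)))" for R
  have bd: "norm (inflC (Suc n) u) \<le> BB R" if "u \<in> dom" "norm u \<le> R" for n u R
    unfolding BB_def using that by (intro inflC_bound) auto
  have comp_bd: "\<exists>B. \<forall>f\<in>range (\<lambda>n. inflC (Suc n)). \<forall>z\<in>K. norm (f z) \<le> B" if K: "compact K" "K \<subseteq> dom" for K
  proof -
    obtain R where "\<forall>z\<in>K. norm z \<le> R" using compact_imp_bounded[OF K(1)] bounded_iff by blast
    then show ?thesis using bd K(2) by (intro exI[of _ "BB R"]) blast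
  qed
  obtain \<Lambda> r where hol: "\<Lambda> holomorphic_on dom" and r: "strict_mono (r :: nat \<Rightarrow> nat)"
    and lim: "\<And>x. x \<in> dom \<Longrightarrow> (\<lambda>n. inflC (Suc (r n)) x) \<longlonglongrightarrow> \<Lambda> x"
  proof (rule Montel[where S = dom and \<H> = "range (\<lambda>n. inflC (Suc n))" and \<F> = "\<lambda>n. inflC (Suc n)"])
    show "open dom" by (rule open_dom)
    show "f holomorphic_on dom" if "f \<in> range (\<lambda>n. inflC (Suc n))" for f
      using that inflC_holomorphic by auto
    show "\<exists>B. \<forall>f\<in>range (\<lambda>n. inflC (Suc n)). \<forall>z\<in>K. norm (f z) \<le> B" if "compact K" "K \<subseteq> dom" for K
      using that by (rule comp_bd)
    fix \<Lambda> r
    assume "\<Lambda> holomorphic_on dom" "strict_mono (r :: nat \<Rightarrow> nat)"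
      "\<And>x. x \<in> dom \<Longrightarrow> (\<lambda>n. inflC (Suc (r n)) x) \<longlonglongrightarrow> \<Lambda> x"
    then show thesis by (rule that)
  qed simp
  define \<iota> where "\<iota> u = Re (\<Lambda> (of_real u))" for u
  have in_dom: "complex_of_real u \<in> dom" if "u \<in> {0..A}" for u using that of_real_in_dom by simp
  have lim\<iota>: "(\<lambda>n. infl (Suc (r n)) u) \<longlonglongrightarrow> \<iota> u" if u: "u \<in> space F" for u
    using tendsto_Re[OF lim[OF in_dom[of u]]] u unfolding \<iota>_def by (simp add: inflC_real[OF u] space_F)
  have \<Lambda>_real: "\<Lambda> (of_real u) = of_real (\<iota> u)" if u: "u \<in> space F" for u
  proof -
    have "(\<lambda>n. 0) \<longlonglongrightarrow> Im (\<Lambda> (of_real u))"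
      using tendsto_Im[OF lim[OF in_dom[of u]]] u by (simp add: inflC_real[OF u] space_F)
    then have "Im (\<Lambda> (of_real u)) = 0" using LIMSEQ_unique tendsto_const by blast
    then show ?thesis by (simp add: \<iota>_def complex_eq_iff)
  qed
  have infl_bd: "\<bar>infl (Suc n) u\<bar> \<le> BB A" if u: "u \<in> space F" for n u
    using bd[OF in_dom, of u A n] u unfolding inflC_real[OF u] by (simp add: space_F)
  have \<iota>bd: "\<bar>\<iota> u\<bar> \<le> BB A" if u: "u \<in> space F" for u
    using infl_bd[OF u] by (intro LIMSEQ_le_const2[OF tendsto_rabs[OF lim\<iota>[OF u]]]) auto
  have \<iota>cont: "continuous_on {0..A} \<iota>"
  proof -
    have "continuous_on {0..A} (\<Lambda> \<circ> of_real)"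
      using in_dom by (intro continuous_on_compose continuous_intros continuous_on_subset[OF holomorphic_on_imp_continuous_on[OF hol]]) auto
    then show ?thesis unfolding \<iota>_def o_def by (intro continuous_intros)
  qed
  have F_meas: "f \<in> borel_measurable F" if "f \<in> borel_measurable (restrict_space borel {0..A})" for f :: "real \<Rightarrow> real"
    using that measurable_cong_sets[OF sets_F refl] by blast
  have cont_meas: "f \<in> borel_measurable (restrict_space borel {0..A})" if "continuous_on {0..A} f" for f :: "real \<Rightarrow> real"
    using that by (rule borel_measurable_continuous_on_restrict)
  have cont_int: "integrable F f" if f: "continuous_on {0..A} f" for f :: "real \<Rightarrow> real"
  proof -
    have "bounded (f ` {0..A})" using f compact_continuous_image compact_imp_bounded by blast
    then obtain C where "\<forall>u\<in>{0..A}. norm (f u) \<le> C" by (auto simp: bounded_iff)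
    then show ?thesis using F_meas[OF cont_meas[OF f]]
      by (intro F.integrable_const_bound[where B = C] AE_I2) (auto simp: space_F)
  qed
  define m where "m = (\<integral>u. u \<partial>F)"
  define v where "v = (\<integral>u. (u - m)\<^sup>2 \<partial>F)"
  have v: "v > 0" unfolding v_def by (rule infinite_support_variance[OF inf])
  \<comment> \<open>\<open>i0 + b0 * (u - m)\<close> is the orthogonal projection of
    \<open>\<iota>\<close> onto the affine functions in the square-integrable functions of
    \<open>F\<close>; the residual \<open>g\<close> is the direction of perturbation.\<close>
  define i0 where "i0 = (\<integral>u. \<iota> u \<partial>F)"
  define b0 where "b0 = (\<integral>u. \<iota> u * (u - m) \<partial>F) / v"
  define g where "g u = \<iota> u - i0 - b0 * (u - m)" for u
  have gc: "continuous_on {0..A} g" unfolding g_def by (intro continuous_intros \<iota>cont)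
  have ci: "continuous_on {0..A} (\<lambda>u. u - m)" "continuous_on {0..A} (\<lambda>u. (u - m)\<^sup>2)"
      "continuous_on {0..A} (\<lambda>u. \<iota> u * (u - m))" "continuous_on {0..A} (\<lambda>u. g u * (u - m))"
      "continuous_on {0..A} (\<lambda>u. g u * \<iota> u)" "continuous_on {0..A} (\<lambda>u. u)" "continuous_on {0..A} (\<lambda>u. (g u)\<^sup>2)"
    by (intro continuous_intros \<iota>cont gc)+
  note ii = ci[THEN cont_int] cont_int[OF gc] cont_int[OF \<iota>cont]
  have um: "(\<integral>u. u - m \<partial>F) = 0" using ii(6) F.prob_space by (simp add: m_def)
  have g0: "(\<integral>u. g u \<partial>F) = 0"
  proof -
    have "(\<integral>u. g u \<partial>F) = (\<integral>u. \<iota> u \<partial>F) - i0 - b0 * (\<integral>u. u - m \<partial>F)"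
      unfolding g_def using ii F.prob_space by simp
    then show ?thesis by (simp add: um i0_def)
  qed
  have gm: "(\<integral>u. g u * (u - m) \<partial>F) = 0"
  proof -
    have "(\<integral>u. g u * (u - m) \<partial>F) = (\<integral>u. \<iota> u * (u - m) - i0 * (u - m) - b0 * (u - m)\<^sup>2 \<partial>F)"
      unfolding g_def by (simp add: algebra_simps power2_eq_square)
    also have "\<dots> = (\<integral>u. \<iota> u * (u - m) \<partial>F) - i0 * (\<integral>u. u - m \<partial>F) - b0 * v"
      unfolding v_def using ii(1,2,3) by simp
    also have "\<dots> = 0" using v unfolding um by (simp add: b0_def)
    finally show ?thesis .
  qed
  have g1: "(\<integral>u. u * g u \<partial>F) = 0"
  proof -
    have "(\<integral>u. u * g u \<partial>F) = (\<integral>u. g u * (u - m) + m * g u \<partial>F)" by (simp add: algebra_simps)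
    also have "\<dots> = 0" using ii g0 gm by simp
    finally show ?thesis .
  qed
  obtain B where B: "\<And>u. 0 \<le> u \<Longrightarrow> u \<le> A \<Longrightarrow> \<bar>g u\<bar> \<le> B"
  proof -
    have "bounded (g ` {0..A})" using gc compact_continuous_image compact_imp_bounded by blast
    then obtain C where "\<forall>u\<in>{0..A}. norm (g u) \<le> C" by (auto simp: bounded_iff)
    then show thesis by (intro that[of C]) auto
  qed
  \<comment> \<open>The direction \<open>g\<close> is built from the subsequential limit but does
    not vary with \<open>n\<close>; stationarity holds along the whole sequence, hence also along
    the subsequence.\<close>
  have stat: "(\<lambda>n. \<integral>u. g u * infl n u \<partial>F) \<longlonglongrightarrow> 0"
    by (rule infl_stationary[OF cont_meas[OF gc] B g0 g1 opt])
  have "strict_mono (\<lambda>n. Suc (r n))" using r by (simp add: strict_mono_def)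
  from LIMSEQ_subseq_LIMSEQ[OF stat this]
  have stat': "(\<lambda>n. \<integral>u. g u * infl (Suc (r n)) u \<partial>F) \<longlonglongrightarrow> 0" by (simp add: o_def)
  have B0: "0 \<le> B" using B[of 0] A_nonneg by simp
  have infl_m: "infl n \<in> borel_measurable F" for n
    unfolding infl_def[abs_def] by (intro borel_measurable_divide borel_measurable_sum infl_term_measurable borel_measurable_const) simp
  have "(\<lambda>n. \<integral>u. g u * infl (Suc (r n)) u \<partial>F) \<longlonglongrightarrow> (\<integral>u. g u * \<iota> u \<partial>F)"
  proof (rule integral_dominated_convergence[where w = "\<lambda>_. B * BB A"])
    show "(\<lambda>u. g u * \<iota> u) \<in> borel_measurable F" by (rule F_meas[OF cont_meas[OF ci(5)]])
    show "(\<lambda>u. g u * infl (Suc (r n)) u) \<in> borel_measurable F" for n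
      using F_meas[OF cont_meas[OF gc]] infl_m by (rule borel_measurable_times)
    show "AE u in F. (\<lambda>n. g u * infl (Suc (r n)) u) \<longlonglongrightarrow> g u * \<iota> u"
      using lim\<iota> by (intro AE_I2 tendsto_intros)
    show "AE u in F. norm (g u * infl (Suc (r n)) u) \<le> B * BB A" for n
      using B infl_bd B0 by (intro AE_I2) (auto simp: abs_mult space_F intro!: mult_mono)
  qed simp
  then have g\<iota>: "(\<integral>u. g u * \<iota> u \<partial>F) = 0" using stat' LIMSEQ_unique by blast
  \<comment> \<open>Since \<open>g\<close> is orthogonal to the affine functions, its squared norm
    equals its inner product with \<open>\<iota>\<close>, which stationarity makes zero.\<close>
  have "(\<integral>u. (g u)\<^sup>2 \<partial>F) = (\<integral>u. g u * \<iota> u - i0 * g u - b0 * (g u * (u - m)) \<partial>F)"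
    by (rule Bochner_Integration.integral_cong[OF refl]) (simp add: power2_eq_square g_def algebra_simps)
  also have "\<dots> = 0" using ii(4,5,8) g\<iota> g0 gm by simp
  finally have "AE u in F. (g u)\<^sup>2 = 0"
    using integral_nonneg_eq_0_iff_AE[OF ii(7)] by simp
  then have ae: "AE u in F. g u = 0" by simp
  have supp0: "g s = 0" if "s \<in> closed_support F" for s
    by (rule closed_support_AE_zero[OF space_F gc ae that F_meas[OF cont_meas[OF gc]]])
  have suppA: "closed_support F \<subseteq> {0..A}" using space_F by (auto simp: closed_support_def)
  define f where "f z = \<Lambda> z - of_real i0 - of_real b0 * (z - of_real m)" for z
  have fhol: "f holomorphic_on dom" unfolding f_def by (intro holomorphic_intros hol)
  let ?T = "complex_of_real ` closed_support F"
  have T0: "f z = 0" if z: "z \<in> ?T" for z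
  proof -
    obtain s where s: "s \<in> closed_support F" "z = of_real s" using z by blast
    have "f z = of_real (g s)"
      using \<Lambda>_real[of s] s suppA by (auto simp: f_def g_def space_F)
    then show ?thesis using supp0[OF s(1)] by simp
  qed
  have "infinite ?T" using inf by (simp add: finite_image_iff inj_on_def)
  moreover have "compact (complex_of_real ` {0..A})"
    by (intro compact_continuous_image continuous_intros) simp
  \<comment> \<open>The accumulation point lies in \<open>[0,A]\<close>, in the interior of
    \<open>dom\<close>, so the identity theorem applies to \<open>f\<close>.\<close>
  ultimately obtain \<xi> where \<xi>: "\<xi> \<in> complex_of_real ` {0..A}" "\<xi> islimpt ?T"
    using suppA by (meson compact_eq_Bolzano_Weierstrass image_mono)
  have zero: "f w = 0" if "w \<in> dom" for w
    by (rule analytic_continuation[OF fhol open_dom convex_connected[OF convex_dom] _ _ \<xi>(2) T0 that])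
       (use \<xi>(1) suppA in_dom in auto)
  define K where "K = (1 + real L) * ((real L + 1) * c)"
  have K: "0 \<le> K" unfolding K_def using c_nonneg by simp
  \<comment> \<open>With \<open>\<alpha> = exp l\<close> the slope \<open>h 0 * l\<close> exceeds by
    exactly 1 the slope \<open>K\<close> of the scores plus the absolute slope of the affine
    limit.\<close>
  define l where "l = (K + \<bar>b0\<bar> + 1) / h 0"
  have l: "0 \<le> l" "h 0 * l = K + \<bar>b0\<bar> + 1" unfolding l_def using h0_pos K by auto
  have growth: "h 0 * u * l - exp l - K * (M + u) \<le> i0 + b0 * (u - m)" if u: "0 \<le> u" for u
  proof -
    have "h 0 * u * ln (exp l) - exp l - (1 + real L) * ((real L + 1) * c * (M + u)) \<le> Re (\<Lambda> (of_real u))"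
      by (rule LIMSEQ_le_const[OF tendsto_Re[OF lim[OF of_real_in_dom[OF u]]]])
         (intro exI[of _ 0] allI impI inflC_growth, use u l in auto)
    moreover have "Re (\<Lambda> (of_real u)) = i0 + b0 * (u - m)"
      using zero[OF of_real_in_dom[OF u]] by (simp add: f_def complex_eq_iff)
    ultimately show ?thesis by (simp add: K_def mult.assoc)
  qed
  \<comment> \<open>One more than an upper bound of all the constant terms, so that the slope excess
    of 1 gives \<open>u <= u - 1\<close>.\<close>
  define u where "u = \<bar>i0\<bar> + \<bar>b0 * m\<bar> + exp l + K * M + 1"
  have u0: "0 \<le> u" unfolding u_def using K M_pos by simp
  have "h 0 * u * l = u * (K + \<bar>b0\<bar> + 1)" using l(2) by (metis mult.commute mult.left_commute)
  then have "u + u * \<bar>b0\<bar> - exp l - K * M \<le> i0 + b0 * u - b0 * m"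
    using growth[OF u0] by (simp add: algebra_simps)
  moreover have "b0 * u \<le> u * \<bar>b0\<bar>" using u0 mult_right_mono[of b0 "\<bar>b0\<bar>" u] by (simp add: mult.commute)
  ultimately have "u \<le> i0 - b0 * m + exp l + K * M" by linarith
  then show False unfolding u_def by linarith
qed

end

theorem theorem1:
  fixes L :: nat and lam0 A Pavg :: real and h :: "nat \<Rightarrow> real" and F :: "real measure"
  assumes "lam0 > 0"
    and "h 0 > 0"
    and "\<And>l. 1 \<le> l \<Longrightarrow> l \<le> L \<Longrightarrow> h l \<ge> 0"
    and "(\<Sum>l\<le>L. h l) = 1"
    and "A \<ge> 0"
    and "Pavg \<ge> 0"
    and "F \<in> input_laws A Pavg"
    and "\<And>G. G \<in> input_laws A Pavg \<Longrightarrow> information_rate lam0 h L G \<le> information_rate lam0 h L F"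
  shows "finite (closed_support F)"
proof -
  have h: "h l \<ge> 0" if "l \<le> L" for l
    using assms(2) assms(3)[of l] that by (cases "l = 0") auto
  interpret poisson_input L lam0 A h F
    by unfold_locales (use assms h in \<open>auto simp: input_laws_def\<close>)
  \<comment> \<open>A law with the mean of \<open>F\<close> satisfies the average constraint because
    \<open>F\<close> does, so optimality covers every mean-preserving competitor.\<close>
  show ?thesis
    using assms(7,8) by (intro finite_support_of_optimal) (auto simp: input_laws_def)
qed

end
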